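(* Let $u\in\mathbb C^\times$, $N\in\mathbb Z$. The following assignment gives a level $(1,N)$ representation of $\mathcal U_{q,t,p}$ on the Fock space $\mathcal F^{(1,N)}_u$: $$x^+(z)=uz^{-N}(t/q)^{3N/4}\exp\Big\{-\sum_{n>0}\tfrac{(t/q)^{n/4}}{1-(t/q)^n}\alpha_{-n}z^n\Big\}\exp\Big\{\sum_{n>0}\tfrac{(t/q)^{3n/4}}{1-(t/q)^n}\alpha_nz^{-n}\Big\},$$ $$x^-(z)=u^{-1}z^N(t/q)^{-3N/4}\exp\Big\{\sum_{n>0}\tfrac{(t/q)^{n/4}}{1-(t/q)^n}\alpha'_{-n}z^n\Big\}\exp\Big\{-\sum_{n>0}\tfrac{(t/q)^{3n/4}}{1-(t/q)^n}\alpha'_nz^{-n}\Big\},$$ $$\psi^+(z)=(t/q)^{-N/2}\exp\Big\{-\sum_{n>0}\tfrac{p^n(t/q)^{-n/4}}{1-p^n}\alpha_{-n}z^n\Big\}\exp\Big\{\sum_{n>0}\tfrac{(t/q)^{n/4}}{1-p^n}\alpha_nz^{-n}\Big\},$$ $$\psi^-(z)=(t/q)^{N/2}\exp\Big\{-\sum_{n>0}\tfrac{(t/q)^{n/4}}{1-p^n}\alpha_{-n}z^n\Big\}\exp\Big\{\sum_{n>0}\tfrac{p^n(t/q)^{-n/4}}{1-p^n}\alpha_nz^{-n}\Big\}.$$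
   Context: Let $q,t\in\mathbb C^\times$ with $q,t,q/t$ not roots of unity. Set $\kappa_m=(1-q^m)(1-t^{-m})(1-(t/q)^m)$, $G^{\pm}(z)=(1-q^{\pm1}z)(1-t^{\mp1}z)(1-(q/t)^{\mp1}z)$, $\delta(z)=\sum_{n\in\mathbb Z}z^n$, $g(z;s)=\exp\big(\sum_{m>0}\frac{\kappa_m}{m}\frac{s^m}{1-s^m}z^m\big)$. The elliptic quantum toroidal algebra $\mathcal U_{q,t,p}=U_{q,t,p}(\mathfrak{gl}_{1,tor})$ is generated by $\alpha_m$ ($m\in\mathbb Z\setminus\{0\}$), $x^\pm_n$ ($n\in\mathbb Z$) and invertible elements $\psi_0^\pm,\gamma^{1/2}$. Put $p^*=p\gamma^{-2}$, $x^\pm(z)=\sum_n x^\pm_nz^{-n}$, $$\psi^+(z)=\psi_0^+\exp\Big(-\sum_{m>0}\tfrac{p^m}{1-p^m}\alpha_{-m}(\gamma^{-1/2}z)^m\Big)\exp\Big(\sum_{m>0}\tfrac{1}{1-p^m}\alpha_m(\gamma^{-1/2}z)^{-m}\Big),$$ $$\psi^-(z)=\psi_0^-\exp\Big(-\sum_{m>0}\tfrac{1}{1-p^m}\alpha_{-m}(\gamma^{1/2}z)^m\Big)\exp\Big(\sum_{m>0}\tfrac{p^m}{1-p^m}\alpha_m(\gamma^{1/2}z)^{-m}\Big).$$ Defining relations: $\psi_0^\pm,\gamma^{1/2}$ central; $[\alpha_m,\alpha_n]=-\frac{\kappa_m}{m}(\gamma^m-\gamma^{-m})\gamma^{-m}\frac{1-p^m}{1-p^{*m}}\delta_{m+n,0}$;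 $[\alpha_m,x^+(z)]=-\frac{\kappa_m}{m}\frac{1-p^m}{1-p^{*m}}\gamma^{-3m/2}z^mx^+(z)$; $[\alpha_m,x^-(z)]=\frac{\kappa_m}{m}\gamma^{-m/2}z^mx^-(z)$; $[x^+(z),x^-(w)]=\frac{(1-q)(1-1/t)}{1-q/t}\big(\delta(\gamma^{-1}z/w)\psi^+(w)-\delta(\gamma z/w)\psi^-(\gamma^{-1}w)\big)$; $z^3G^+(w/z)g(w/z;p^* )x^+(z)x^+(w)=-w^3G^+(z/w)g(z/w;p^* )x^+(w)x^+(z)$; $z^3G^-(w/z)g(w/z;p)^{-1}x^-(z)x^-(w)=-w^3G^-(z/w)g(z/w;p)^{-1}x^-(w)x^-(z)$; $g(w/z;p^* )g(u/w;p^* )g(u/z;p^* )\big(\frac wu+\frac wz-\frac zw-\frac uw\big)x^+(z)x^+(w)x^+(u)+$ permutations in $z,w,u$ $=0$; $g(w/z;p)^{-1}g(u/w;p)^{-1}g(u/z;p)^{-1}\big(\frac wu+\frac wz-\frac zw-\frac uw\big)x^-(z)x^-(w)x^-(u)+$ permutations in $z,w,u$ $=0$. On modules, $p$ and $p^*$ are regarded as generic complex numbers with $|p|<1,|p^*|<1$ (or formal). A module has level $(k,l)$ if $\gamma^{1/2}$ acts as $(t/q)^{k/4}$ and $\psi_0^+$ as $(t/q)^{-l/2}$. $\mathcal F^{(1,N)}_u=\mathbb C[\alpha_{-m}\,(m>0)]\,1^{(N)}_u$ is the Fock space on which $\gamma^{1/2}$ acts as $(t/q)^{1/4}$ (so $p^*=pq/t$),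 $\psi_0^+$ acts as $(t/q)^{-N/2}$, $\alpha_m1^{(N)}_u=0$ for $m>0$, $\alpha_{-m}$ acts by multiplication and $\alpha_m$ acts as $-\frac{\kappa_m}{m}(1-(q/t)^m)\frac{1-p^m}{1-p^{*m}}\frac{\partial}{\partial\alpha_{-m}}$ ($m>0$). Finally $\alpha'_m=\frac{1-p^{*m}}{1-p^m}\gamma^m\alpha_m$ with $\gamma=(t/q)^{1/2}$. *)

theory Defs
  imports
    Complex_Main
    "HOL-Library.Groups_Big_Fun"
    "HOL-Library.Poly_Mapping"
    "HOL-Computational_Algebra.Formal_Power_Series"
begin

section \<open>Structure functions\<close>

definition kappa :: "complex \<Rightarrow> complex \<Rightarrow> int \<Rightarrow> complex" where
  "kappa q t m = (1 - q powi m) * (1 - t powi (- m)) * (1 - (t / q) powi m)"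

text \<open>\<open>G\<^sup>+\<close> is \<open>G_series q t\<close>; \<open>G\<^sup>-\<close> is \<open>G_series (1/q) (1/t)\<close>.\<close>

definition G_series :: "complex \<Rightarrow> complex \<Rightarrow> complex fps" where
  "G_series q t =
     (1 - fps_const q * fps_X) * (1 - fps_const (1 / t) * fps_X) * (1 - fps_const (1 / (q / t)) * fps_X)"

definition g_series :: "complex \<Rightarrow> complex \<Rightarrow> complex \<Rightarrow> complex fps" where
  "g_series q t s =
     fps_exp 1 oo Abs_fps (\<lambda>m. if m = 0 then 0
       else kappa q t (int m) / of_nat m * (s ^ m / (1 - s ^ m)))"


section \<open>Operator-valued formal series\<close>

text \<open>
  A formal series in \<open>z\<^sup>\<plusminus>\<^sup>1\<close> with operator coefficients is given by the function that sends
  \<open>a :: int\<close> to the coefficient of \<open>z\<^sup>a\<close>; likewise in two and three variables. \<open>current X\<close>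
  is \<open>X(z) = \<Sum>\<^sub>n X\<^sub>n z\<^sup>-\<^sup>n\<close>. Infinite sums of vectors are sums of families with finite support
  (\<^const>\<open>Sum_any\<close> is 0 on a family with infinite support, but the smoothness axioms of the
  locale below exclude that case for every sum that is used).
\<close>

definition current :: "(int \<Rightarrow> 'v \<Rightarrow> 'v) \<Rightarrow> int \<Rightarrow> 'v \<Rightarrow> 'v" where
  "current X a = X (- a)"

text \<open>\<open>series_power A j k\<close> is the coefficient of \<open>z\<^sup>k\<close> in \<open>(\<Sum>\<^sub>m\<^sub>>\<^sub>0 A\<^sub>m z\<^sup>m)\<^sup>j\<close>, and
  \<open>exp_coeff scale A k\<close> the one in \<open>exp (\<Sum>\<^sub>m\<^sub>>\<^sub>0 A\<^sub>m z\<^sup>m)\<close>; powers with \<open>j > k\<close> do not contribute to the latter.\<close>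

primrec series_power ::
  "(nat \<Rightarrow> 'v \<Rightarrow> 'v) \<Rightarrow> nat \<Rightarrow> nat \<Rightarrow> 'v \<Rightarrow> 'v::ab_group_add" where
  "series_power A 0 k v = (if k = 0 then v else 0)"
| "series_power A (Suc j) k v = (\<Sum>m = 1..k. A m (series_power A j (k - m) v))"

definition exp_coeff ::
  "(complex \<Rightarrow> 'v \<Rightarrow> 'v) \<Rightarrow> (nat \<Rightarrow> 'v \<Rightarrow> 'v) \<Rightarrow> nat \<Rightarrow> 'v \<Rightarrow> 'v::ab_group_add" where
  "exp_coeff scale A k v = (\<Sum>j\<le>k. scale (1 / fact j) (series_power A j k v))"

text \<open>Coefficient of \<open>z\<^sup>a\<close> in \<open>exp (\<Sum>\<^sub>m\<^sub>>\<^sub>0 A\<^sub>m z\<^sup>m) exp (\<Sum>\<^sub>m\<^sub>>\<^sub>0 B\<^sub>m z\<^sup>-\<^sup>m)\<close>.\<close>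

definition vertex ::
  "(complex \<Rightarrow> 'v \<Rightarrow> 'v) \<Rightarrow> (nat \<Rightarrow> 'v \<Rightarrow> 'v) \<Rightarrow> (nat \<Rightarrow> 'v \<Rightarrow> 'v) \<Rightarrow> int \<Rightarrow> 'v \<Rightarrow> 'v::ab_group_add" where
  "vertex scale A B a v = Sum_any (\<lambda>l::nat.
     if a + int l \<ge> 0 then exp_coeff scale A (nat (a + int l)) (exp_coeff scale B l v) else 0)"

text \<open>Coefficient of \<open>z\<^sup>a w\<^sup>b\<close> in \<open>\<delta>(s z/w) \<Psi>(w)\<close>, where \<open>\<delta>(z) = \<Sum>\<^sub>n z\<^sup>n\<close>: only \<open>n = a\<close> contributes.\<close>

definition delta_mult ::
  "(complex \<Rightarrow> 'v \<Rightarrow> 'v) \<Rightarrow> complex \<Rightarrow> (int \<Rightarrow> 'v) \<Rightarrow> int \<Rightarrow> int \<Rightarrow> 'v" where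
  "delta_mult scale s \<Psi> a b = scale (s powi a) (\<Psi> (a + b))"

text \<open>Coefficient of \<open>z\<^sup>a w\<^sup>b\<close> in \<open>f(w/z) X(z) X(w) v\<close>.\<close>

definition ratio_mult ::
  "(complex \<Rightarrow> 'v \<Rightarrow> 'v) \<Rightarrow> complex fps \<Rightarrow> (int \<Rightarrow> 'v \<Rightarrow> 'v) \<Rightarrow> 'v \<Rightarrow> int \<Rightarrow> int \<Rightarrow> 'v::ab_group_add" where
  "ratio_mult scale f X v a b = Sum_any (\<lambda>k::nat.
     scale (fps_nth f k) (X (a + int k) (X (b - int k) v)))"

text \<open>Coefficient of \<open>z\<^sup>a w\<^sup>b u\<^sup>c\<close> in \<open>(w/u + w/z - z/w - u/w) X(z) X(w) X(u) v\<close>, and then in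
  the product of that series with \<open>f(w/z) f(u/w) f(u/z)\<close>.\<close>

definition serre_core ::
  "(int \<Rightarrow> 'v \<Rightarrow> 'v) \<Rightarrow> 'v \<Rightarrow> int \<Rightarrow> int \<Rightarrow> int \<Rightarrow> 'v::ab_group_add" where
  "serre_core X v a b c =
     X a (X (b - 1) (X (c + 1) v)) + X (a + 1) (X (b - 1) (X c v))
     - X (a - 1) (X (b + 1) (X c v)) - X a (X (b + 1) (X (c - 1) v))"

definition serre_term ::
  "(complex \<Rightarrow> 'v \<Rightarrow> 'v) \<Rightarrow> complex fps \<Rightarrow> (int \<Rightarrow> 'v \<Rightarrow> 'v) \<Rightarrow> 'v \<Rightarrow> int \<Rightarrow> int \<Rightarrow> int \<Rightarrow> 'v::ab_group_add" where
  "serre_term scale f X v a b c = Sum_any (\<lambda>(i::nat, j::nat, k::nat).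
     scale (fps_nth f i * fps_nth f j * fps_nth f k)
       (serre_core X v (a + int i + int k) (b - int i + int j) (c - int j - int k)))"

definition serre_sum ::
  "(complex \<Rightarrow> 'v \<Rightarrow> 'v) \<Rightarrow> complex fps \<Rightarrow> (int \<Rightarrow> 'v \<Rightarrow> 'v) \<Rightarrow> 'v \<Rightarrow> int \<Rightarrow> int \<Rightarrow> int \<Rightarrow> 'v::ab_group_add" where
  "serre_sum scale f X v a b c =
     serre_term scale f X v a b c + serre_term scale f X v a c b +
     serre_term scale f X v b a c + serre_term scale f X v b c a +
     serre_term scale f X v c a b + serre_term scale f X v c b a"


section \<open>Modules over the elliptic quantum toroidal algebra\<close>

text \<open>The currents \<open>\<psi>\<^sup>\<plusminus>(z)\<close> as expressions in the generators; \<open>c\<close> is the scalar by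
  which \<open>\<gamma>\<^sup>1\<^sup>/\<^sup>2\<close> acts.\<close>

definition psi_plus ::
  "(complex \<Rightarrow> 'v \<Rightarrow> 'v) \<Rightarrow> complex \<Rightarrow> complex \<Rightarrow> ('v \<Rightarrow> 'v) \<Rightarrow> (int \<Rightarrow> 'v \<Rightarrow> 'v) \<Rightarrow>
     int \<Rightarrow> 'v \<Rightarrow> 'v::ab_group_add" where
  "psi_plus scale p c psi0 alpha a v = psi0 (vertex scale
     (\<lambda>m w. scale (- (p ^ m / (1 - p ^ m)) * (1 / c) ^ m) (alpha (- int m) w))
     (\<lambda>m w. scale (1 / (1 - p ^ m) * c ^ m) (alpha (int m) w)) a v)"

definition psi_minus ::
  "(complex \<Rightarrow> 'v \<Rightarrow> 'v) \<Rightarrow> complex \<Rightarrow> complex \<Rightarrow> ('v \<Rightarrow> 'v) \<Rightarrow> (int \<Rightarrow> 'v \<Rightarrow> 'v) \<Rightarrow>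
     int \<Rightarrow> 'v \<Rightarrow> 'v::ab_group_add" where
  "psi_minus scale p c psi0 alpha a v = psi0 (vertex scale
     (\<lambda>m w. scale (- (1 / (1 - p ^ m)) * c ^ m) (alpha (- int m) w))
     (\<lambda>m w. scale (p ^ m / (1 - p ^ m) * (1 / c) ^ m) (alpha (int m) w)) a v)"

text \<open>
  The defining relations, coefficientwise, for operators on a complex vector space.
  The central element \<open>\<gamma>\<^sup>1\<^sup>/\<^sup>2\<close> acts by a nonzero scalar \<open>c\<close>, so that \<open>\<gamma> = c\<^sup>2\<close> and
  \<open>p\<^sup>* = p \<gamma>\<^sup>-\<^sup>2 = p / c\<^sup>4\<close> are numbers; this makes \<open>\<gamma>\<^sup>1\<^sup>/\<^sup>2\<close> invertible and central.
  \<open>p\<close> must be nonzero because \<open>p\<^sup>m\<close> occurs with negative \<open>m\<close>.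
  There is no generator \<open>\<alpha>\<^sub>0\<close>; the value \<open>alpha 0\<close> is irrelevant.
  The smoothness axioms express that the infinite sums in the relations and in \<open>\<psi>\<^sup>\<plusminus>(z)\<close>
  are finite on each vector.
\<close>

locale elliptic_toroidal_module = vector_space scale
  for scale :: "complex \<Rightarrow> 'v \<Rightarrow> 'v::ab_group_add" +
  fixes q t p c :: complex
    and gammah psi0p psi0m :: "'v \<Rightarrow> 'v"
    and alpha xp xm :: "int \<Rightarrow> 'v \<Rightarrow> 'v"
  assumes c_nonzero: "c \<noteq> 0"
    and p_nonzero: "p \<noteq> 0"
    and norm_p: "norm p < 1"
    and norm_pstar: "norm (p / c ^ 4) < 1"
    and gammah_scalar: "\<And>v. gammah v = scale c v"
    and linear_psi0p: "Vector_Spaces.linear scale scale psi0p"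
    and linear_psi0m: "Vector_Spaces.linear scale scale psi0m"
    and linear_alpha: "\<And>m. m \<noteq> 0 \<Longrightarrow> Vector_Spaces.linear scale scale (alpha m)"
    and linear_xp: "\<And>n. Vector_Spaces.linear scale scale (xp n)"
    and linear_xm: "\<And>n. Vector_Spaces.linear scale scale (xm n)"
    and psi0p_invertible: "bij psi0p"
    and psi0m_invertible: "bij psi0m"
    and smooth_alpha: "\<And>v. \<exists>d. \<forall>ms. (\<forall>m\<in>set ms. m > 0) \<and> sum_list ms \<ge> d \<longrightarrow> foldr alpha ms v = 0"
    and smooth_xp: "\<And>v. \<exists>d. \<forall>n\<ge>d. xp n v = 0"
    and smooth_xm: "\<And>v. \<exists>d. \<forall>n\<ge>d. xm n v = 0"
    and psi0p_psi0m: "\<And>v. psi0p (psi0m v) = psi0m (psi0p v)"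
    and psi0p_alpha: "\<And>m v. m \<noteq> 0 \<Longrightarrow> psi0p (alpha m v) = alpha m (psi0p v)"
    and psi0p_xp: "\<And>n v. psi0p (xp n v) = xp n (psi0p v)"
    and psi0p_xm: "\<And>n v. psi0p (xm n v) = xm n (psi0p v)"
    and psi0m_alpha: "\<And>m v. m \<noteq> 0 \<Longrightarrow> psi0m (alpha m v) = alpha m (psi0m v)"
    and psi0m_xp: "\<And>n v. psi0m (xp n v) = xp n (psi0m v)"
    and psi0m_xm: "\<And>n v. psi0m (xm n v) = xm n (psi0m v)"
    and alpha_alpha: "\<And>m n v. m \<noteq> 0 \<Longrightarrow> n \<noteq> 0 \<Longrightarrow>
      alpha m (alpha n v) - alpha n (alpha m v) =
      scale (if m + n = 0
             then - (kappa q t m / of_int m) * ((c\<^sup>2) powi m - (c\<^sup>2) powi (- m)) * (c\<^sup>2) powi (- m)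
                  * ((1 - p powi m) / (1 - (p / c ^ 4) powi m))
             else 0) v"
    and alpha_xp: "\<And>m a v. m \<noteq> 0 \<Longrightarrow>
      alpha m (current xp a v) - current xp a (alpha m v) =
      scale (- (kappa q t m / of_int m) * ((1 - p powi m) / (1 - (p / c ^ 4) powi m)) * c powi (- 3 * m))
        (current xp (a - m) v)"
    and alpha_xm: "\<And>m a v. m \<noteq> 0 \<Longrightarrow>
      alpha m (current xm a v) - current xm a (alpha m v) =
      scale (kappa q t m / of_int m * c powi (- m)) (current xm (a - m) v)"
    and xp_xm: "\<And>a b v.
      current xp a (current xm b v) - current xm b (current xp a v) =
      scale ((1 - q) * (1 - 1 / t) / (1 - q / t))
        (delta_mult scale (1 / c\<^sup>2) (\<lambda>e. psi_plus scale p c psi0p alpha e v) a b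
         - delta_mult scale (c\<^sup>2) (\<lambda>e. scale ((1 / c\<^sup>2) powi e) (psi_minus scale p c psi0m alpha e v)) a b)"
    and xp_xp: "\<And>a b v.
      ratio_mult scale (G_series q t * g_series q t (p / c ^ 4)) (current xp) v (a - 3) b =
      - ratio_mult scale (G_series q t * g_series q t (p / c ^ 4)) (current xp) v (b - 3) a"
    and xm_xm: "\<And>a b v.
      ratio_mult scale (G_series (1 / q) (1 / t) * inverse (g_series q t p)) (current xm) v (a - 3) b =
      - ratio_mult scale (G_series (1 / q) (1 / t) * inverse (g_series q t p)) (current xm) v (b - 3) a"
    and serre_xp: "\<And>a b e v. serre_sum scale (g_series q t (p / c ^ 4)) (current xp) v a b e = 0"
    and serre_xm: "\<And>a b e v. serre_sum scale (inverse (g_series q t p)) (current xm) v a b e = 0"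

text \<open>Level \<open>(k, l)\<close>, relative to a fixed choice \<open>r\<close> of the fourth root \<open>(t/q)\<^sup>1\<^sup>/\<^sup>4\<close>, so that
  \<open>(t/q)\<^sup>-\<^sup>l\<^sup>/\<^sup>2 = r\<^sup>-\<^sup>2\<^sup>l\<close>.\<close>

definition has_level ::
  "(complex \<Rightarrow> 'v \<Rightarrow> 'v) \<Rightarrow> complex \<Rightarrow> ('v \<Rightarrow> 'v) \<Rightarrow> ('v \<Rightarrow> 'v) \<Rightarrow> int \<Rightarrow> int \<Rightarrow> bool" where
  "has_level scale r gammah psi0p k l \<longleftrightarrow>
     (\<forall>v. gammah v = scale (r powi k) v) \<and> (\<forall>v. psi0p v = scale (r powi (- 2 * l)) v)"


section \<open>The Fock space\<close>

text \<open>Polynomials in the variables \<open>\<alpha>\<^sub>-\<^sub>m\<close>, \<open>m > 0\<close>; the variable with index \<open>i :: nat\<close> is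
  \<open>\<alpha>\<^sub>-\<^sub>(\<^sub>i\<^sub>+\<^sub>1\<^sub>)\<close>.\<close>

type_synonym fock = "(nat \<Rightarrow>\<^sub>0 nat) \<Rightarrow>\<^sub>0 complex"

definition fock_scale :: "complex \<Rightarrow> fock \<Rightarrow> fock" where
  "fock_scale a f = Poly_Mapping.map ((*) a) f"

definition fock_var :: "nat \<Rightarrow> fock" where
  "fock_var i = Poly_Mapping.single (Poly_Mapping.single i 1) 1"

definition fock_pderiv :: "nat \<Rightarrow> fock \<Rightarrow> fock" where
  "fock_pderiv i f = (\<Sum>\<mu>\<in>Poly_Mapping.keys f.
     Poly_Mapping.single (\<mu> - Poly_Mapping.single i 1)
       (of_nat (Poly_Mapping.lookup \<mu> i) * Poly_Mapping.lookup f \<mu>))"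

text \<open>On the Fock space \<open>p\<^sup>* = p q / t\<close>.\<close>

definition fock_alpha :: "complex \<Rightarrow> complex \<Rightarrow> complex \<Rightarrow> int \<Rightarrow> fock \<Rightarrow> fock" where
  "fock_alpha q t p m f =
     (if m < 0 then fock_var (nat (- m) - 1) * f
      else if m > 0 then
        fock_scale (- (kappa q t m / of_int m) * (1 - (q / t) powi m)
            * ((1 - p powi m) / (1 - (p * q / t) powi m)))
          (fock_pderiv (nat m - 1) f)
      else 0)"

text \<open>In what follows \<open>r\<close> is the chosen fourth root \<open>(t/q)\<^sup>1\<^sup>/\<^sup>4\<close>; thus \<open>\<gamma> = r\<^sup>2\<close>.\<close>

definition fock_alpha' :: "complex \<Rightarrow> complex \<Rightarrow> complex \<Rightarrow> complex \<Rightarrow> int \<Rightarrow> fock \<Rightarrow> fock" where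
  "fock_alpha' q t p r m f =
     fock_scale ((1 - (p * q / t) powi m) / (1 - p powi m) * (r\<^sup>2) powi m) (fock_alpha q t p m f)"

text \<open>\<open>fock_xp \<dots> n\<close> and \<open>fock_xm \<dots> n\<close> are the modes, that is, the coefficients of \<open>z\<^sup>-\<^sup>n\<close>;
  \<open>fock_psi_plus \<dots> a\<close> and \<open>fock_psi_minus \<dots> a\<close> are the coefficients of \<open>z\<^sup>a\<close>. The prefactors
  \<open>z\<^sup>-\<^sup>N\<close> and \<open>z\<^sup>N\<close> shift the exponent.\<close>

definition fock_xp ::
  "complex \<Rightarrow> complex \<Rightarrow> complex \<Rightarrow> complex \<Rightarrow> complex \<Rightarrow> int \<Rightarrow> int \<Rightarrow> fock \<Rightarrow> fock" where
  "fock_xp q t p r u N n f = fock_scale (u * r powi (3 * N)) (vertex fock_scale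
     (\<lambda>m h. fock_scale (- (r ^ m / (1 - (t / q) ^ m))) (fock_alpha q t p (- int m) h))
     (\<lambda>m h. fock_scale (r ^ (3 * m) / (1 - (t / q) ^ m)) (fock_alpha q t p (int m) h))
     (- n + N) f)"

definition fock_xm ::
  "complex \<Rightarrow> complex \<Rightarrow> complex \<Rightarrow> complex \<Rightarrow> complex \<Rightarrow> int \<Rightarrow> int \<Rightarrow> fock \<Rightarrow> fock" where
  "fock_xm q t p r u N n f = fock_scale (1 / u * r powi (- 3 * N)) (vertex fock_scale
     (\<lambda>m h. fock_scale (r ^ m / (1 - (t / q) ^ m)) (fock_alpha' q t p r (- int m) h))
     (\<lambda>m h. fock_scale (- (r ^ (3 * m) / (1 - (t / q) ^ m))) (fock_alpha' q t p r (int m) h))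
     (- n - N) f)"

definition fock_psi_plus ::
  "complex \<Rightarrow> complex \<Rightarrow> complex \<Rightarrow> complex \<Rightarrow> int \<Rightarrow> int \<Rightarrow> fock \<Rightarrow> fock" where
  "fock_psi_plus q t p r N a f = fock_scale (r powi (- 2 * N)) (vertex fock_scale
     (\<lambda>m h. fock_scale (- (p ^ m * r powi (- int m) / (1 - p ^ m))) (fock_alpha q t p (- int m) h))
     (\<lambda>m h. fock_scale (r ^ m / (1 - p ^ m)) (fock_alpha q t p (int m) h))
     a f)"

definition fock_psi_minus ::
  "complex \<Rightarrow> complex \<Rightarrow> complex \<Rightarrow> complex \<Rightarrow> int \<Rightarrow> int \<Rightarrow> fock \<Rightarrow> fock" where
  "fock_psi_minus q t p r N a f = fock_scale (r powi (2 * N)) (vertex fock_scale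
     (\<lambda>m h. fock_scale (- (r ^ m / (1 - p ^ m))) (fock_alpha q t p (- int m) h))
     (\<lambda>m h. fock_scale (p ^ m * r powi (- int m) / (1 - p ^ m)) (fock_alpha q t p (int m) h))
     a f)"

end

theory Submission
  imports Defs
begin

text \<open>
  On the Fock space the creation part of a vertex operator is multiplication by a power series
  with polynomial coefficients, and its annihilation part is the exponential of a derivation,
  that is, a ring homomorphism that only shifts the variables. Hence a product of vertex
  operators is a scalar contraction series times a normally ordered product, and every relation
  becomes an identity between contraction series.

  Once the elliptic factor \<open>g\<close> is absorbed, the contraction of two equal currents is
  \<open>h(x) = (1 - x)(1 - abx) / ((1 - ax)(1 - bx))\<close>, which gives the quadratic relations. The mixed
  contraction has the same expansion from both sides up to two delta functions, and on their
  supports the normally ordered product collapses to \<open>\<psi>\<^sup>\<plusminus>\<close>.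

  For the cubic relations write \<open>h = 1 + \<kappa> e\<close> with \<open>e(x) = x / ((1 - ax)(1 - bx))\<close> and
  \<open>\<kappa> = -(1 - a)(1 - b)\<close>. With \<open>c = w/u + w/z - z/w - u/w\<close> one has
  \<open>c e(w/z) e(u/w) (1 + \<kappa> e(u/z)) = (z/u - u/z) (e(w/z) e(u/z) - e(u/z) e(u/w))\<close>,
  so that the triple product disappears. The remaining products of one or two factors \<open>e\<close> have the
  same expansion in all orders of \<open>z, w, u\<close> in which they occur, and their coefficients cancel after
  symmetrization, for instance because \<open>c\<close> sums to zero over the three positions of one variable.
\<close>

section \<open>Formal series acting on lattice functions\<close>

text \<open>The obstacle is that formal series in several variables cannot be multiplied freely: the
  expansions of one rational function in \<open>w/z\<close> and in \<open>z/w\<close> differ by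
  delta functions. Therefore a vector is fixed throughout, a normally ordered product applied to it
  becomes a function from exponent vectors to the commutative ring \<open>fock\<close>, and scalar
  series act on such functions by translation. This action is safe for translations that lower a
  common functional bounded below on the support. Normally ordered products have support bounded
  below in every exponent separately, so both expansions act on them, and delta functions can be
  multiplied in. Identities between exponentials of operators use neither logarithms nor
  convergence: every family of modes satisfies an Euler recursion
  \<open>k E_k = \<Sum> m A_m E_(k-m)\<close>, and equality follows by induction and division by
  \<open>k\<close>. All scalar coefficients become rational functions of \<open>r^m\<close>,
  \<open>q^m\<close>, \<open>p^m\<close> once \<open>t^m = (r^m)^4 q^m\<close> is substituted, so
  the structure constants are checked by polynomial arithmetic.\<close>

lemma Sum_any_lessThan:
  fixes f :: "nat \<Rightarrow> 'a::comm_monoid_add"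
  assumes "\<And>i. i \<ge> K \<Longrightarrow> f i = 0"
  shows "Sum_any f = (\<Sum>i<K. f i)"
  by (rule Sum_any.expand_superset) (use assms in \<open>auto simp: not_le[symmetric]\<close>)

text \<open>
  \<open>M n\<close> is the coefficient of the monomial with exponent vector \<open>n\<close>, and \<open>T\<close> is the translation with
  \<open>(x M) n = M (T n)\<close> for some monomial \<open>x\<close>; then \<open>lser T f M\<close> is the product of \<open>f(x)\<close> with that series.
  The product is finite in each degree when \<open>T\<close> lowers a functional that is bounded below on the
  support of \<open>M\<close>.
\<close>

definition lser :: "('g \<Rightarrow> 'g) \<Rightarrow> 'k::comm_ring_1 fps \<Rightarrow> ('g \<Rightarrow> 'k) \<Rightarrow> 'g \<Rightarrow> 'k" where
  "lser T f M n = Sum_any (\<lambda>i::nat. fps_nth f i * M ((T ^^ i) n))"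

definition tame :: "('g \<Rightarrow> int) \<Rightarrow> ('g \<Rightarrow> 'k::zero) \<Rightarrow> bool" where
  "tame l M \<longleftrightarrow> (\<exists>D. \<forall>n. M n \<noteq> 0 \<longrightarrow> D \<le> l n)"

definition lowers :: "('g \<Rightarrow> int) \<Rightarrow> ('g \<Rightarrow> 'g) \<Rightarrow> bool" where
  "lowers l T \<longleftrightarrow> (\<forall>n. l (T n) < l n)"

lemma lowers_funpow:
  assumes "lowers l T"
  shows "l ((T ^^ i) n) \<le> l n - int i"
proof (induction i)
  case (Suc i)
  have "l (T ((T ^^ i) n)) < l ((T ^^ i) n)"
    using assms by (simp add: lowers_def)
  with Suc show ?case by simp
qed simp

text \<open>Each application of either translation lowers \<open>l\<close> by at least one, so a
  single cutoff on the total number \<open>i + j\<close> of steps serves a double sum.\<close>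

lemma tame_bound2:
  assumes "tame l M" "lowers l T" "lowers l T'"
  obtains K where "\<And>i j. i + j \<ge> K \<Longrightarrow> M ((T ^^ i) ((T' ^^ j) n)) = 0"
proof -
  obtain D where D: "\<And>n. M n \<noteq> 0 \<Longrightarrow> D \<le> l n"
    using assms(1) by (auto simp: tame_def)
  show thesis
  proof (rule that)
    fix i j :: nat
    assume "i + j \<ge> nat (l n - D + 1)"
    moreover have "l ((T ^^ i) ((T' ^^ j) n)) \<le> l n - int j - int i"
      using lowers_funpow[OF assms(2), of i "(T' ^^ j) n"] lowers_funpow[OF assms(3), of j n] by simp
    ultimately have "l ((T ^^ i) ((T' ^^ j) n)) < D"
      by linarith
    then show "M ((T ^^ i) ((T' ^^ j) n)) = 0"
      using D not_le by blast
  qed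
qed

lemma tame_bound:
  assumes "tame l M" "lowers l T"
  obtains K where "\<And>i. i \<ge> K \<Longrightarrow> M ((T ^^ i) n) = 0"
  using tame_bound2[OF assms assms(2), of n] by (metis add_0_right funpow_0)

lemma lser_eq_sum:
  assumes "\<And>i. i \<ge> K \<Longrightarrow> M ((T ^^ i) n) = 0"
  shows "lser T f M n = (\<Sum>i<K. fps_nth f i * M ((T ^^ i) n))"
  unfolding lser_def by (rule Sum_any_lessThan) (simp add: assms)

lemma tame_lser:
  assumes "tame l M" "lowers l T"
  shows "tame l (lser T f M)"
proof -
  obtain D where D: "\<And>n. M n \<noteq> 0 \<Longrightarrow> D \<le> l n"
    using assms(1) by (auto simp: tame_def)
  have "lser T f M n = 0" if "l n < D" for n
  proof -
    have "M ((T ^^ i) n) = 0" for i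
      using D[of "(T ^^ i) n"] lowers_funpow[OF assms(2), of i n] that by force
    then show ?thesis
      by (simp add: lser_def)
  qed
  then show ?thesis
    unfolding tame_def by (meson not_le)
qed

lemma funpow_commute:
  assumes "\<And>n. T (T' n) = T' (T n)"
  shows "(T ^^ i) ((T' ^^ j) n) = (T' ^^ j) ((T ^^ i) n)"
proof -
  have "T ((T' ^^ j) n) = (T' ^^ j) (T n)" for n
    by (induction j) (simp_all add: assms)
  then show ?thesis
    by (induction i) simp_all
qed

text \<open>Both orders are the same finite double sum, cut off at one \<open>K\<close>. The common
  functional \<open>l\<close> is essential: translations in opposite directions would in general
  produce infinite sums.\<close>

lemma lser_commute:
  assumes "tame l M" "lowers l T" "lowers l T'" "\<And>n. T (T' n) = T' (T n)"
  shows "lser T f (lser T' g M) = lser T' g (lser T f M)"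
proof
  fix n
  note comm = funpow_commute[of T T', OF assms(4)]
  obtain K where K: "\<And>i j. i + j \<ge> K \<Longrightarrow> M ((T ^^ i) ((T' ^^ j) n)) = 0"
    using tame_bound2[OF assms(1-3)] by blast
  have *: "lser T' g M ((T ^^ i) n) = (\<Sum>j<K. fps_nth g j * M ((T ^^ i) ((T' ^^ j) n)))" for i
    by (subst lser_eq_sum[where K = K]) (auto simp: K comm[symmetric])
  have **: "lser T f M ((T' ^^ j) n) = (\<Sum>i<K. fps_nth f i * M ((T ^^ i) ((T' ^^ j) n)))" for j
    by (subst lser_eq_sum[where K = K]) (auto simp: K)
  have "lser T f (lser T' g M) n = (\<Sum>i<K. fps_nth f i * (\<Sum>j<K. fps_nth g j * M ((T ^^ i) ((T' ^^ j) n))))"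
    by (subst lser_eq_sum[where K = K]) (auto simp: K *)
  also have "\<dots> = (\<Sum>j<K. fps_nth g j * (\<Sum>i<K. fps_nth f i * M ((T ^^ i) ((T' ^^ j) n))))"
    by (simp only: sum_distrib_left, subst sum.swap) (simp add: mult.left_commute)
  also have "\<dots> = lser T' g (lser T f M) n"
    by (subst lser_eq_sum[where K = K]) (auto simp: K **)
  finally show "lser T f (lser T' g M) n = lser T' g (lser T f M) n" .
qed

lemma lser_mult:
  assumes "tame l M" "lowers l T"
  shows "lser T (f * g) M = lser T f (lser T g M)"
proof
  fix n
  obtain K where K: "\<And>i. i \<ge> K \<Longrightarrow> M ((T ^^ i) n) = 0"
    using tame_bound[OF assms] by blast
  have *: "lser T g M ((T ^^ i) n) = (\<Sum>j<K. fps_nth g j * M ((T ^^ (i + j)) n))" for i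
  proof -
    have "M ((T ^^ j) ((T ^^ i) n)) = M ((T ^^ (i + j)) n)" for j
      by (simp add: funpow_add add.commute[of i j])
    then show ?thesis
      by (subst lser_eq_sum[where K = K]) (auto simp: K)
  qed
  have "lser T (f * g) M n = (\<Sum>k<K. \<Sum>i\<le>k. fps_nth f i * fps_nth g (k - i) * M ((T ^^ k) n))"
    by (subst lser_eq_sum[where K = K]) (auto simp: K fps_mult_nth sum_distrib_right atLeast0AtMost)
  also have "\<dots> = (\<Sum>k<K. \<Sum>i\<le>k. fps_nth f i * (fps_nth g (k - i) * M ((T ^^ (i + (k - i))) n)))"
    by (intro sum.cong) (auto simp: mult.assoc)
  also have "\<dots> = (\<Sum>(i, j)\<in>{(i, j). i + j < K}. fps_nth f i * (fps_nth g j * M ((T ^^ (i + j)) n)))"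
    by (subst sum.triangle_reindex) simp
  \<comment> \<open>The Cauchy product sums over the triangle \<open>i + j < K\<close>, the iterated
    action over the square; the extra terms lie beyond the cutoff.\<close>
  also have "\<dots> = (\<Sum>(i, j)\<in>{..<K} \<times> {..<K}. fps_nth f i * (fps_nth g j * M ((T ^^ (i + j)) n)))"
  proof (rule sum.mono_neutral_left)
    have "M ((T ^^ (i + j)) n) = 0" if "\<not> i + j < K" for i j
      using K that by simp
    then show "\<forall>x\<in>{..<K} \<times> {..<K} - {(i, j). i + j < K}. (case x of (i, j) \<Rightarrow> fps_nth f i * (fps_nth g j * M ((T ^^ (i + j)) n))) = 0"
      by (metis (mono_tags, lifting) DiffD2 case_prodI2 mem_Collect_eq mult_zero_right split_conv surj_pair)
  qed auto
  also have "\<dots> = (\<Sum>i<K. fps_nth f i * lser T g M ((T ^^ i) n))"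
    by (simp add: sum.cartesian_product[symmetric] sum_distrib_left *)
  also have "\<dots> = lser T f (lser T g M) n"
    by (subst lser_eq_sum[where K = K]) (auto simp: K *)
  finally show "lser T (f * g) M n = lser T f (lser T g M) n" .
qed

lemma lser_add:
  assumes "tame l M" "lowers l T"
  shows "lser T (f + g) M n = lser T f M n + lser T g M n"
proof -
  obtain K where K: "\<And>i. i \<ge> K \<Longrightarrow> M ((T ^^ i) n) = 0"
    using tame_bound[OF assms] by blast
  show ?thesis
    by (simp add: lser_eq_sum[where K = K] K algebra_simps sum.distrib)
qed

lemma lser_one: "lser T 1 M = M"
  by (auto simp: fun_eq_iff lser_def Sum_any_lessThan[where K = 1])

lemma lser_const_mult: 
  assumes "tame l M" "lowers l T"
  shows "lser T (fps_const c * f) M n = c * lser T f M n"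
proof -
  obtain K where K: "\<And>i. i \<ge> K \<Longrightarrow> M ((T ^^ i) n) = 0"
    using tame_bound[OF assms] by blast
  show ?thesis
    by (simp add: lser_eq_sum[where K = K] K algebra_simps sum_distrib_left)
qed

lemma lser_fps_X: "lser T fps_X M n = M (T n)"
proof -
  have "lser T fps_X M n = (\<Sum>i<2. fps_nth fps_X i * M ((T ^^ i) n))"
    unfolding lser_def by (rule Sum_any_lessThan) simp
  then show ?thesis
    by (simp add: numeral_2_eq_2)
qed

lemma lser_quadratic:
  "lser T (1 - fps_const c * fps_X + fps_const d * fps_X ^ 2) M n = M n - c * M (T n) + d * M (T (T n))"
proof -
  let ?f = "1 - fps_const c * fps_X + fps_const d * fps_X ^ 2"
  have "lser T ?f M n = (\<Sum>i<3. fps_nth ?f i * M ((T ^^ i) n))"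
    unfolding lser_def by (rule Sum_any_lessThan) (simp add: fps_X_power_iff)
  then show ?thesis
    by (simp add: numeral_eq_Suc fps_X_power_iff)
qed

lemma lser_shift:
  assumes "\<And>n. T (S n) = S (T n)"
  shows "lser T f (\<lambda>n. M (S n)) n = lser T f M (S n)"
proof -
  have "(T ^^ i) (S n) = S ((T ^^ i) n)" for i
    using funpow_commute[of T S i 1 n] assms by simp
  then show ?thesis
    by (simp add: lser_def)
qed

lemma tame_add:
  fixes M M' :: "'g \<Rightarrow> 'k::comm_ring_1"
  shows "tame l M \<Longrightarrow> tame l M' \<Longrightarrow> tame l (\<lambda>n. M n + M' n)"
proof -
  assume "tame l M" "tame l M'"
  then obtain D D' where "\<And>n. M n \<noteq> 0 \<Longrightarrow> D \<le> l n" "\<And>n. M' n \<noteq> 0 \<Longrightarrow> D' \<le> l n"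
    by (auto simp: tame_def)
  then have "\<forall>n. M n + M' n \<noteq> 0 \<longrightarrow> min D D' \<le> l n"
    by (metis add.right_neutral min.coboundedI1 min.coboundedI2)
  then show ?thesis
    unfolding tame_def ..
qed

lemma lser_add_right:
  assumes "tame l M" "tame l M'" "lowers l T"
  shows "lser T f (\<lambda>n. M n + M' n) n = lser T f M n + lser T f M' n"
proof -
  obtain K K' where K: "\<And>i. i \<ge> K \<Longrightarrow> M ((T ^^ i) n) = 0" "\<And>i. i \<ge> K' \<Longrightarrow> M' ((T ^^ i) n) = 0"
    using tame_bound[OF assms(1,3)] tame_bound[OF assms(2,3)] by metis
  show ?thesis
    by (subst (1 2 3) lser_eq_sum[where K = "max K K'"]) (simp_all add: K algebra_simps sum.distrib)
qed

lemma tame_uminus: "tame l M \<Longrightarrow> tame l (\<lambda>n. - M n)" for M :: "'g \<Rightarrow> 'k::comm_ring_1"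
  by (simp add: tame_def)

lemma lser_uminus_right: "lser T f (\<lambda>n. - M n) n = - lser T f M n"
  by (simp add: lser_def Sum_any.expand_set sum_negf)

section \<open>The cubic relation for a symmetric function\<close>

type_synonym zzz = "int \<times> int \<times> int"

text \<open>\<open>T12\<close>, \<open>T23\<close>, \<open>T13\<close> belong to the monomials \<open>w/z\<close>, \<open>u/w\<close>, \<open>u/z\<close> in \<open>z\<^sup>a w\<^sup>b u\<^sup>c\<close>.\<close>

definition T12 :: "zzz \<Rightarrow> zzz" where "T12 = (\<lambda>(a, b, c). (a + 1, b - 1, c))"
definition T23 :: "zzz \<Rightarrow> zzz" where "T23 = (\<lambda>(a, b, c). (a, b + 1, c - 1))"
definition T13 :: "zzz \<Rightarrow> zzz" where "T13 = (\<lambda>(a, b, c). (a + 1, b, c - 1))"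

lemma T_apply [simp]:
  "T12 (a, b, c) = (a + 1, b - 1, c)" "T23 (a, b, c) = (a, b + 1, c - 1)" "T13 (a, b, c) = (a + 1, b, c - 1)"
  by (simp_all add: T12_def T23_def T13_def)

text \<open>Each of the three translations moves one unit to an earlier exponent, so any strictly
  increasing weights would do; with 1, 2, 3 the drops are 1, 1 and 2. One functional thus covers all
  expansions belonging to the order \<open>z, w, u\<close>.\<close>

definition slope :: "zzz \<Rightarrow> int" where "slope = (\<lambda>(a, b, c). a + 2 * b + 3 * c)"

lemma lowers_slope [simp]: "lowers slope T12" "lowers slope T23" "lowers slope T13"
  by (auto simp: lowers_def slope_def T12_def T23_def T13_def)

lemma T_commute:
  "T12 (T23 n) = T23 (T12 n)" "T12 (T13 n) = T13 (T12 n)" "T23 (T13 n) = T13 (T23 n)"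
  by (auto simp: T12_def T23_def T13_def split: prod.splits)

text \<open>Multiplication by \<open>w/u + w/z - z/w - u/w\<close>, respectively by \<open>z/u - u/z\<close>.\<close>

definition serre_shift :: "(zzz \<Rightarrow> 'k::comm_ring_1) \<Rightarrow> zzz \<Rightarrow> 'k" where
  "serre_shift M = (\<lambda>(a, b, c). M (a, b - 1, c + 1) + M (a + 1, b - 1, c) - M (a - 1, b + 1, c) - M (a, b + 1, c - 1))"

definition anti_shift :: "(zzz \<Rightarrow> 'k::comm_ring_1) \<Rightarrow> zzz \<Rightarrow> 'k" where
  "anti_shift M = (\<lambda>(a, b, c). M (a - 1, b, c + 1) - M (a + 1, b, c - 1))"

context
  fixes s d \<kappa> :: "'k::comm_ring_1" and e :: "'k fps"
  assumes e: "(1 - fps_const s * fps_X + fps_const d * fps_X ^ 2) * e = fps_X"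
    and \<kappa>: "\<kappa> = s - 1 - d"
begin

text \<open>Here \<open>s = a + b\<close> and \<open>d = a b\<close> in terms of the two poles of
  \<open>e\<close>. The relation for \<open>1/e\<close> is multiplied by the variable to stay within
  power series, which is why \<open>T n\<close> appears on the left; it is applied at indices
  shifted back by \<open>T\<close>.\<close>

lemma lser_e_recurrence:
  assumes "tame slope M" "lowers slope T"
  shows "M (T n) = lser T e M n - s * lser T e M (T n) + d * lser T e M (T (T n))"
  by (metis assms e lser_fps_X lser_mult lser_quadratic)

text \<open>Divided by the three factors \<open>e\<close> this is an identity of Laurent polynomials, as
  \<open>1/e(x) = 1/x - s + d x\<close>.\<close>

lemma triple_product:
  assumes M: "tame slope M"
  defines "Q \<equiv> lser T12 e (lser T23 e (lser T13 e M))"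
  shows "serre_shift (lser T12 e (lser T23 e M)) n + \<kappa> * serre_shift Q n
       = anti_shift (lser T12 e (lser T13 e M)) n - anti_shift (lser T13 e (lser T23 e M)) n"
proof -
  note [simp] = tame_lser[where l = slope] M
  have Q: "Q = lser T13 e (lser T12 e (lser T23 e M))" "Q = lser T23 e (lser T12 e (lser T13 e M))"
    "Q = lser T12 e (lser T13 e (lser T23 e M))"
    by (simp_all add: Q_def lser_commute[where l = slope] T_commute)
  \<comment> \<open>Each product of two factors is recovered from the triple product
    \<open>Q\<close> by removing the third factor, so the claim becomes linear in translates of
    \<open>Q\<close>.\<close>
  have A: "lser T12 e (lser T23 e M) (a, b, c) = Q (a - 1, b, c + 1) - s * Q (a, b, c) + d * Q (a + 1, b, c - 1)" for a b c
    using lser_e_recurrence[of "lser T12 e (lser T23 e M)" T13 "(a - 1, b, c + 1)"] by (simp add: Q(1))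
  have B: "lser T12 e (lser T13 e M) (a, b, c) = Q (a, b - 1, c + 1) - s * Q (a, b, c) + d * Q (a, b + 1, c - 1)" for a b c
    using lser_e_recurrence[of "lser T12 e (lser T13 e M)" T23 "(a, b - 1, c + 1)"] by (simp add: Q(2))
  have C: "lser T13 e (lser T23 e M) (a, b, c) = Q (a - 1, b + 1, c) - s * Q (a, b, c) + d * Q (a + 1, b - 1, c)" for a b c
    using lser_e_recurrence[of "lser T13 e (lser T23 e M)" T12 "(a - 1, b + 1, c)"] by (simp add: Q(3))
  obtain a b c where n: "n = (a, b, c)"
    by (cases n)
  show ?thesis
    by (simp add: n serre_shift_def anti_shift_def A B C \<kappa> algebra_simps)
qed

lemma lser_one_plus:
  assumes "tame slope M" "lowers slope T"
  shows "lser T (1 + fps_const \<kappa> * e) M = (\<lambda>n. M n + \<kappa> * lser T e M n)"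
  using lser_add[OF assms] lser_const_mult[OF assms] by (auto simp: fun_eq_iff lser_one)

lemma lser_scale_right:
  assumes "tame slope M" "lowers slope T"
  shows "lser T f (\<lambda>n. c * M n) n = c * lser T f M n"
proof -
  obtain K where K: "\<And>i. i \<ge> K \<Longrightarrow> M ((T ^^ i) n) = 0"
    using tame_bound[OF assms] by blast
  show ?thesis
    by (simp add: lser_eq_sum[where K = K] K sum_distrib_left mult.left_commute)
qed

lemma tame_scale: "tame slope M \<Longrightarrow> tame slope (\<lambda>n. c * M n)" for M :: "zzz \<Rightarrow> 'k"
  unfolding tame_def by (metis mult_zero_right)

text \<open>Of the eight terms of the product, the one with \<open>w/z\<close> and
  \<open>u/w\<close> and the triple one occur exactly in the combination handled by
  \<open>triple_product\<close>. What survives with two factors shares either the variable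
  \<open>z\<close> or the variable \<open>u\<close>.\<close>

lemma serre_expand:
  assumes M: "tame slope M"
  defines "F \<equiv> 1 + fps_const \<kappa> * e"
  shows "serre_shift (lser T12 F (lser T23 F (lser T13 F M))) n =
    serre_shift M n
    + \<kappa> * (serre_shift (lser T12 e M) n + serre_shift (lser T23 e M) n + serre_shift (lser T13 e M) n)
    + \<kappa>\<^sup>2 * (serre_shift (lser T12 e (lser T13 e M)) n + anti_shift (lser T12 e (lser T13 e M)) n
          + serre_shift (lser T13 e (lser T23 e M)) n - anti_shift (lser T13 e (lser T23 e M)) n)"
proof -
  note [simp] = tame_lser[where l = slope] M tame_add tame_scale
  have 1: "lser T23 e (lser T13 e M) = lser T13 e (lser T23 e M)"
    by (simp add: lser_commute[where l = slope] T_commute)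
  obtain a b c where n: "n = (a, b, c)"
    by (cases n)
  have 2: "lser T12 F (lser T23 F (lser T13 F M)) n = M n 
    + \<kappa> * (lser T12 e M n + lser T23 e M n + lser T13 e M n)
    + \<kappa>\<^sup>2 * (lser T12 e (lser T13 e M) n + lser T13 e (lser T23 e M) n + lser T12 e (lser T23 e M) n)
    + \<kappa>\<^sup>2 * \<kappa> * lser T12 e (lser T23 e (lser T13 e M)) n" for n
    unfolding F_def
    by (simp add: lser_one_plus lser_add_right[where l = slope] lser_scale_right 1 power2_eq_square)
       (simp add: algebra_simps)
  have "serre_shift (lser T12 F (lser T23 F (lser T13 F M))) n =
    serre_shift M n
    + \<kappa> * (serre_shift (lser T12 e M) n + serre_shift (lser T23 e M) n + serre_shift (lser T13 e M) n)
    + \<kappa>\<^sup>2 * (serre_shift (lser T12 e (lser T13 e M)) n + serre_shift (lser T13 e (lser T23 e M)) n)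
    + \<kappa>\<^sup>2 * (serre_shift (lser T12 e (lser T23 e M)) n + \<kappa> * serre_shift (lser T12 e (lser T23 e (lser T13 e M))) n)"
    unfolding serre_shift_def n prod.case 2 by (simp only: algebra_simps)
  then show ?thesis
    unfolding triple_product[OF M] by (simp only: algebra_simps)
qed

text \<open>This renames variables inside an expansion. It is used only where the swap
  \<open>p\<close> exchanges two of the lowering translations; the third one would turn into its
  inverse, that is, into an expansion in the wrong direction.\<close>

lemma lser_conj:
  assumes "\<And>n. T (p n) = p (T' n)"
  shows "lser T f M (p n) = lser T' f (\<lambda>n. M (p n)) n"
proof -
  have "(T ^^ i) (p n) = p ((T' ^^ i) n)" for i
    by (induction i) (simp_all add: assms(1))
  then show ?thesis
    by (simp add: lser_def)
qed

lemma serre_symmetrized: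
  fixes M :: "zzz \<Rightarrow> 'k"
  assumes M: "tame slope M"
    and sym: "\<And>a b c. M (b, a, c) = M (a, b, c)" "\<And>a b c. M (a, c, b) = M (a, b, c)"
  defines "F \<equiv> 1 + fps_const \<kappa> * e"
  defines "S \<equiv> serre_shift (lser T12 F (lser T23 F (lser T13 F M)))"
  shows "S (a, b, c) + S (a, c, b) + S (b, a, c) + S (b, c, a) + S (c, a, b) + S (c, b, a) = 0"
proof -
  note [simp] = tame_lser[where l = slope] M
  define G where "G = lser T12 e M"
  define H where "H = lser T12 e (lser T13 e M)"
  define L where "L = lser T13 e (lser T23 e M)"
  let ?p = "\<lambda>(a, b, c). (a, c, b) :: zzz"
  let ?q = "\<lambda>(a, b, c). (b, a, c) :: zzz"
  have p: "M (?p n) = M n" "M (?q n) = M n" for n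
    by (cases n; simp add: sym)+
  have conj_p: "lser T12 f N (?p n) = lser T13 f (\<lambda>n. N (?p n)) n" "lser T13 f N (?p n) = lser T12 f (\<lambda>n. N (?p n)) n"
    for f :: "'k fps" and N n
    by (rule lser_conj; auto)+
  have conj_q: "lser T23 f N (?q n) = lser T13 f (\<lambda>n. N (?q n)) n" "lser T13 f N (?q n) = lser T23 f (\<lambda>n. N (?q n)) n"
    for f :: "'k fps" and N n
    by (rule lser_conj; auto)+
  \<comment> \<open>Since \<open>M\<close> is symmetric, the three single-factor terms are one
    function \<open>G\<close> of an ordered pair and a spectator exponent.\<close>
  have 13: "lser T13 e M (a, b, c) = G (a, c, b)" for a b c
    using conj_p(2)[of e M "(a, c, b)"] by (simp add: G_def p)
  have 23: "lser T23 e M (a, b, c) = G (b, c, a)" for a b c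
    using conj_q(1)[of e M "(b, a, c)"] by (simp add: 13 p)
  have H: "H (a, c, b) = H (a, b, c)" for a b c
  proof -
    have "H (?p (a, b, c)) = lser T13 e (lser T12 e M) (a, b, c)"
      unfolding H_def conj_p p ..
    also have "\<dots> = H (a, b, c)"
      by (simp add: H_def lser_commute[where l = slope and T = T12] T_commute)
    finally show ?thesis
      by simp
  qed
  have L: "L (b, a, c) = L (a, b, c)" for a b c
  proof -
    have "L (?q (a, b, c)) = lser T23 e (lser T13 e M) (a, b, c)"
      unfolding L_def conj_q p ..
    also have "\<dots> = L (a, b, c)"
      by (simp add: L_def lser_commute[where l = slope and T = T23] T_commute)
    finally show ?thesis
      by simp
  qed
  have S: "S n = serre_shift M n
    + \<kappa> * (serre_shift G n + serre_shift (lser T23 e M) n + serre_shift (lser T13 e M) n)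
    + \<kappa>\<^sup>2 * (serre_shift H n + anti_shift H n + serre_shift L n - anti_shift L n)" for n
    unfolding S_def F_def G_def H_def L_def by (rule serre_expand[OF M])
  have Msum: "serre_shift M (a, b, c) + serre_shift M (a, c, b) + serre_shift M (b, a, c) + serre_shift M (b, c, a)
     + serre_shift M (c, a, b) + serre_shift M (c, b, a) = 0"
    by (simp add: serre_shift_def sym)
  define G' where "G' n = serre_shift G n + serre_shift (lser T23 e M) n + serre_shift (lser T13 e M) n" for n
  have Gsum: "G' (a, b, c) + G' (a, c, b) + G' (b, a, c) + G' (b, c, a) + G' (c, a, b) + G' (c, b, a) = 0"
    by (simp add: G'_def serre_shift_def 13 23)
  \<comment> \<open>\<open>H\<close> is symmetric in \<open>w, u\<close>, while the multiplier
    \<open>w/u + w/z - z/w - u/w + z/u - u/z\<close> is antisymmetric in them, so the six terms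
    cancel in pairs.\<close>
  define H' where "H' n = serre_shift H n + anti_shift H n" for n
  have Hsum: "H' (a, b, c) + H' (a, c, b) + H' (b, a, c) + H' (b, c, a) + H' (c, a, b) + H' (c, b, a) = 0"
    by (simp add: H'_def serre_shift_def anti_shift_def H)
  \<comment> \<open>Likewise \<open>L\<close> is symmetric in \<open>z, w\<close>, and with the
    opposite sign of \<open>z/u - u/z\<close> the multiplier is antisymmetric in
    \<open>z, w\<close>.\<close>
  define L' where "L' n = serre_shift L n - anti_shift L n" for n
  have Lsum: "L' (a, b, c) + L' (a, c, b) + L' (b, a, c) + L' (b, c, a) + L' (c, a, b) + L' (c, b, a) = 0"
    by (simp add: L'_def serre_shift_def anti_shift_def L)
  have S': "S n = serre_shift M n + \<kappa> * G' n + \<kappa>\<^sup>2 * (H' n + L' n)" for n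
    by (simp add: S G'_def H'_def L'_def algebra_simps)
  have "S (a, b, c) + S (a, c, b) + S (b, a, c) + S (b, c, a) + S (c, a, b) + S (c, b, a) 
   = (serre_shift M (a, b, c) + serre_shift M (a, c, b) + serre_shift M (b, a, c) + serre_shift M (b, c, a)
     + serre_shift M (c, a, b) + serre_shift M (c, b, a)) 
    + \<kappa> * (G' (a, b, c) + G' (a, c, b) + G' (b, a, c) + G' (b, c, a) + G' (c, a, b) + G' (c, b, a))
    + \<kappa>\<^sup>2 * (H' (a, b, c) + H' (a, c, b) + H' (b, a, c) + H' (b, c, a) + H' (c, a, b) + H' (c, b, a))
    + \<kappa>\<^sup>2 * (L' (a, b, c) + L' (a, c, b) + L' (b, a, c) + L' (b, c, a) + L' (c, a, b) + L' (c, b, a))"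
    unfolding S' by (simp only: algebra_simps)
  then show ?thesis
    by (simp only: Msum Gsum Hsum Lsum) simp
qed

end

section \<open>The Fock space as a polynomial ring\<close>

abbreviation fock_const :: "complex \<Rightarrow> fock" where
  "fock_const \<equiv> Poly_Mapping.single 0"

lemma fock_scale_eq: "fock_scale a f = fock_const a * f"
  by (simp add: fock_scale_def mult_map_scale_conv_mult)

lemma fock_const_add: "fock_const (a + b) = fock_const a + fock_const b"
  by (rule single_add)

lemma fock_const_mult: "fock_const (a * b) = fock_const a * fock_const b"
  by (simp add: mult_single)

lemma fock_const_sum: "fock_const (\<Sum>i\<in>I. f i) = (\<Sum>i\<in>I. fock_const (f i))"
  by (induction I rule: infinite_finite_induct) (simp_all add: fock_const_add)

lemma lookup_fock_const_mult: "Poly_Mapping.lookup (fock_const a * f) \<mu> = a * Poly_Mapping.lookup f \<mu>"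
  by (simp flip: mult_map_scale_conv_mult add: Poly_Mapping.map.rep_eq when_def)

lemma vector_space_fock_scale: "vector_space fock_scale"
  by unfold_locales (simp_all add: fock_scale_eq fock_const_add fock_const_mult algebra_simps)

text \<open>The Euler recursions determine \<open>k E_k\<close> rather than \<open>E_k\<close>; this
  divides by \<open>k\<close>, which is possible because \<open>fock\<close> contains the complex
  constants.\<close>

lemma fock_of_nat_cancel:
  fixes f g :: fock
  assumes "of_nat k * f = of_nat k * g" "k \<noteq> 0"
  shows "f = g"
proof -
  have "fock_const (1 / of_nat k) * of_nat k = 1"
    using assms(2) by (simp add: fock_const_mult[symmetric] flip: single_of_nat)
  then show ?thesis
    using arg_cong[OF assms(1), of "\<lambda>h. fock_const (1 / of_nat k) * h"] by (simp flip: mult.assoc)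
qed

lemma fock_induct [case_names single add]:
  assumes "\<And>\<mu> c. P (Poly_Mapping.single \<mu> c)" "\<And>f g :: fock. P f \<Longrightarrow> P g \<Longrightarrow> P (f + g)"
  shows "P f"
proof -
  have "P (\<Sum>\<mu>\<in>A. Poly_Mapping.single \<mu> (Poly_Mapping.lookup f \<mu>))" if "finite A" for A
    using that
  proof (induction A rule: finite_induct)
    case empty
    show ?case
      using assms(1)[of 0 0] by simp
  qed (simp add: assms)
  moreover have "f = (\<Sum>\<mu>\<in>Poly_Mapping.keys f. Poly_Mapping.single \<mu> (Poly_Mapping.lookup f \<mu>))"
    by (rule poly_mapping_eqI) (simp add: lookup_sum lookup_single when_def not_in_keys_iff_lookup_eq_zero)
  ultimately show ?thesis
    by (metis finite_keys)
qed

text \<open>Truncated subtraction of exponents is not injective, but monomials without the variable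
  carry the factor 0, and on the others removing one is inverse to adding one.\<close>

lemma lookup_fock_pderiv:
  "Poly_Mapping.lookup (fock_pderiv i f) \<mu> =
     of_nat (Poly_Mapping.lookup \<mu> i + 1) * Poly_Mapping.lookup f (\<mu> + Poly_Mapping.single i 1)"
proof -
  let ?\<nu> = "\<mu> + Poly_Mapping.single i 1"
  have *: "\<nu> = ?\<nu>" if "Poly_Mapping.lookup \<nu> i \<noteq> 0" "\<nu> - Poly_Mapping.single i 1 = \<mu>" for \<nu>
    using that by (auto intro!: poly_mapping_eqI simp: lookup_add lookup_minus lookup_single when_def)
  have "Poly_Mapping.lookup (fock_pderiv i f) \<mu> =
    (\<Sum>\<nu>\<in>Poly_Mapping.keys f. of_nat (Poly_Mapping.lookup \<nu> i) * Poly_Mapping.lookup f \<nu> when \<nu> - Poly_Mapping.single i 1 = \<mu>)"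
    by (simp add: fock_pderiv_def lookup_sum lookup_single)
  also have "\<dots> = (\<Sum>\<nu>\<in>Poly_Mapping.keys f. if \<nu> = ?\<nu> then of_nat (Poly_Mapping.lookup ?\<nu> i) * Poly_Mapping.lookup f ?\<nu> else 0)"
    by (intro sum.cong refl) (use * in \<open>auto simp: when_def\<close>)
  also have "\<dots> = of_nat (Poly_Mapping.lookup \<mu> i + 1) * Poly_Mapping.lookup f ?\<nu>"
    by (simp add: not_in_keys_iff_lookup_eq_zero lookup_add)
  finally show ?thesis .
qed

lemma fock_pderiv_add: "fock_pderiv i (f + g) = fock_pderiv i f + fock_pderiv i g"
  by (rule poly_mapping_eqI) (simp add: lookup_fock_pderiv lookup_add algebra_simps)

lemma fock_pderiv_const_mult: "fock_pderiv i (fock_const a * f) = fock_const a * fock_pderiv i f"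
  by (rule poly_mapping_eqI) (simp add: lookup_fock_pderiv lookup_fock_const_mult)

lemma fock_pderiv_zero [simp]: "fock_pderiv i 0 = 0"
  by (simp add: fock_pderiv_def)

lemma fock_pderiv_sum: "fock_pderiv i (\<Sum>x\<in>I. f x) = (\<Sum>x\<in>I. fock_pderiv i (f x))"
  by (induction I rule: infinite_finite_induct) (simp_all add: fock_pderiv_add)

lemma fock_pderiv_commute: "fock_pderiv i (fock_pderiv j f) = fock_pderiv j (fock_pderiv i f)"
  by (rule poly_mapping_eqI) (simp add: lookup_fock_pderiv lookup_add lookup_single when_def ac_simps)

lemma fock_pderiv_single:
  "fock_pderiv i (Poly_Mapping.single \<mu> c) =
     Poly_Mapping.single (\<mu> - Poly_Mapping.single i 1) (of_nat (Poly_Mapping.lookup \<mu> i) * c)"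
  by (cases "c = 0") (simp_all add: fock_pderiv_def)

lemma fock_pderiv_mult: "fock_pderiv i (f * g) = fock_pderiv i f * g + f * fock_pderiv i g"
proof (induction f rule: fock_induct)
  case (single \<mu> c)
  show ?case
  proof (induction g rule: fock_induct)
    case (single \<nu> d)
    \<comment> \<open>Truncated subtraction passes through the sum of exponents only when the
      exponent of the variable is positive; otherwise the coefficient is 0 on both sides.\<close>
    have 1: "Poly_Mapping.single (\<mu> - Poly_Mapping.single i 1 + \<nu>) (of_nat (Poly_Mapping.lookup \<mu> i) * c * d)
      = Poly_Mapping.single (\<mu> + \<nu> - Poly_Mapping.single i 1) (of_nat (Poly_Mapping.lookup \<mu> i) * c * d)"
    proof (cases "Poly_Mapping.lookup \<mu> i = 0")
      case False
      then have "\<mu> - Poly_Mapping.single i 1 + \<nu> = \<mu> + \<nu> - Poly_Mapping.single i 1"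
        by (auto intro!: poly_mapping_eqI simp: lookup_add lookup_minus lookup_single when_def)
      then show ?thesis
        by simp
    qed simp
    have 2: "Poly_Mapping.single (\<mu> + (\<nu> - Poly_Mapping.single i 1)) (of_nat (Poly_Mapping.lookup \<nu> i) * c * d)
      = Poly_Mapping.single (\<mu> + \<nu> - Poly_Mapping.single i 1) (of_nat (Poly_Mapping.lookup \<nu> i) * c * d)"
    proof (cases "Poly_Mapping.lookup \<nu> i = 0")
      case False
      then have "\<mu> + (\<nu> - Poly_Mapping.single i 1) = \<mu> + \<nu> - Poly_Mapping.single i 1"
        by (auto intro!: poly_mapping_eqI simp: lookup_add lookup_minus lookup_single when_def)
      then show ?thesis
        by simp
    qed simp
    show ?case
      using 1 2 by (simp add: fock_pderiv_single mult_single lookup_add algebra_simps flip: single_add)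
  qed (simp add: fock_pderiv_add algebra_simps)
qed (simp add: fock_pderiv_add algebra_simps)

lemma fock_pderiv_var: "fock_pderiv i (fock_var j) = (if i = j then 1 else 0)"
  by (simp add: fock_var_def fock_pderiv_single lookup_single)

lemma fock_pderiv_const [simp]: "fock_pderiv i (fock_const c) = 0" "fock_pderiv i 1 = 0"
  using fock_pderiv_single[of i 0 c] fock_pderiv_single[of i 0 1] by simp_all

section \<open>The weight grading, which controls all finiteness statements\<close>

definition weight :: "(nat \<Rightarrow>\<^sub>0 nat) \<Rightarrow> nat" where
  "weight \<mu> = (\<Sum>i\<in>Poly_Mapping.keys \<mu>. Suc i * Poly_Mapping.lookup \<mu> i)"

lemma weight_add: "weight (\<mu> + \<nu>) = weight \<mu> + weight \<nu>"
  unfolding weight_def by (rule setsum_keys_plus_distrib) (simp_all add: algebra_simps)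

lemma weight_single [simp]: "weight (Poly_Mapping.single i 1) = Suc i"
  by (simp add: weight_def)

text \<open>The bound is an integer so that derivatives may push it to 0 or below, where the
  polynomial has to vanish.\<close>

definition weight_below :: "int \<Rightarrow> fock \<Rightarrow> bool" where
  "weight_below d f \<longleftrightarrow> (\<forall>\<mu>. Poly_Mapping.lookup f \<mu> \<noteq> 0 \<longrightarrow> int (weight \<mu>) < d)"

lemma weight_below_exists: "\<exists>d. weight_below (int d) f"
proof
  have "weight \<mu> \<le> Max (weight ` Poly_Mapping.keys f)" if "Poly_Mapping.lookup f \<mu> \<noteq> 0" for \<mu>
    using that by (intro Max_ge) (auto simp: in_keys_iff)
  then show "weight_below (int (Suc (Max (weight ` Poly_Mapping.keys f)))) f"
    by (auto simp: weight_below_def less_Suc_eq_le simp del: of_nat_Suc)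
qed

lemma weight_below_zero [simp]: "weight_below d 0"
  by (simp add: weight_below_def)

lemma weight_below_nonpos:
  assumes "weight_below d f" "d \<le> 0"
  shows "f = 0"
proof (rule poly_mapping_eqI)
  fix \<mu>
  have "\<not> int (weight \<mu>) < d"
    using assms(2) by simp
  then show "Poly_Mapping.lookup f \<mu> = Poly_Mapping.lookup 0 \<mu>"
    using assms(1) by (auto simp: weight_below_def)
qed

lemma weight_below_add: "weight_below d f \<Longrightarrow> weight_below d g \<Longrightarrow> weight_below d (f + g)"
  unfolding weight_below_def lookup_add by (metis (no_types, opaque_lifting) add_cancel_right_right)

lemma weight_below_sum: "(\<And>x. x \<in> I \<Longrightarrow> weight_below d (f x)) \<Longrightarrow> weight_below d (\<Sum>x\<in>I. f x)"
  by (induction I rule: infinite_finite_induct) (simp_all add: weight_below_add)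

lemma weight_below_const_mult: "weight_below d f \<Longrightarrow> weight_below d (fock_const a * f)"
  by (simp add: weight_below_def lookup_fock_const_mult)

lemma weight_below_pderiv:
  assumes "weight_below d f"
  shows "weight_below (d - int (Suc i)) (fock_pderiv i f)"
  unfolding weight_below_def
proof (intro allI impI)
  fix \<mu>
  assume "Poly_Mapping.lookup (fock_pderiv i f) \<mu> \<noteq> 0"
  then have "Poly_Mapping.lookup f (\<mu> + Poly_Mapping.single i 1) \<noteq> 0"
    by (auto simp: lookup_fock_pderiv)
  then have "int (weight (\<mu> + Poly_Mapping.single i 1)) < d"
    using assms by (simp add: weight_below_def)
  then show "int (weight \<mu>) < d - int (Suc i)"
    by (simp only: weight_add weight_single)
qed

section \<open>Exponentials of commuting operators\<close>

lemma sum_triangle_swap: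
  fixes f :: "nat \<Rightarrow> nat \<Rightarrow> 'a::comm_monoid_add"
  shows "(\<Sum>m=1..k. \<Sum>n=1..k-m. f m n) = (\<Sum>n=1..k. \<Sum>m=1..k-n. f m n)"
  unfolding sum.Sigma[OF finite_atLeastAtMost ballI[OF finite_atLeastAtMost]]
  by (rule sum.reindex_bij_witness[where i = prod.swap and j = prod.swap]) auto

text \<open>The Euler recursion peels an index \<open>m\<close> off the first factor of a
  convolution; the reindexing moves \<open>m\<close> to the outside.
  \<open>sum_triple_second\<close> does the same for the second factor.\<close>

lemma sum_triple_first:
  fixes f :: "nat \<Rightarrow> nat \<Rightarrow> nat \<Rightarrow> 'a::comm_monoid_add"
  shows "(\<Sum>i\<le>l. \<Sum>m=1..i. f m (i - m) (l - i)) = (\<Sum>m=1..l. \<Sum>i\<le>l-m. f m i (l - m - i))"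
  unfolding sum.Sigma[OF finite_atLeastAtMost ballI[OF finite_atMost]] sum.Sigma[OF finite_atMost ballI[OF finite_atLeastAtMost]]
  by (rule sum.reindex_bij_witness[where i = "\<lambda>(m, i). (i + m, m)" and j = "\<lambda>(i, m). (m, i - m)"]) auto

lemma sum_triple_second:
  fixes f :: "nat \<Rightarrow> nat \<Rightarrow> nat \<Rightarrow> 'a::comm_monoid_add"
  shows "(\<Sum>i\<le>l. \<Sum>m=1..l-i. f m i (l - i - m)) = (\<Sum>m=1..l. \<Sum>i\<le>l-m. f m i (l - m - i))"
  unfolding sum.Sigma[OF finite_atLeastAtMost ballI[OF finite_atMost]] sum.Sigma[OF finite_atMost ballI[OF finite_atLeastAtMost]]
  by (rule sum.reindex_bij_witness[where i = "\<lambda>(m, i). (i, m)" and j = "\<lambda>(i, m). (m, i)"]) (auto simp: add.commute)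

lemma series_power_cong:
  assumes "\<And>m v. m \<ge> 1 \<Longrightarrow> A m v = B m v"
  shows "series_power A j k v = series_power B j k v"
  by (induction j arbitrary: k) (auto intro!: sum.cong assms simp: assms)

lemma exp_coeff_cong:
  assumes "\<And>m v. m \<ge> 1 \<Longrightarrow> A m v = B m v"
  shows "exp_coeff scale A k v = exp_coeff scale B k v"
  by (simp add: exp_coeff_def series_power_cong[of A B, OF assms])

text \<open>Only modes \<open>m \<ge> 1\<close> enter the exponentials. This matters because
  coefficients such as \<open>r ^ m / (1 - (t / q) ^ m)\<close> have a meaningless value at
  \<open>m = 0\<close>.\<close>

lemma vertex_cong:
  assumes "\<And>m v. m \<ge> 1 \<Longrightarrow> A m v = A' m v" "\<And>m v. m \<ge> 1 \<Longrightarrow> B m v = B' m v"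
  shows "vertex scale A B e v = vertex scale A' B' e v"
proof -
  have "exp_coeff scale A = exp_coeff scale A'" "exp_coeff scale B = exp_coeff scale B'"
    by (intro ext exp_coeff_cong assms; assumption)+
  then show ?thesis
    by (simp add: vertex_def cong: if_cong)
qed

context
  fixes scale :: "complex \<Rightarrow> 'v::ab_group_add \<Rightarrow> 'v" and A :: "nat \<Rightarrow> 'v \<Rightarrow> 'v"
  assumes vs: "vector_space scale"
    and A_add: "\<And>m v w. A m (v + w) = A m v + A m w"
    and A_scale: "\<And>m a v. A m (scale a v) = scale a (A m v)"
begin

interpretation vector_space scale
  by (rule vs)

lemma A_zero: "A m 0 = 0"
  using A_scale[of m 0 0] by simp

lemma A_sum: "A m (\<Sum>i\<in>I. f i) = (\<Sum>i\<in>I. A m (f i))"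
  by (induction I rule: infinite_finite_induct) (simp_all add: A_zero A_add)

text \<open>Each of the \<open>j\<close> factors starts in degree 1.\<close>

lemma series_power_eq_0: "k < j \<Longrightarrow> series_power A j k v = 0"
proof (induction j arbitrary: k)
  case (Suc j)
  have "A m (series_power A j (k - m) v) = 0" if "m \<in> {1..k}" for m
    using that Suc.prems by (subst Suc.IH) (auto simp: A_zero)
  then show ?case
    by simp
qed simp

lemma series_power_add: "series_power A j k (v + w) = series_power A j k v + series_power A j k w"
  by (induction j arbitrary: k) (simp_all add: A_add sum.distrib)

lemma series_power_scale: "series_power A j k (scale a v) = scale a (series_power A j k v)"
  by (induction j arbitrary: k) (simp_all add: A_scale scale_sum_right)

lemma exp_coeff_add: "exp_coeff scale A k (v + w) = exp_coeff scale A k v + exp_coeff scale A k w"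
  by (simp add: exp_coeff_def series_power_add scale_right_distrib sum.distrib)

lemma exp_coeff_scale: "exp_coeff scale A k (scale a v) = scale a (exp_coeff scale A k v)"
  by (simp add: exp_coeff_def series_power_scale scale_sum_right mult.commute)

lemma exp_coeff_0: "exp_coeff scale A 0 v = v"
  by (simp add: exp_coeff_def)

text \<open>Coefficient form of \<open>z d/dz\<close> applied to \<open>A(z)\<^sup>j\<^sup>+\<^sup>1\<close> and to \<open>exp A(z)\<close>.\<close>

lemma series_power_euler:
  assumes "\<And>m n v. A m (A n v) = A n (A m v)"
  shows "scale (of_nat k) (series_power A (Suc j) k v) =
    scale (of_nat (Suc j)) (\<Sum>m=1..k. scale (of_nat m) (A m (series_power A j (k - m) v)))"
proof (induction j arbitrary: k)
  case 0
  show ?case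
    by (simp add: scale_sum_right) (intro sum.cong, auto simp: A_zero)
next
  case (Suc j)
  let ?P = "\<lambda>j k. series_power A j k v"
  have "scale (of_nat k) (?P (Suc (Suc j)) k) = (\<Sum>m=1..k. scale (of_nat k) (A m (?P (Suc j) (k - m))))"
    by (simp only: series_power.simps(2)[of A "Suc j"] scale_sum_right)
  \<comment> \<open>Leibniz rule: \<open>k = m + (k - m)\<close> splits the degree between the outer
    factor and the remaining power, to which the induction hypothesis applies.\<close>
  also have "\<dots> = (\<Sum>m=1..k. scale (of_nat m) (A m (?P (Suc j) (k - m))) + A m (scale (of_nat (k - m)) (?P (Suc j) (k - m))))"
    by (intro sum.cong refl) (auto simp: A_scale of_nat_diff simp flip: scale_left_distrib simp del: series_power.simps)
  also have "\<dots> = (\<Sum>m=1..k. scale (of_nat m) (A m (?P (Suc j) (k - m)))) +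
      (\<Sum>m=1..k. \<Sum>n=1..k-m. scale (of_nat (Suc j)) (scale (of_nat n) (A m (A n (?P j (k - m - n))))))"
    by (simp only: Suc.IH sum.distrib A_scale A_sum scale_sum_right)
  \<comment> \<open>Commutativity brings the marked factor \<open>A n\<close> to the front, so that
    the inner sum is again a power.\<close>
  also have "(\<Sum>m=1..k. \<Sum>n=1..k-m. scale (of_nat (Suc j)) (scale (of_nat n) (A m (A n (?P j (k - m - n)))))) =
      (\<Sum>n=1..k. \<Sum>m=1..k-n. scale (of_nat (Suc j)) (scale (of_nat n) (A n (A m (?P j (k - n - m))))))"
    by (subst sum_triangle_swap) (simp add: assms add.commute)
  also have "\<dots> = scale (of_nat (Suc j)) (\<Sum>n=1..k. scale (of_nat n) (A n (?P (Suc j) (k - n))))"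
    by (simp only: series_power.simps(2)[of A j] A_sum scale_sum_right)
  also have "(\<Sum>m=1..k. scale (of_nat m) (A m (?P (Suc j) (k - m)))) + \<dots> =
      scale (of_nat (Suc (Suc j))) (\<Sum>m=1..k. scale (of_nat m) (A m (?P (Suc j) (k - m))))"
    by (simp only: of_nat_Suc[of "Suc j"] scale_left_distrib scale_one)
  finally show ?case .
qed

lemma exp_coeff_euler:
  assumes "\<And>m n v. A m (A n v) = A n (A m v)"
  shows "scale (of_nat k) (exp_coeff scale A k v) = (\<Sum>m=1..k. scale (of_nat m) (A m (exp_coeff scale A (k - m) v)))"
proof (cases "k = 0")
  case False
  let ?P = "\<lambda>j k. series_power A j k v"
  have "scale (of_nat k) (exp_coeff scale A k v) = (\<Sum>j\<le>k. scale (1 / fact j) (scale (of_nat k) (?P j k)))"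
    by (simp add: exp_coeff_def scale_sum_right mult.commute)
  also have "\<dots> = (\<Sum>j<k. scale (1 / fact (Suc j)) (scale (of_nat k) (?P (Suc j) k)))"
    using False by (subst sum.atMost_shift) simp
  also have "\<dots> = (\<Sum>j<k. scale (1 / fact j) (\<Sum>m=1..k. scale (of_nat m) (A m (?P j (k - m)))))"
  proof (intro sum.cong refl)
    fix j
    have "1 / fact (Suc j) * of_nat (Suc j) = (1 / fact j :: complex)"
      by (simp del: of_nat_Suc)
    then show "scale (1 / fact (Suc j)) (scale (of_nat k) (?P (Suc j) k)) = 
       scale (1 / fact j) (\<Sum>m=1..k. scale (of_nat m) (A m (?P j (k - m))))"
      by (simp only: series_power_euler[OF assms] scale_scale)
  qed
  also have "\<dots> = (\<Sum>m=1..k. scale (of_nat m) (A m (\<Sum>j<k. scale (1 / fact j) (?P j (k - m)))))"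
    by (simp add: scale_sum_right A_sum A_scale mult.commute) (rule sum.swap)
  \<comment> \<open>The range \<open>j < k\<close> exceeds \<open>j \<le> k - m\<close> only by
    powers that vanish in degree \<open>k - m\<close>.\<close>
  also have "\<dots> = (\<Sum>m=1..k. scale (of_nat m) (A m (exp_coeff scale A (k - m) v)))"
    unfolding exp_coeff_def
    by (intro sum.cong refl arg_cong2[of _ _ _ _ scale] arg_cong[of _ _ "A _"] sum.mono_neutral_right)
       (auto simp: series_power_eq_0)
  finally show ?thesis .
qed simp

end

section \<open>Raising and lowering modes on the Fock space and their contraction\<close>

declare One_nat_def [simp del]

definition creation :: "(nat \<Rightarrow> complex) \<Rightarrow> nat \<Rightarrow> fock \<Rightarrow> fock" where
  "creation a m h = fock_const (a m) * fock_var (m - 1) * h"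

definition annihilation :: "(nat \<Rightarrow> complex) \<Rightarrow> nat \<Rightarrow> fock \<Rightarrow> fock" where
  "annihilation b m h = fock_const (b m) * fock_pderiv (m - 1) h"

definition exp_raise :: "(nat \<Rightarrow> complex) \<Rightarrow> nat \<Rightarrow> fock" where
  "exp_raise a k = exp_coeff fock_scale (creation a) k 1"

definition exp_lower :: "(nat \<Rightarrow> complex) \<Rightarrow> nat \<Rightarrow> fock \<Rightarrow> fock" where
  "exp_lower b = exp_coeff fock_scale (annihilation b)"

text \<open>The exponents of a lowering and a raising exponential commute up to the scalars
  \<open>a m * b m\<close>; this is the resulting Baker-Campbell-Hausdorff factor.\<close>

definition contraction :: "(nat \<Rightarrow> complex) \<Rightarrow> (nat \<Rightarrow> complex) \<Rightarrow> complex fps" where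
  "contraction a b = fps_exp 1 oo Abs_fps (\<lambda>m. if m = 0 then 0 else a m * b m)"

text \<open>Coefficient comparison in \<open>F' = L' F\<close>, the scalar counterpart of the Euler
  recursion for operators.\<close>

lemma fps_exp_compose_euler:
  fixes L :: "'a::field_char_0 fps"
  assumes "fps_nth L 0 = 0"
  shows "of_nat n * fps_nth (fps_exp 1 oo L) n = (\<Sum>m=1..n. of_nat m * fps_nth L m * fps_nth (fps_exp 1 oo L) (n - m))"
proof (cases n)
  case (Suc k)
  have "fps_deriv (fps_exp 1 oo L) = fps_deriv L * (fps_exp 1 oo L)"
    by (simp add: fps_compose_deriv[OF assms] mult.commute)
  then have "of_nat n * fps_nth (fps_exp 1 oo L) n = fps_nth (fps_deriv L * (fps_exp 1 oo L)) k"
    by (metis Suc Suc_eq_plus1 fps_deriv_nth)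
  also have "\<dots> = (\<Sum>i=0..k. of_nat (Suc i) * fps_nth L (Suc i) * fps_nth (fps_exp 1 oo L) (n - Suc i))"
    by (simp add: fps_mult_nth Suc Suc_eq_plus1 add.commute)
  also have "\<dots> = (\<Sum>m=Suc 0..Suc k. of_nat m * fps_nth L m * fps_nth (fps_exp 1 oo L) (n - m))"
    by (simp only: sum.shift_bounds_cl_Suc_ivl)
  finally show ?thesis
    by (simp add: Suc One_nat_def)
qed simp

lemma contraction_0 [simp]: "fps_nth (contraction a b) 0 = 1"
  by (simp add: contraction_def)

lemma contraction_euler:
  "of_nat n * fps_nth (contraction a b) n = (\<Sum>m=1..n. of_nat m * (a m * b m) * fps_nth (contraction a b) (n - m))"
  unfolding contraction_def by (subst fps_exp_compose_euler) (auto intro!: sum.cong)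

lemma of_nat_fock_const: "of_nat n = fock_const (of_nat n)"
  by simp

lemma exp_raise_0 [simp]: "exp_raise a 0 = 1"
  unfolding exp_raise_def by (rule exp_coeff_0[OF vector_space_fock_scale]) (simp_all add: creation_def fock_scale_eq algebra_simps)

lemma exp_raise_euler:
  "of_nat k * exp_raise a k = (\<Sum>m=1..k. of_nat m * fock_const (a m) * fock_var (m - 1) * exp_raise a (k - m))"
  using exp_coeff_euler[OF vector_space_fock_scale, of "creation a" k 1]
  by (simp add: creation_def fock_scale_eq algebra_simps exp_raise_def)

lemma exp_coeff_creation: "exp_coeff fock_scale (creation a) k f = exp_raise a k * f"
proof -
  have "series_power (creation a) j k f = series_power (creation a) j k 1 * f" for j
    by (induction j arbitrary: k) (simp_all add: creation_def sum_distrib_right mult.assoc)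
  then show ?thesis
    by (simp add: exp_raise_def exp_coeff_def sum_distrib_right fock_scale_eq mult.assoc)
qed

lemma annihilation_linear:
  "annihilation b m (f + g) = annihilation b m f + annihilation b m g"
  "annihilation b m (fock_scale c f) = fock_scale c (annihilation b m f)"
  by (simp_all add: annihilation_def fock_scale_eq fock_pderiv_add fock_pderiv_const_mult distrib_left mult.left_commute)

lemma annihilation_commute: "annihilation b m (annihilation b' n f) = annihilation b' n (annihilation b m f)"
  by (simp add: annihilation_def fock_pderiv_const_mult fock_pderiv_commute[of "m - 1"] mult.left_commute)

lemma exp_lower_0 [simp]: "exp_lower b 0 f = f"
  unfolding exp_lower_def by (rule exp_coeff_0[OF vector_space_fock_scale]) (simp_all add: annihilation_linear)

lemma exp_lower_add: "exp_lower b k (f + g) = exp_lower b k f + exp_lower b k g"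
  unfolding exp_lower_def by (rule exp_coeff_add[OF vector_space_fock_scale]) (simp_all add: annihilation_linear)

lemma exp_lower_const_mult: "exp_lower b k (fock_const c * f) = fock_const c * exp_lower b k f"
  using exp_coeff_scale[OF vector_space_fock_scale, of "annihilation b" k c f]
  by (simp add: annihilation_linear exp_lower_def flip: fock_scale_eq)

lemma exp_lower_zero [simp]: "exp_lower b k 0 = 0"
  using exp_lower_const_mult[of b k 0 0] by simp

lemma exp_lower_sum: "exp_lower b k (\<Sum>i\<in>I. f i) = (\<Sum>i\<in>I. exp_lower b k (f i))"
  by (induction I rule: infinite_finite_induct) (simp_all add: exp_lower_add)

lemma exp_lower_euler:
  "of_nat k * exp_lower b k f = (\<Sum>m=1..k. of_nat m * fock_const (b m) * fock_pderiv (m - 1) (exp_lower b (k - m) f))"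
  using exp_coeff_euler[OF vector_space_fock_scale, of "annihilation b" k f]
  by (simp add: annihilation_commute annihilation_linear exp_lower_def)
     (simp add: annihilation_def fock_scale_eq mult.assoc)

text \<open>Two families of operators are equal if they satisfy the same Euler recursion.\<close>

lemma fock_pderiv_of_nat_mult: "fock_pderiv i (of_nat k * f) = of_nat k * fock_pderiv i f"
  unfolding of_nat_fock_const by (rule fock_pderiv_const_mult)

lemma fock_pderiv_of_nat [simp]: "fock_pderiv i (of_nat n) = 0"
  unfolding of_nat_fock_const by (rule fock_pderiv_const)

lemma exp_lower_of_nat_mult: "exp_lower b l (of_nat k * f) = of_nat k * exp_lower b l f"
  unfolding of_nat_fock_const by (rule exp_lower_const_mult)

lemma fock_pderiv_exp_lower: "fock_pderiv i (exp_lower b k f) = exp_lower b k (fock_pderiv i f)"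
proof (induction k rule: less_induct)
  case (less k)
  show ?case
  proof (cases "k = 0")
    case False
    have "of_nat k * fock_pderiv i (exp_lower b k f) = fock_pderiv i (of_nat k * exp_lower b k f)"
      by (simp add: fock_pderiv_of_nat_mult)
    also have "\<dots> = (\<Sum>m=1..k. of_nat m * fock_const (b m) * fock_pderiv (m - 1) (fock_pderiv i (exp_lower b (k - m) f)))"
      unfolding exp_lower_euler fock_pderiv_sum
      by (simp only: mult.assoc fock_pderiv_of_nat_mult fock_pderiv_const_mult fock_pderiv_commute[of i])
    also have "\<dots> = of_nat k * exp_lower b k (fock_pderiv i f)"
      unfolding exp_lower_euler using False by (intro sum.cong refl) (simp add: less.IH)
    finally show ?thesis
      using False by (rule fock_of_nat_cancel)
  qed simp
qed

lemma exp_lower_commute: "exp_lower b k (exp_lower b' l f) = exp_lower b' l (exp_lower b k f)"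
proof (induction k rule: less_induct)
  case (less k)
  show ?case
  proof (cases "k = 0")
    case False
    have "of_nat k * exp_lower b' l (exp_lower b k f) = exp_lower b' l (of_nat k * exp_lower b k f)"
      by (simp add: exp_lower_of_nat_mult)
    also have "\<dots> = (\<Sum>m=1..k. of_nat m * fock_const (b m) * fock_pderiv (m - 1) (exp_lower b' l (exp_lower b (k - m) f)))"
      unfolding exp_lower_euler[of k] exp_lower_sum
      by (simp only: mult.assoc exp_lower_of_nat_mult exp_lower_const_mult fock_pderiv_exp_lower)
    also have "\<dots> = of_nat k * exp_lower b k (exp_lower b' l f)"
      unfolding exp_lower_euler[of k] using False by (intro sum.cong refl) (simp add: less.IH)
    finally show ?thesis
      using False by (rule fock_of_nat_cancel[of k, OF sym])
  qed simp
qed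

text \<open>By the Leibniz rule the convolution on the right satisfies the Euler recursion of the
  left side.\<close>

lemma exp_lower_mult: "exp_lower b l (f * g) = (\<Sum>i\<le>l. exp_lower b i f * exp_lower b (l - i) g)"
proof (induction l rule: less_induct)
  case (less l)
  show ?case
  proof (cases "l = 0")
    case False
    let ?T = "exp_lower b" and ?D = "\<lambda>m. fock_pderiv (m - 1)"
    have "of_nat l * (\<Sum>i\<le>l. ?T i f * ?T (l - i) g) =
      (\<Sum>i\<le>l. (of_nat i * ?T i f) * ?T (l - i) g) + (\<Sum>i\<le>l. ?T i f * (of_nat (l - i) * ?T (l - i) g))"
      by (simp add: sum_distrib_left flip: sum.distrib) (intro sum.cong refl, auto simp: of_nat_diff algebra_simps)
    also have "(\<Sum>i\<le>l. (of_nat i * ?T i f) * ?T (l - i) g) =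
      (\<Sum>i\<le>l. \<Sum>m=1..i. of_nat m * fock_const (b m) * ?D m (?T (i - m) f) * ?T (l - i) g)"
      unfolding exp_lower_euler sum_distrib_right ..
    also have "\<dots> = (\<Sum>m=1..l. \<Sum>i\<le>l-m. of_nat m * fock_const (b m) * ?D m (?T i f) * ?T (l - m - i) g)"
      by (rule sum_triple_first)
    also have "(\<Sum>i\<le>l. ?T i f * (of_nat (l - i) * ?T (l - i) g)) =
      (\<Sum>i\<le>l. \<Sum>m=1..l-i. ?T i f * (of_nat m * fock_const (b m) * ?D m (?T (l - i - m) g)))"
      unfolding exp_lower_euler sum_distrib_left ..
    also have "\<dots> = (\<Sum>m=1..l. \<Sum>i\<le>l-m. ?T i f * (of_nat m * fock_const (b m) * ?D m (?T (l - m - i) g)))"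
      by (rule sum_triple_second)
    also have "(\<Sum>m=1..l. \<Sum>i\<le>l-m. of_nat m * fock_const (b m) * ?D m (?T i f) * ?T (l - m - i) g) + \<dots>
      = (\<Sum>m=1..l. of_nat m * fock_const (b m) * ?D m (\<Sum>i\<le>l-m. ?T i f * ?T (l - m - i) g))"
      by (simp only: sum.distrib[symmetric] fock_pderiv_sum fock_pderiv_mult sum_distrib_left) (simp only: algebra_simps)
    also have "\<dots> = of_nat l * ?T l (f * g)"
      unfolding exp_lower_euler[of l] using False by (intro sum.cong refl) (simp add: less.IH)
    finally show ?thesis
      using False by (rule fock_of_nat_cancel[of l, OF sym])
  qed simp
qed

lemma fock_pderiv_monomial_mult:
  "fock_pderiv i (of_nat n * fock_const c * fock_var j * h) =
     of_nat n * fock_const c * (if i = j then h else 0) + of_nat n * fock_const c * fock_var j * fock_pderiv i h"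
  by (simp only: mult.assoc fock_pderiv_of_nat_mult fock_pderiv_const_mult fock_pderiv_mult fock_pderiv_var) (simp add: distrib_left)

text \<open>The derivative of \<open>exp (\<Sum> a_m x_m z^m)\<close> in \<open>x_m\<close> brings
  down \<open>a_m z^m\<close>, which costs \<open>m\<close> degrees.\<close>

lemma fock_pderiv_exp_raise:
  assumes "m \<ge> 1"
  shows "fock_pderiv (m - 1) (exp_raise a k) = (if m \<le> k then fock_const (a m) * exp_raise a (k - m) else 0)"
proof (induction k rule: less_induct)
  case (less k)
  let ?R = "\<lambda>k. if m \<le> k then fock_const (a m) * exp_raise a (k - m) else 0"
  show ?case
  proof (cases "k = 0")
    case False
    have "of_nat k * fock_pderiv (m - 1) (exp_raise a k) = fock_pderiv (m - 1) (of_nat k * exp_raise a k)"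
      by (simp add: fock_pderiv_of_nat_mult)
    also have "\<dots> = (\<Sum>n=1..k. of_nat n * fock_const (a n) * (if m = n then exp_raise a (k - n) else 0))
        + (\<Sum>n=1..k. of_nat n * fock_const (a n) * fock_var (n - 1) * ?R (k - n))"
      unfolding exp_raise_euler fock_pderiv_sum sum.distrib[symmetric] fock_pderiv_monomial_mult
    proof (intro sum.cong refl arg_cong2[of _ _ _ _ "(+)"] arg_cong2[of _ _ _ _ "(*)"])
      fix n
      assume "n \<in> {1..k}"
      then show "(if m - 1 = n - 1 then exp_raise a (k - n) else 0) = (if m = n then exp_raise a (k - n) else 0)"
        "fock_pderiv (m - 1) (exp_raise a (k - n)) = ?R (k - n)"
        using assms by (auto simp: less.IH)
    qed
    also have "(\<Sum>n=1..k. of_nat n * fock_const (a n) * (if m = n then exp_raise a (k - n) else 0)) = of_nat m * ?R k"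
      using assms by (simp add: if_distrib sum.delta mult.assoc cong: if_cong)
    \<comment> \<open>Once \<open>a m\<close> is pulled out, this is the Euler recursion in degree
      \<open>k - m\<close>; together with the factor \<open>m\<close> of the first sum it yields
      \<open>k\<close>.\<close>
    also have "(\<Sum>n=1..k. of_nat n * fock_const (a n) * fock_var (n - 1) * ?R (k - n)) = of_nat (k - m) * ?R k"
    proof (cases "m \<le> k")
      case True
      have "(\<Sum>n=1..k. of_nat n * fock_const (a n) * fock_var (n - 1) * ?R (k - n))
        = (\<Sum>n=1..k-m. of_nat n * fock_const (a n) * fock_var (n - 1) * (fock_const (a m) * exp_raise a (k - m - n)))"
        by (rule sum.mono_neutral_cong_right) (auto simp: diff_commute add.commute)
      also have "\<dots> = fock_const (a m) * (of_nat (k - m) * exp_raise a (k - m))"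
        unfolding exp_raise_euler sum_distrib_left by (simp only: mult_ac)
      finally show ?thesis
        using True by (simp add: mult_ac)
    next
      case False
      then show ?thesis
        by (subst sum.neutral) auto
    qed
    also have "of_nat m * ?R k + of_nat (k - m) * ?R k = of_nat k * ?R k"
      by (auto simp: of_nat_diff algebra_simps)
    finally show ?thesis
      using False by (rule fock_of_nat_cancel)
  qed (use assms in simp)
qed

text \<open>A raising exponential is a common eigenvector of all derivatives, so a lowering
  exponential only multiplies it by the scalar contraction series.\<close>

lemma exp_lower_exp_raise:
  "exp_lower b l (exp_raise a k) = (if l \<le> k then fock_const (fps_nth (contraction a b) l) * exp_raise a (k - l) else 0)"
proof (induction l rule: less_induct)
  case (less l)
  let ?C = "fps_nth (contraction a b)"
  show ?case
  proof (cases "l = 0")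
    case False
    have "of_nat l * exp_lower b l (exp_raise a k) = 
      (\<Sum>m=1..l. of_nat m * fock_const (b m) * (if l \<le> k then fock_const (?C (l - m) * a m) * exp_raise a (k - l) else 0))"
      unfolding exp_lower_euler[of l]
    proof (intro sum.cong refl arg_cong2[of _ _ _ _ "(*)"])
      fix m
      assume m: "m \<in> {1..l}"
      have "fock_pderiv (m - 1) (exp_lower b (l - m) (exp_raise a k)) =
        (if l - m \<le> k then fock_const (?C (l - m)) * fock_pderiv (m - 1) (exp_raise a (k - (l - m))) else 0)"
        using m by (simp add: less.IH fock_pderiv_const_mult)
      also have "\<dots> = (if l \<le> k then fock_const (?C (l - m) * a m) * exp_raise a (k - l) else 0)"
        using m by (auto simp: fock_pderiv_exp_raise fock_const_mult mult.assoc)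
      finally show "fock_pderiv (m - 1) (exp_lower b (l - m) (exp_raise a k)) = \<dots>" .
    qed
    also have "\<dots> = of_nat l * (if l \<le> k then fock_const (?C l) * exp_raise a (k - l) else 0)"
    proof (cases "l \<le> k")
      case True
      have "of_nat l * fock_const (?C l) = (\<Sum>m=1..l. of_nat m * fock_const (b m) * fock_const (?C (l - m) * a m))"
        unfolding of_nat_fock_const fock_const_mult[symmetric] contraction_euler fock_const_sum
        by (simp only: mult_ac)
      then show ?thesis
        using True by (simp add: sum_distrib_right mult.assoc[symmetric])
    qed simp
    finally show ?thesis
      using False by (rule fock_of_nat_cancel)
  qed simp
qed

lemma exp_raise_scale: "exp_raise (\<lambda>m. c ^ m * a m) k = fock_const (c ^ k) * exp_raise a k"
proof (induction k rule: less_induct)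
  case (less k)
  show ?case
  proof (cases "k = 0")
    case False
    have "of_nat k * exp_raise (\<lambda>m. c ^ m * a m) k =
      (\<Sum>m=1..k. of_nat m * fock_const (c ^ m * a m) * fock_var (m - 1) * (fock_const (c ^ (k - m)) * exp_raise a (k - m)))"
      unfolding exp_raise_euler[of k] by (intro sum.cong refl) (simp add: less.IH)
    also have "\<dots> = (\<Sum>m=1..k. fock_const (c ^ k) * (of_nat m * fock_const (a m) * fock_var (m - 1) * exp_raise a (k - m)))"
    proof (intro sum.cong refl)
      fix m
      assume "m \<in> {1..k}"
      then have "c ^ k = c ^ m * c ^ (k - m)"
        by (simp flip: power_add)
      then show "of_nat m * fock_const (c ^ m * a m) * fock_var (m - 1) * (fock_const (c ^ (k - m)) * exp_raise a (k - m))
        = fock_const (c ^ k) * (of_nat m * fock_const (a m) * fock_var (m - 1) * exp_raise a (k - m))"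
        by (simp only: fock_const_mult mult_ac)
    qed
    also have "\<dots> = of_nat k * (fock_const (c ^ k) * exp_raise a k)"
      by (simp only: sum_distrib_left[symmetric] exp_raise_euler[symmetric] mult.left_commute)
    finally show ?thesis
      using False by (rule fock_of_nat_cancel)
  qed simp
qed

lemma exp_lower_scale: "exp_lower (\<lambda>m. c ^ m * b m) k f = fock_const (c ^ k) * exp_lower b k f"
proof (induction k rule: less_induct)
  case (less k)
  show ?case
  proof (cases "k = 0")
    case False
    have "of_nat k * exp_lower (\<lambda>m. c ^ m * b m) k f =
      (\<Sum>m=1..k. of_nat m * fock_const (c ^ m * b m) * (fock_const (c ^ (k - m)) * fock_pderiv (m - 1) (exp_lower b (k - m) f)))"
      unfolding exp_lower_euler[of k] by (intro sum.cong refl) (simp add: less.IH fock_pderiv_const_mult)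
    also have "\<dots> = (\<Sum>m=1..k. fock_const (c ^ k) * (of_nat m * fock_const (b m) * fock_pderiv (m - 1) (exp_lower b (k - m) f)))"
    proof (intro sum.cong refl)
      fix m
      assume "m \<in> {1..k}"
      then have "c ^ k = c ^ m * c ^ (k - m)"
        by (simp flip: power_add)
      then show "of_nat m * fock_const (c ^ m * b m) * (fock_const (c ^ (k - m)) * fock_pderiv (m - 1) (exp_lower b (k - m) f))
        = fock_const (c ^ k) * (of_nat m * fock_const (b m) * fock_pderiv (m - 1) (exp_lower b (k - m) f))"
        by (simp only: fock_const_mult mult_ac)
    qed
    also have "\<dots> = of_nat k * (fock_const (c ^ k) * exp_lower b k f)"
      by (simp only: sum_distrib_left[symmetric] exp_lower_euler[symmetric] mult.left_commute)
    finally show ?thesis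
      using False by (rule fock_of_nat_cancel)
  qed simp
qed

lemma exp_raise_add: "exp_raise (\<lambda>m. a m + a' m) l = (\<Sum>i\<le>l. exp_raise a i * exp_raise a' (l - i))"
proof (induction l rule: less_induct)
  case (less l)
  show ?case
  proof (cases "l = 0")
    case False
    let ?E = "exp_raise a" and ?E' = "exp_raise a'"
    have "of_nat l * (\<Sum>i\<le>l. ?E i * ?E' (l - i)) =
      (\<Sum>i\<le>l. (of_nat i * ?E i) * ?E' (l - i)) + (\<Sum>i\<le>l. ?E i * (of_nat (l - i) * ?E' (l - i)))"
      by (simp add: sum_distrib_left flip: sum.distrib) (intro sum.cong refl, auto simp: of_nat_diff algebra_simps)
    also have "(\<Sum>i\<le>l. (of_nat i * ?E i) * ?E' (l - i)) =
      (\<Sum>i\<le>l. \<Sum>m=1..i. of_nat m * fock_const (a m) * fock_var (m - 1) * ?E (i - m) * ?E' (l - i))"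
      unfolding exp_raise_euler sum_distrib_right ..
    also have "\<dots> = (\<Sum>m=1..l. \<Sum>i\<le>l-m. of_nat m * fock_const (a m) * fock_var (m - 1) * ?E i * ?E' (l - m - i))"
      by (rule sum_triple_first)
    also have "(\<Sum>i\<le>l. ?E i * (of_nat (l - i) * ?E' (l - i))) =
      (\<Sum>i\<le>l. \<Sum>m=1..l-i. ?E i * (of_nat m * fock_const (a' m) * fock_var (m - 1) * ?E' (l - i - m)))"
      unfolding exp_raise_euler sum_distrib_left ..
    also have "\<dots> = (\<Sum>m=1..l. \<Sum>i\<le>l-m. ?E i * (of_nat m * fock_const (a' m) * fock_var (m - 1) * ?E' (l - m - i)))"
      by (rule sum_triple_second)
    also have "(\<Sum>m=1..l. \<Sum>i\<le>l-m. of_nat m * fock_const (a m) * fock_var (m - 1) * ?E i * ?E' (l - m - i)) + \<dots>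
      = (\<Sum>m=1..l. of_nat m * fock_const (a m + a' m) * fock_var (m - 1) * (\<Sum>i\<le>l-m. ?E i * ?E' (l - m - i)))"
      by (simp only: sum.distrib[symmetric] sum_distrib_left fock_const_add) (simp only: algebra_simps)
    also have "\<dots> = of_nat l * exp_raise (\<lambda>m. a m + a' m) l"
      unfolding exp_raise_euler[of l] by (intro sum.cong refl) (simp add: less.IH)
    finally show ?thesis
      using False by (rule fock_of_nat_cancel[of l, OF sym])
  qed simp
qed

lemma exp_lower_plus: "exp_lower (\<lambda>m. b m + b' m) l f = (\<Sum>i\<le>l. exp_lower b i (exp_lower b' (l - i) f))"
proof (induction l rule: less_induct)
  case (less l)
  show ?case
  proof (cases "l = 0")
    case False
    let ?T = "exp_lower b" and ?T' = "exp_lower b'" and ?D = "\<lambda>m. fock_pderiv (m - 1)"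
    have "of_nat l * (\<Sum>i\<le>l. ?T i (?T' (l - i) f)) =
      (\<Sum>i\<le>l. of_nat i * ?T i (?T' (l - i) f)) + (\<Sum>i\<le>l. ?T i (of_nat (l - i) * ?T' (l - i) f))"
      by (simp only: sum_distrib_left exp_lower_of_nat_mult sum.distrib[symmetric])
         (intro sum.cong refl, auto simp: of_nat_diff algebra_simps)
    also have "(\<Sum>i\<le>l. of_nat i * ?T i (?T' (l - i) f)) =
      (\<Sum>i\<le>l. \<Sum>m=1..i. of_nat m * fock_const (b m) * ?D m (?T (i - m) (?T' (l - i) f)))"
      unfolding exp_lower_euler ..
    also have "\<dots> = (\<Sum>m=1..l. \<Sum>i\<le>l-m. of_nat m * fock_const (b m) * ?D m (?T i (?T' (l - m - i) f)))"
      by (rule sum_triple_first)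
    also have "(\<Sum>i\<le>l. ?T i (of_nat (l - i) * ?T' (l - i) f)) =
      (\<Sum>i\<le>l. \<Sum>m=1..l-i. of_nat m * fock_const (b' m) * ?D m (?T i (?T' (l - i - m) f)))"
      unfolding exp_lower_euler exp_lower_sum
      by (simp only: mult.assoc exp_lower_of_nat_mult exp_lower_const_mult fock_pderiv_exp_lower)
    also have "\<dots> = (\<Sum>m=1..l. \<Sum>i\<le>l-m. of_nat m * fock_const (b' m) * ?D m (?T i (?T' (l - m - i) f)))"
      by (rule sum_triple_second)
    also have "(\<Sum>m=1..l. \<Sum>i\<le>l-m. of_nat m * fock_const (b m) * ?D m (?T i (?T' (l - m - i) f))) + \<dots>
      = (\<Sum>m=1..l. of_nat m * fock_const (b m + b' m) * ?D m (\<Sum>i\<le>l-m. ?T i (?T' (l - m - i) f)))"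
      by (simp only: sum.distrib[symmetric] sum_distrib_left fock_const_add fock_pderiv_sum) (simp only: algebra_simps)
    also have "\<dots> = of_nat l * exp_lower (\<lambda>m. b m + b' m) l f"
      unfolding exp_lower_euler[of l] by (intro sum.cong refl) (simp add: less.IH)
    finally show ?thesis
      using False by (rule fock_of_nat_cancel[of l, OF sym])
  qed simp
qed

text \<open>All terms of the \<open>k\<close>-th lowering mode remove weight exactly
  \<open>k\<close>; hence only finitely many modes act nontrivially on a given polynomial.\<close>

lemma weight_below_exp_lower:
  assumes "weight_below d f"
  shows "weight_below (d - int k) (exp_lower b k f)"
proof -
  have "weight_below (d - int k) (series_power (annihilation b) j k f)" for j
  proof (induction j arbitrary: k)
    case (Suc j)
    show ?case
      unfolding series_power.simps
    proof (rule weight_below_sum)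
      fix m
      assume m: "m \<in> {1..k}"
      have "weight_below (d - int (k - m) - int (Suc (m - 1))) (fock_pderiv (m - 1) (series_power (annihilation b) j (k - m) f))"
        by (intro weight_below_pderiv Suc.IH)
      also have "d - int (k - m) - int (Suc (m - 1)) = d - int k"
        using m by auto
      finally show "weight_below (d - int k) (annihilation b m (series_power (annihilation b) j (k - m) f))"
        unfolding annihilation_def by (rule weight_below_const_mult)
    qed
  qed (use assms in simp)
  then show ?thesis
    unfolding exp_lower_def exp_coeff_def fock_scale_eq
    by (intro weight_below_sum weight_below_const_mult)
qed

lemma exp_lower_one: "exp_lower b k 1 = (if k = 0 then 1 else 0)"
proof (cases "k = 0")
  case False
  have "of_nat k * exp_lower b k 1 = of_nat k * 0"
    unfolding exp_lower_euler by (simp add: fock_pderiv_exp_lower)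
  then have "exp_lower b k 1 = 0"
    using False by (rule fock_of_nat_cancel)
  then show ?thesis
    using False by simp
qed simp

text \<open>In generating form this is the shift \<open>x_m + b_m y^m\<close> of the variable, where
  \<open>y\<close> marks the degree.\<close>

lemma exp_lower_var:
  assumes "m \<ge> 1"
  shows "exp_lower b k (fock_var (m - 1)) = (if k = 0 then fock_var (m - 1) else if k = m then fock_const (b m) else 0)"
proof (cases "k = 0")
  case False
  have "of_nat k * exp_lower b k (fock_var (m - 1)) = (\<Sum>n=1..k. if n = m then of_nat m * fock_const (b m) * (if k = m then 1 else 0) else 0)"
    unfolding exp_lower_euler using assms
    by (intro sum.cong refl) (auto simp: fock_pderiv_exp_lower fock_pderiv_var exp_lower_one)
  also have "\<dots> = of_nat k * (if k = m then fock_const (b m) else 0)"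
    using assms by auto
  finally have "exp_lower b k (fock_var (m - 1)) = (if k = m then fock_const (b m) else 0)"
    using False by (rule fock_of_nat_cancel)
  then show ?thesis
    using False by simp
qed simp

lemma exp_lower_var_mult:
  assumes "m \<ge> 1"
  shows "exp_lower b k (fock_var (m - 1) * f) =
    fock_var (m - 1) * exp_lower b k f + (if m \<le> k then fock_const (b m) * exp_lower b (k - m) f else 0)"
proof -
  have "exp_lower b k (fock_var (m - 1) * f) =
    (\<Sum>i\<le>k. (if i = 0 then fock_var (m - 1) * exp_lower b k f else 0) + (if i = m then fock_const (b m) * exp_lower b (k - m) f else 0))"
    unfolding exp_lower_mult using assms by (intro sum.cong refl) (auto simp: exp_lower_var)
  then show ?thesis
    by (simp add: sum.distrib)
qed

lemma exp_lower_eq_0: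
  assumes "weight_below d f" "d \<le> int k"
  shows "exp_lower b k f = 0"
  using weight_below_exp_lower[OF assms(1)] assms(2) by (intro weight_below_nonpos[of "d - int k"]) simp_all

section \<open>Products of vertex operators\<close>

lemma weight_below_mono: "weight_below d f \<Longrightarrow> d \<le> d' \<Longrightarrow> weight_below d' f"
  by (force simp: weight_below_def)

lemma weight_below_exp_lower_same: "weight_below d f \<Longrightarrow> weight_below d (exp_lower b k f)"
  by (rule weight_below_mono[OF weight_below_exp_lower[of d]]) auto

text \<open>The shift \<open>s\<close> absorbs the prefactors \<open>z^-N\<close> and
  \<open>z^N\<close>. The guard is needed because \<open>nat\<close> would send negative degrees to
  the constant term.\<close>

definition raising :: "complex \<Rightarrow> int \<Rightarrow> (nat \<Rightarrow> complex) \<Rightarrow> int \<Rightarrow> fock" where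
  "raising \<kappa> s a e = (if e + s < 0 then 0 else fock_const \<kappa> * exp_raise a (nat (e + s)))"

lemma raising_eq_0: "e + s < 0 \<Longrightarrow> raising \<kappa> s a e = 0"
  by (simp add: raising_def)

lemma exp_lower_raising:
  "exp_lower b l (raising \<kappa> s a e) = fock_const (fps_nth (contraction a b) l) * raising \<kappa> s a (e - int l)"
proof (cases "e + s < 0")
  case False
  then have "nat (e - int l + s) = nat (e + s) - l" "l \<le> nat (e + s) \<longleftrightarrow> \<not> e - int l + s < 0"
    by auto
  then show ?thesis
    using False by (simp add: raising_def exp_lower_const_mult exp_lower_exp_raise mult.left_commute)
qed (simp add: raising_def)

lemma fock_pderiv_raising:
  assumes "m \<ge> 1"
  shows "fock_pderiv (m - 1) (raising \<kappa> s a e) = fock_const (a m) * raising \<kappa> s a (e - int m)"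
proof (cases "e + s < 0")
  case False
  then have "nat (e - int m + s) = nat (e + s) - m" "m \<le> nat (e + s) \<longleftrightarrow> \<not> e - int m + s < 0"
    by auto
  then show ?thesis
    using False assms by (simp add: raising_def fock_pderiv_const_mult fock_pderiv_exp_raise mult.left_commute)
qed (simp add: raising_def)

text \<open>
  Coefficient of \<open>z\<^sup>e\<close> in \<open>\<kappa> z\<^sup>-\<^sup>s exp (\<Sum>\<^sub>m a\<^sub>m \<alpha>\<^sub>-\<^sub>m z\<^sup>m) exp (\<Sum>\<^sub>m b\<^sub>m \<partial>\<^sub>m z\<^sup>-\<^sup>m)\<close>, where \<open>\<partial>\<^sub>m\<close> is
  the derivative in the variable \<open>\<alpha>\<^sub>-\<^sub>m\<close>.
\<close>

definition vop :: "complex \<Rightarrow> int \<Rightarrow> (nat \<Rightarrow> complex) \<Rightarrow> (nat \<Rightarrow> complex) \<Rightarrow> int \<Rightarrow> fock \<Rightarrow> fock" where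
  "vop \<kappa> s a b e f = Sum_any (\<lambda>l::nat. raising \<kappa> s a (e + int l) * exp_lower b l f)"

lemma vop_eq_sum:
  assumes "weight_below (int d) f"
  shows "vop \<kappa> s a b e f = (\<Sum>l<d. raising \<kappa> s a (e + int l) * exp_lower b l f)"
  unfolding vop_def by (rule Sum_any_lessThan) (use exp_lower_eq_0[OF assms] in simp)

lemma scale_vertex_eq_vop:
  "fock_scale \<kappa> (vertex fock_scale (creation a) (annihilation b) (e + s) f) = vop \<kappa> s a b e f"
proof -
  obtain d where d: "weight_below (int d) f"
    using weight_below_exists by blast
  have "vertex fock_scale (creation a) (annihilation b) (e + s) f =
    (\<Sum>l<d. if 0 \<le> e + s + int l then exp_raise a (nat (e + s + int l)) * exp_lower b l f else 0)"
    unfolding vertex_def exp_coeff_creation exp_lower_def[symmetric]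
    by (rule Sum_any_lessThan) (use exp_lower_eq_0[OF d] in simp)
  then show ?thesis
    by (auto simp: vop_eq_sum[OF d] fock_scale_eq sum_distrib_left raising_def algebra_simps intro!: sum.cong)
qed

lemma vop_add: "vop \<kappa> s a b e (f + g) = vop \<kappa> s a b e f + vop \<kappa> s a b e g"
proof -
  obtain d d' where "weight_below (int d) f" "weight_below (int d') g"
    using weight_below_exists by metis
  then have "weight_below (int (max d d')) f" "weight_below (int (max d d')) g"
    by (auto elim: weight_below_mono)
  then show ?thesis
    by (simp add: vop_eq_sum[where d = "max d d'"] weight_below_add exp_lower_add distrib_left sum.distrib)
qed

lemma vop_const_mult: "vop \<kappa> s a b e (fock_const c * f) = fock_const c * vop \<kappa> s a b e f"
proof -
  obtain d where "weight_below (int d) f"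
    using weight_below_exists by blast
  then show ?thesis
    by (simp add: vop_eq_sum[where d = d] weight_below_const_mult exp_lower_const_mult sum_distrib_left mult.left_commute)
qed

lemma vop_zero [simp]: "vop \<kappa> s a b e 0 = 0"
  by (simp add: vop_def)

lemma vop_sum: "vop \<kappa> s a b e (\<Sum>i\<in>I. f i) = (\<Sum>i\<in>I. vop \<kappa> s a b e (f i))"
  by (induction I rule: infinite_finite_induct) (simp_all add: vop_add)

text \<open>Only lowering modes \<open>l < d\<close> act on \<open>f\<close>, and then the raising
  degree \<open>e + s + l\<close> is still negative.\<close>

lemma vop_eq_0:
  assumes "weight_below (int d) f" "e + s + int d \<le> 0"
  shows "vop \<kappa> s a b e f = 0"
  unfolding vop_eq_sum[OF assms(1)] using assms(2) by (intro sum.neutral) (auto simp: raising_eq_0)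

text \<open>The derivative commutes with the lowering part and multiplies the raising part by
  \<open>a_m z^m\<close>. The next lemma is the mirror image, in which the lowering part shifts the
  variable.\<close>

lemma pderiv_vop:
  assumes "m \<ge> 1"
  shows "fock_pderiv (m - 1) (vop \<kappa> s a b e f) - vop \<kappa> s a b e (fock_pderiv (m - 1) f) =
    fock_const (a m) * vop \<kappa> s a b (e - int m) f"
proof -
  obtain d where d: "weight_below (int d) f"
    using weight_below_exists by blast
  have d': "weight_below (int d) (fock_pderiv (m - 1) f)"
    using weight_below_pderiv[OF d] by (rule weight_below_mono) simp
  have "fock_pderiv (m - 1) (vop \<kappa> s a b e f) = (\<Sum>l<d. fock_const (a m) * (raising \<kappa> s a (e - int m + int l) * exp_lower b l f)
     + raising \<kappa> s a (e + int l) * exp_lower b l (fock_pderiv (m - 1) f))"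
    unfolding vop_eq_sum[OF d] fock_pderiv_sum fock_pderiv_mult fock_pderiv_raising[OF assms] fock_pderiv_exp_lower
    by (simp add: algebra_simps)
  then show ?thesis
    by (simp add: vop_eq_sum[OF d] vop_eq_sum[OF d'] sum.distrib sum_distrib_left)
qed

lemma vop_var_mult:
  assumes "m \<ge> 1"
  shows "vop \<kappa> s a b e (fock_var (m - 1) * f) =
    fock_var (m - 1) * vop \<kappa> s a b e f + fock_const (b m) * vop \<kappa> s a b (e + int m) f"
proof -
  obtain d d' where "weight_below (int d) f" "weight_below (int d') (fock_var (m - 1) * f)"
    using weight_below_exists by metis
  moreover define D where "D = d + d'"
  ultimately have D: "weight_below (int D) f" "weight_below (int (D + m)) f" "weight_below (int (D + m)) (fock_var (m - 1) * f)"
    by (auto elim: weight_below_mono)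
  have "vop \<kappa> s a b e (fock_var (m - 1) * f) = fock_var (m - 1) * vop \<kappa> s a b e f +
    (\<Sum>l<D+m. if m \<le> l then fock_const (b m) * (raising \<kappa> s a (e + int l) * exp_lower b (l - m) f) else 0)"
    unfolding vop_eq_sum[OF D(3)] vop_eq_sum[OF D(2)] exp_lower_var_mult[OF assms] sum_distrib_left sum.distrib[symmetric]
    by (intro sum.cong refl) (auto simp: algebra_simps)
  also have "(\<Sum>l<D+m. if m \<le> l then fock_const (b m) * (raising \<kappa> s a (e + int l) * exp_lower b (l - m) f) else 0) =
    (\<Sum>l<D. fock_const (b m) * (raising \<kappa> s a (e + int (l + m)) * exp_lower b l f))"
  proof -
    have "(\<Sum>l<D+m. if m \<le> l then fock_const (b m) * (raising \<kappa> s a (e + int l) * exp_lower b (l - m) f) else 0) =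
      (\<Sum>l=0+m..<D+m. fock_const (b m) * (raising \<kappa> s a (e + int l) * exp_lower b (l - m) f))"
      by (rule sum.mono_neutral_cong_right) auto
    then show ?thesis
      unfolding sum.shift_bounds_nat_ivl by (simp add: atLeast0LessThan)
  qed
  also have "\<dots> = fock_const (b m) * vop \<kappa> s a b (e + int m) f"
    by (simp add: vop_eq_sum[OF D(1)] sum_distrib_left algebra_simps)
  finally show ?thesis .
qed

text \<open>Moving a vertex operator past a raising mode is what produces the contraction series.\<close>

lemma vop_raising_mult:
  assumes K: "e' + s' < int K"
  shows "vop \<kappa> s a b e (raising \<kappa>' s' a' e' * g) =
    (\<Sum>i<K. fock_const (fps_nth (contraction a' b) i) * (raising \<kappa>' s' a' (e' - int i) * vop \<kappa> s a b (e + int i) g))"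
proof -
  let ?C = "fps_nth (contraction a' b)"
  obtain d d' where d: "weight_below (int d) g" "weight_below (int d') (raising \<kappa>' s' a' e' * g)"
    using weight_below_exists by metis
  \<comment> \<open>\<open>L\<close> has to bound the weight of the whole product, and the triangle
    \<open>i + j < L\<close> has to contain the box \<open>i < K\<close>, \<open>j < d\<close>
    outside which all terms vanish.\<close>
  define L where "L = d + d' + K"
  have L: "weight_below (int L) (raising \<kappa>' s' a' e' * g)"
    using d(2) by (rule weight_below_mono) (simp add: L_def)
  define F where "F i j = fock_const (?C i) * (raising \<kappa>' s' a' (e' - int i) * (raising \<kappa> s a (e + int (i + j)) * exp_lower b j g))" for i j
  have "vop \<kappa> s a b e (raising \<kappa>' s' a' e' * g) = (\<Sum>l<L. \<Sum>i\<le>l. F i (l - i))"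
    unfolding vop_eq_sum[OF L] exp_lower_mult exp_lower_raising sum_distrib_left
    by (intro sum.cong refl) (auto simp: F_def mult_ac)
  also have "\<dots> = (\<Sum>(i, j)\<in>{(i, j). i + j < L}. F i j)"
    by (subst sum.triangle_reindex) simp
  also have "\<dots> = (\<Sum>(i, j)\<in>{..<K} \<times> {..<d}. F i j)"
  proof (rule sum.mono_neutral_right)
    have "F i j = 0" if "\<not> (i < K \<and> j < d)" for i j
    proof (cases "i < K")
      case True
      then have "exp_lower b j g = 0"
        using that exp_lower_eq_0[OF d(1)] by simp
      then show ?thesis
        by (simp add: F_def)
    next
      case False
      then show ?thesis
        using K by (simp add: F_def raising_eq_0)
    qed
    then show "\<forall>i\<in>{(i, j). i + j < L} - {..<K} \<times> {..<d}. (case i of (i, j) \<Rightarrow> F i j) = 0"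
      by auto
    have "{(i, j). i + j < L} \<subseteq> {..<L} \<times> {..<L}"
      by auto
    then show "finite {(i, j). i + j < L}"
      by (rule finite_subset) simp
  qed (auto simp: L_def)
  also have "\<dots> = (\<Sum>i<K. \<Sum>j<d. F i j)"
    by (simp add: sum.cartesian_product)
  also have "\<dots> = (\<Sum>i<K. fock_const (?C i) * (raising \<kappa>' s' a' (e' - int i) * vop \<kappa> s a b (e + int i) g))"
    unfolding vop_eq_sum[OF d(1)] sum_distrib_left by (simp add: F_def add.assoc)
  finally show ?thesis .
qed

text \<open>Coefficients of the normally ordered products of two and of three vertex operators.\<close>

definition nord2 where
  "nord2 \<kappa> s a b \<kappa>' s' a' b' f =
    (\<lambda>(x, y). Sum_any (\<lambda>m::nat. raising \<kappa>' s' a' (y + int m) * vop \<kappa> s a b x (exp_lower b' m f)))"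

definition nord3 where
  "nord3 \<kappa> s a b f =
    (\<lambda>(x, y, z). Sum_any (\<lambda>n::nat. raising \<kappa> s a (z + int n) * nord2 \<kappa> s a b \<kappa> s a b (exp_lower b n f) (x, y)))"

lemma nord2_eq_sum:
  assumes "weight_below (int d) f"
  shows "nord2 \<kappa> s a b \<kappa>' s' a' b' f (x, y) =
    (\<Sum>m<d. raising \<kappa>' s' a' (y + int m) * vop \<kappa> s a b x (exp_lower b' m f))"
  unfolding nord2_def prod.case by (rule Sum_any_lessThan) (use exp_lower_eq_0[OF assms] in simp)

lemma nord2_zero [simp]: "nord2 \<kappa> s a b \<kappa>' s' a' b' 0 n = 0"
  by (cases n) (simp add: nord2_def)

lemma nord3_eq_sum:
  assumes "weight_below (int d) f"
  shows "nord3 \<kappa> s a b f (x, y, z) =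
    (\<Sum>n<d. raising \<kappa> s a (z + int n) * nord2 \<kappa> s a b \<kappa> s a b (exp_lower b n f) (x, y))"
  unfolding nord3_def prod.case by (rule Sum_any_lessThan) (use exp_lower_eq_0[OF assms] in simp)

lemma nord2_eq_sum2:
  assumes "weight_below (int d) f"
  shows "nord2 \<kappa> s a b \<kappa>' s' a' b' f (x, y) =
    (\<Sum>m<d. \<Sum>l<d. raising \<kappa>' s' a' (y + int m) * (raising \<kappa> s a (x + int l) * exp_lower b l (exp_lower b' m f)))"
  unfolding nord2_eq_sum[OF assms]
  by (simp add: vop_eq_sum[where d = d] weight_below_exp_lower_same assms sum_distrib_left)

text \<open>Raising modes are polynomials and lowering modes commute with one another, so the order
  of the two operators leaves no trace.\<close>

lemma nord2_swap: "nord2 \<kappa> s a b \<kappa>' s' a' b' f (x, y) = nord2 \<kappa>' s' a' b' \<kappa> s a b f (y, x)"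
proof -
  obtain d where d: "weight_below (int d) f"
    using weight_below_exists by blast
  show ?thesis
    unfolding nord2_eq_sum2[OF d]
    by (subst sum.swap) (simp add: exp_lower_commute[of b _ b'] mult.left_commute)
qed

text \<open>The support is a quadrant, bounded below in each exponent separately; therefore
  expansions in \<open>w/z\<close> and in \<open>z/w\<close> are both finite in each degree.\<close>

lemma nord2_eq_0:
  assumes "weight_below (int d) f" "x + s + int d \<le> 0 \<or> y + s' + int d \<le> 0"
  shows "nord2 \<kappa> s a b \<kappa>' s' a' b' f (x, y) = 0"
  unfolding nord2_eq_sum2[OF assms(1)] using assms(2) by (intro sum.neutral ballI) (auto simp: raising_eq_0)

lemma nord3_swap:
  "nord3 \<kappa> s a b f (y, x, z) = nord3 \<kappa> s a b f (x, y, z)"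
  "nord3 \<kappa> s a b f (x, z, y) = nord3 \<kappa> s a b f (x, y, z)"
proof -
  show "nord3 \<kappa> s a b f (y, x, z) = nord3 \<kappa> s a b f (x, y, z)"
    by (simp add: nord3_def nord2_swap[of _ _ _ _ _ _ _ _ _ y x])
  obtain d where d: "weight_below (int d) f"
    using weight_below_exists by blast
  show "nord3 \<kappa> s a b f (x, z, y) = nord3 \<kappa> s a b f (x, y, z)"
    unfolding nord3_eq_sum[OF d] nord2_eq_sum[OF weight_below_exp_lower_same[OF d]] sum_distrib_left
    by (subst sum.swap) (simp add: exp_lower_commute[of b _ b] mult.left_commute)
qed

lemma nord3_eq_0:
  assumes "weight_below (int d) f" "x + s + int d \<le> 0 \<or> y + s + int d \<le> 0 \<or> z + s + int d \<le> 0"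
  shows "nord3 \<kappa> s a b f (x, y, z) = 0"
  unfolding nord3_eq_sum[OF assms(1)] using assms
  by (intro sum.neutral ballI) (auto simp: raising_eq_0 nord2_eq_0[OF weight_below_exp_lower_same[OF assms(1)]])

section \<open>Products of two and three operators as contractions of normally ordered
  products\<close>

definition lift_fps :: "complex fps \<Rightarrow> fock fps" where
  "lift_fps f = Abs_fps (\<lambda>n. fock_const (fps_nth f n))"

lemma lift_fps_nth [simp]: "fps_nth (lift_fps f) n = fock_const (fps_nth f n)"
  by (simp add: lift_fps_def)

lemma lift_fps_mult: "lift_fps (f * g) = lift_fps f * lift_fps g"
  by (rule fps_ext) (simp add: fps_mult_nth fock_const_sum fock_const_mult)

lemma lift_fps_add: "lift_fps (f + g) = lift_fps f + lift_fps g"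
  by (rule fps_ext) (simp add: fock_const_add)

lemma lift_fps_diff: "lift_fps (f - g) = lift_fps f - lift_fps g"
  by (rule fps_ext) (simp add: single_diff)

lemma lift_fps_simps [simp]:
  "lift_fps (fps_const c) = fps_const (fock_const c)" "lift_fps 1 = 1" "lift_fps fps_X = fps_X"
  by (rule fps_ext; simp add: fps_X_nth)+

lemma sum_swap4:
  "(\<Sum>m\<in>A. \<Sum>l\<in>B. \<Sum>i\<in>I. \<Sum>k\<in>J. g m l i k) = (\<Sum>i\<in>I. \<Sum>k\<in>J. \<Sum>m\<in>A. \<Sum>l\<in>B. g m l i k)"
proof -
  have "(\<Sum>p\<in>A \<times> B. \<Sum>r\<in>I \<times> J. g (fst p) (snd p) (fst r) (snd r)) =
    (\<Sum>r\<in>I \<times> J. \<Sum>p\<in>A \<times> B. g (fst p) (snd p) (fst r) (snd r))"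
    by (rule sum.swap)
  then show ?thesis
    by (simp add: sum.cartesian_product')
qed

text \<open>The translation that belongs to the monomial \<open>w/z\<close> in \<open>z\<^sup>x w\<^sup>y\<close>.\<close>

definition T2 :: "int \<times> int \<Rightarrow> int \<times> int" where "T2 = (\<lambda>(x, y). (x + 1, y - 1))"

lemma T2_funpow: "(T2 ^^ i) (x, y) = (x + int i, y - int i)"
  by (induction i) (auto simp: T2_def)

lemma T_funpow:
  "(T12 ^^ i) (x, y, z) = (x + int i, y - int i, z)"
  "(T23 ^^ i) (x, y, z) = (x, y + int i, z - int i)"
  "(T13 ^^ i) (x, y, z) = (x + int i, y, z - int i)"
  by (induction i) auto

lemma vop_vop:
  "vop \<kappa> s a b x (vop \<kappa>' s' a' b' y f) =
     lser T2 (lift_fps (contraction a' b)) (nord2 \<kappa> s a b \<kappa>' s' a' b' f) (x, y)"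
proof -
  obtain d where d: "weight_below (int d) f"
    using weight_below_exists by blast
  \<comment> \<open>The shifted degree of a raising mode on the right is at most
    \<open>y + s' + d - 1\<close>, which bounds the contraction index uniformly in
    \<open>m\<close>.\<close>
  define K where "K = nat (y + s' + int d + 1)"
  let ?C = "\<lambda>i. fock_const (fps_nth (contraction a' b) i)"
  have "vop \<kappa> s a b x (vop \<kappa>' s' a' b' y f) =
    (\<Sum>m<d. vop \<kappa> s a b x (raising \<kappa>' s' a' (y + int m) * exp_lower b' m f))"
    unfolding vop_eq_sum[OF d] vop_sum ..
  also have "\<dots> = (\<Sum>m<d. \<Sum>i<K. ?C i * (raising \<kappa>' s' a' (y + int m - int i) * vop \<kappa> s a b (x + int i) (exp_lower b' m f)))"
    by (intro sum.cong refl vop_raising_mult) (auto simp: K_def)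
  also have "\<dots> = (\<Sum>i<K. ?C i * nord2 \<kappa> s a b \<kappa>' s' a' b' f (x + int i, y - int i))"
    by (subst sum.swap) (simp add: nord2_eq_sum[OF d] sum_distrib_left algebra_simps)
  also have "\<dots> = lser T2 (lift_fps (contraction a' b)) (nord2 \<kappa> s a b \<kappa>' s' a' b' f) (x, y)"
    by (subst lser_eq_sum[where K = K]) (auto simp: T2_funpow K_def intro!: nord2_eq_0[OF d])
  finally show ?thesis .
qed

text \<open>The lowering part of the new operator meets two raising factors, and \<open>T12\<close>
  and \<open>T13\<close> record the two contractions.\<close>

lemma vop_nord2:
  "vop \<kappa> s a b x (nord2 \<kappa> s a b \<kappa> s a b f (y, z)) =
     lser T12 (lift_fps (contraction a b)) (lser T13 (lift_fps (contraction a b)) (nord3 \<kappa> s a b f)) (x, y, z)"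
proof -
  obtain d where d: "weight_below (int d) f"
    using weight_below_exists by blast
  define K where "K = nat (y + s + int d + 1) + nat (z + s + int d + 1)"
  let ?C = "\<lambda>i. fock_const (fps_nth (contraction a b) i)"
  let ?R = "raising \<kappa> s a" and ?V = "vop \<kappa> s a b" and ?T = "exp_lower b"
  have "?V x (nord2 \<kappa> s a b \<kappa> s a b f (y, z)) = (\<Sum>m<d. \<Sum>l<d. ?V x (?R (y + int l) * (?R (z + int m) * ?T l (?T m f))))"
    by (simp only: nord2_eq_sum2[OF d] vop_sum mult.left_commute)
  also have "\<dots> = (\<Sum>m<d. \<Sum>l<d. \<Sum>i<K. ?C i * (?R (y + int l - int i) * ?V (x + int i) (?R (z + int m) * ?T l (?T m f))))"
    by (intro sum.cong refl vop_raising_mult) (auto simp: K_def)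
  also have "\<dots> = (\<Sum>m<d. \<Sum>l<d. \<Sum>i<K. ?C i * (?R (y + int l - int i) *
      (\<Sum>k<K. ?C k * (?R (z + int m - int k) * ?V (x + int i + int k) (?T l (?T m f))))))"
    by (intro sum.cong refl arg_cong2[of _ _ _ _ "(*)"] vop_raising_mult) (auto simp: K_def)
  also have "\<dots> = (\<Sum>m<d. \<Sum>l<d. \<Sum>i<K. \<Sum>k<K. ?C i * (?C k * (?R (z - int k + int m) * (?R (y - int i + int l) * ?V (x + int i + int k) (?T l (?T m f))))))"
    by (simp only: sum_distrib_left add_diff_eq[symmetric] mult_ac) (simp add: algebra_simps)
  also have "\<dots> = (\<Sum>i<K. \<Sum>k<K. \<Sum>m<d. \<Sum>l<d. ?C i * (?C k * (?R (z - int k + int m) * (?R (y - int i + int l) * ?V (x + int i + int k) (?T l (?T m f))))))"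
    by (rule sum_swap4)
  also have "\<dots> = (\<Sum>i<K. ?C i * (\<Sum>k<K. ?C k * nord3 \<kappa> s a b f (x + int i + int k, y - int i, z - int k)))"
    by (simp only: nord3_eq_sum[OF d] nord2_eq_sum[OF weight_below_exp_lower_same[OF d]] sum_distrib_left)
  also have "\<dots> = (\<Sum>i<K. ?C i * lser T13 (lift_fps (contraction a b)) (nord3 \<kappa> s a b f) (x + int i, y - int i, z))"
    by (intro sum.cong refl arg_cong2[of _ _ _ _ "(*)"], subst lser_eq_sum[where K = K])
       (auto simp: T_funpow K_def intro!: nord3_eq_0[OF d])
  also have "\<dots> = lser T12 (lift_fps (contraction a b)) (lser T13 (lift_fps (contraction a b)) (nord3 \<kappa> s a b f)) (x, y, z)"
  proof (rule lser_eq_sum[where K = K, THEN trans, symmetric])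
    fix i
    assume "K \<le> i"
    then have "nord3 \<kappa> s a b f (x + int i + int k, y - int i, z - int k) = 0" for k
      by (intro nord3_eq_0[OF d]) (auto simp: K_def)
    then show "lser T13 (lift_fps (contraction a b)) (nord3 \<kappa> s a b f) ((T12 ^^ i) (x, y, z)) = 0"
      by (simp add: T_funpow lser_def)
  qed (simp add: T_funpow)
  finally show ?thesis .
qed

text \<open>The two right operators contract first, giving \<open>T23\<close>; the leftmost one then
  contracts with both.\<close>

lemma vop_vop_vop:
  "vop \<kappa> s a b x (vop \<kappa> s a b y (vop \<kappa> s a b z f)) =
     lser T23 (lift_fps (contraction a b)) (lser T12 (lift_fps (contraction a b))
       (lser T13 (lift_fps (contraction a b)) (nord3 \<kappa> s a b f))) (x, y, z)"
proof -
  obtain d where d: "weight_below (int d) f"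
    using weight_below_exists by blast
  define K where "K = nat (z + s + int d + 1)"
  let ?C = "lift_fps (contraction a b)"
  have "vop \<kappa> s a b x (vop \<kappa> s a b y (vop \<kappa> s a b z f)) =
    vop \<kappa> s a b x (\<Sum>j<K. fps_nth ?C j * nord2 \<kappa> s a b \<kappa> s a b f (y + int j, z - int j))"
    unfolding vop_vop[of \<kappa> s a b y]
    by (subst lser_eq_sum[where K = K]) (auto simp: T2_funpow K_def intro!: nord2_eq_0[OF d])
  also have "\<dots> = (\<Sum>j<K. fps_nth ?C j * lser T12 ?C (lser T13 ?C (nord3 \<kappa> s a b f)) (x, y + int j, z - int j))"
    by (simp add: vop_sum vop_const_mult vop_nord2)
  also have "\<dots> = lser T23 ?C (lser T12 ?C (lser T13 ?C (nord3 \<kappa> s a b f))) (x, y, z)"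
  proof (rule lser_eq_sum[where K = K, THEN trans, symmetric])
    show "(\<Sum>j<K. fps_nth ?C j * lser T12 ?C (lser T13 ?C (nord3 \<kappa> s a b f)) ((T23 ^^ j) (x, y, z))) =
      (\<Sum>j<K. fps_nth ?C j * lser T12 ?C (lser T13 ?C (nord3 \<kappa> s a b f)) (x, y + int j, z - int j))"
      by (simp add: T_funpow)
    fix j
    assume "K \<le> j"
    then have "nord2 \<kappa> s a b \<kappa> s a b f (y + int j, z - int j) = 0"
      by (intro nord2_eq_0[OF d]) (auto simp: K_def)
    then show "lser T12 ?C (lser T13 ?C (nord3 \<kappa> s a b f)) ((T23 ^^ j) (x, y, z)) = 0"
      by (simp add: T_funpow vop_nord2[symmetric])
  qed
  finally show ?thesis .
qed

section \<open>Rescaling a variable and specializing normally ordered products\<close>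

lemma vop_cong:
  assumes "\<And>m. m \<ge> 1 \<Longrightarrow> a m = a' m" "\<And>m. m \<ge> 1 \<Longrightarrow> b m = b' m"
  shows "vop \<kappa> s a b e f = vop \<kappa> s a' b' e f"
proof -
  have "vertex fock_scale (creation a) (annihilation b) (e + s) f = vertex fock_scale (creation a') (annihilation b') (e + s) f"
    by (rule vertex_cong) (simp_all add: creation_def annihilation_def assms)
  then show ?thesis
    by (simp flip: scale_vertex_eq_vop)
qed

text \<open>The rescaled exponents are those of the operator at \<open>c z\<close>. With a shift
  \<open>s\<close> a further factor \<open>c^s\<close> would appear.\<close>

lemma vop_rescale:
  assumes "c \<noteq> 0"
  shows "vop \<kappa> 0 (\<lambda>m. c ^ m * a m) (\<lambda>m. (1 / c) ^ m * b m) e f = fock_const (c powi e) * vop \<kappa> 0 a b e f"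
proof -
  obtain d where d: "weight_below (int d) f"
    using weight_below_exists by blast
  have "raising \<kappa> 0 (\<lambda>m. c ^ m * a m) (e + int l) * exp_lower (\<lambda>m. (1 / c) ^ m * b m) l f =
    fock_const (c powi e) * (raising \<kappa> 0 a (e + int l) * exp_lower b l f)" for l
  proof (cases "e + int l < 0")
    case False
    then obtain k where k: "e + int l = int k"
      by (metis not_less nonneg_int_cases)
    then have "c powi e = c powi (int k - int l)"
      by (simp flip: k)
    also have "\<dots> = c ^ nat (e + int l) * (1 / c) ^ l"
      using assms by (simp add: k power_int_diff power_divide)
    finally have "c powi e = c ^ nat (e + int l) * (1 / c) ^ l" .
    then show ?thesis
      unfolding raising_def exp_raise_scale exp_lower_scale using False by (simp add: fock_const_mult mult_ac)
  qed (simp add: raising_def)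
  then show ?thesis
    by (simp add: vop_eq_sum[OF d] sum_distrib_left)
qed

text \<open>Put \<open>z = c w\<close> in the product of the two raising parts: the opposite
  prefactors \<open>z^-s\<close> and \<open>w^s\<close> leave only the constant
  \<open>c^-s\<close>.\<close>

lemma raising_convolution:
  assumes "c \<noteq> 0"
  shows "Sum_any (\<lambda>j::int. fock_const (c powi j) * (raising \<kappa> s a j * raising \<kappa>' (- s) a' (n - j))) =
    raising (\<kappa> * \<kappa>' * c powi (- s)) 0 (\<lambda>m. c ^ m * a m + a' m) n"
proof (cases "n < 0")
  case True
  then have "fock_const (c powi j) * (raising \<kappa> s a j * raising \<kappa>' (- s) a' (n - j)) = 0" for j
    by (cases "j + s < 0") (simp_all add: raising_eq_0)
  then have "Sum_any (\<lambda>j::int. fock_const (c powi j) * (raising \<kappa> s a j * raising \<kappa>' (- s) a' (n - j))) = Sum_any (\<lambda>j::int. 0)"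
    by (rule Sum_any.cong)
  then show ?thesis
    using True by (simp add: raising_eq_0)
next
  case False
  let ?h = "\<lambda>j::int. fock_const (c powi j) * (raising \<kappa> s a j * raising \<kappa>' (- s) a' (n - j))"
  have "Sum_any ?h = sum ?h ((\<lambda>i. int i - s) ` {..nat n})"
  proof (rule Sum_any.expand_superset)
    show "{j. ?h j \<noteq> 0} \<subseteq> (\<lambda>i. int i - s) ` {..nat n}"
    proof
      fix j
      assume j: "j \<in> {j. ?h j \<noteq> 0}"
      then have "\<not> j + s < 0" "\<not> n - j - s < 0"
        using raising_eq_0[of j s \<kappa> a] raising_eq_0[of "n - j" "- s" \<kappa>' a'] by auto
      then show "j \<in> (\<lambda>i. int i - s) ` {..nat n}"
        by (intro image_eqI[of _ _ "nat (j + s)"]) auto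
    qed
  qed simp
  also have "\<dots> = (\<Sum>i\<le>nat n. ?h (int i - s))"
    by (subst sum.reindex) (simp_all add: inj_on_def)
  also have "\<dots> = (\<Sum>i\<le>nat n. fock_const (\<kappa> * \<kappa>' * c powi (- s)) * ((fock_const (c ^ i) * exp_raise a i) * exp_raise a' (nat n - i)))"
  proof (intro sum.cong refl)
    fix i
    assume "i \<in> {..nat n}"
    then have i: "i \<le> nat n"
      by simp
    have "raising \<kappa>' (- s) a' (n - (int i - s)) = fock_const \<kappa>' * exp_raise a' (nat n - i)"
      using i False by (simp add: raising_def nat_diff_distrib')
    moreover have "raising \<kappa> s a (int i - s) = fock_const \<kappa> * exp_raise a i"
      by (simp add: raising_def)
    moreover have "c powi (int i - s) = c ^ i * c powi (- s)"
      using assms by (simp add: power_int_diff power_int_minus divide_inverse)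
    ultimately show "?h (int i - s) = fock_const (\<kappa> * \<kappa>' * c powi (- s)) * ((fock_const (c ^ i) * exp_raise a i) * exp_raise a' (nat n - i))"
      by (simp only: fock_const_mult mult_ac)
  qed
  also have "\<dots> = raising (\<kappa> * \<kappa>' * c powi (- s)) 0 (\<lambda>m. c ^ m * a m + a' m) n"
    using False by (simp add: raising_def exp_raise_add exp_raise_scale sum_distrib_left)
  finally show ?thesis .
qed

lemma Sum_any_int_superset:
  fixes f :: "int \<Rightarrow> 'a::comm_monoid_add"
  assumes "\<And>i. i \<notin> {-int K<..<int K} \<Longrightarrow> f i = 0"
  shows "Sum_any f = (\<Sum>i\<in>{-int K<..<int K}. f i)"
  by (rule Sum_any.expand_superset) (use assms in blast)+

text \<open>Specialising \<open>z = c w\<close> in the normally ordered product merges two vertex operators into one.\<close>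

lemma nord2_diagonal:
  assumes "c \<noteq> 0"
  shows "Sum_any (\<lambda>j::int. fock_const (c powi j) * nord2 \<kappa> s a b \<kappa>' (- s) a' b' f (j, e - j)) =
    vop (\<kappa> * \<kappa>' * c powi (- s)) 0 (\<lambda>m. c ^ m * a m + a' m) (\<lambda>m. (1 / c) ^ m * b m + b' m) e f"
proof -
  obtain d where d: "weight_below (int d) f"
    using weight_below_exists by blast
  let ?R = "raising \<kappa> s a" and ?R' = "raising \<kappa>' (- s) a'"
  let ?R'' = "raising (\<kappa> * \<kappa>' * c powi (- s)) 0 (\<lambda>m. c ^ m * a m + a' m)"
  let ?T = "exp_lower b" and ?T' = "exp_lower b'"
  define K where "K = nat (\<bar>s\<bar> + \<bar>e\<bar> + int d + 1)"
  let ?J = "{-int K<..<int K}"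
  \<comment> \<open>For fixed lowering degrees, undoing the shift by \<open>l\<close> in the first
    raising factor costs \<open>c^-l\<close>; this later turns \<open>b m\<close> into
    \<open>(1 / c) ^ m * b m\<close>.\<close>
  have inner: "(\<Sum>j\<in>?J. fock_const (c powi j) * (?R (j + int l) * ?R' (e - j + int m))) = fock_const ((1 / c) ^ l) * ?R'' (e + int (l + m))"
    if "l < d" "m < d" for l m
  proof -
    have "(\<Sum>j\<in>?J. fock_const (c powi j) * (?R (j + int l) * ?R' (e - j + int m))) =
      Sum_any (\<lambda>j. fock_const (c powi j) * (?R (j + int l) * ?R' (e - j + int m)))"
    proof (rule Sum_any_int_superset[symmetric])
      fix j
      assume "j \<notin> ?J"
      then have "j + int l + s < 0 \<or> e - j + int m + - s < 0"
        using that by (auto simp: K_def)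
      then show "fock_const (c powi j) * (?R (j + int l) * ?R' (e - j + int m)) = 0"
        by (auto simp: raising_eq_0)
    qed
    also have "\<dots> = Sum_any (\<lambda>j. fock_const ((1 / c) ^ l) * (fock_const (c powi j) * (?R j * ?R' (e + int (l + m) - j))))"
    proof (rule Sum_any.reindex_cong[where l = "\<lambda>j. j - int l"])
      show "bij (\<lambda>j. j - int l)"
        by (rule bij_betw_byWitness[where f' = "\<lambda>j. j + int l"]) auto
      show "(\<lambda>j. fock_const (c powi j) * (?R (j + int l) * ?R' (e - j + int m))) \<circ> (\<lambda>j. j - int l) =
        (\<lambda>j. fock_const ((1 / c) ^ l) * (fock_const (c powi j) * (?R j * ?R' (e + int (l + m) - j))))"
      proof
        fix j
        have "c powi (j - int l) = (1 / c) ^ l * c powi j"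
          using assms by (simp add: power_int_diff power_divide)
        then show "((\<lambda>j. fock_const (c powi j) * (?R (j + int l) * ?R' (e - j + int m))) \<circ> (\<lambda>j. j - int l)) j =
          fock_const ((1 / c) ^ l) * (fock_const (c powi j) * (?R j * ?R' (e + int (l + m) - j)))"
          by (simp add: fock_const_mult mult.assoc algebra_simps)
      qed
    qed
    also have "\<dots> = fock_const ((1 / c) ^ l) * Sum_any (\<lambda>j. fock_const (c powi j) * (?R j * ?R' (e + int (l + m) - j)))"
    proof (rule Sum_any_right_distrib[symmetric])
      have "{j. fock_const (c powi j) * (?R j * ?R' (e + int (l + m) - j)) \<noteq> 0} \<subseteq> {- s..e + int (l + m) - s}"
      proof
        fix j
        assume "j \<in> {j. fock_const (c powi j) * (?R j * ?R' (e + int (l + m) - j)) \<noteq> 0}"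
        then have "\<not> j + s < 0" "\<not> e + int (l + m) - j + - s < 0"
          using raising_eq_0[of j s \<kappa> a] raising_eq_0[of "e + int (l + m) - j" "- s" \<kappa>' a'] by auto
        then show "j \<in> {- s..e + int (l + m) - s}"
          by simp
      qed
      then show "finite {j. fock_const (c powi j) * (?R j * ?R' (e + int (l + m) - j)) \<noteq> 0}"
        by (rule finite_subset) simp
    qed
    also have "\<dots> = fock_const ((1 / c) ^ l) * ?R'' (e + int (l + m))"
      by (simp only: raising_convolution[OF assms])
    finally show ?thesis .
  qed
  have "Sum_any (\<lambda>j::int. fock_const (c powi j) * nord2 \<kappa> s a b \<kappa>' (- s) a' b' f (j, e - j)) =
    (\<Sum>j\<in>?J. fock_const (c powi j) * nord2 \<kappa> s a b \<kappa>' (- s) a' b' f (j, e - j))"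
  proof (rule Sum_any_int_superset)
    fix j
    assume "j \<notin> ?J"
    then have "nord2 \<kappa> s a b \<kappa>' (- s) a' b' f (j, e - j) = 0"
      by (intro nord2_eq_0[OF d]) (auto simp: K_def)
    then show "fock_const (c powi j) * nord2 \<kappa> s a b \<kappa>' (- s) a' b' f (j, e - j) = 0"
      by simp
  qed
  also have "\<dots> = (\<Sum>j\<in>?J. \<Sum>(m, l)\<in>{..<d} \<times> {..<d}. (fock_const (c powi j) * (?R (j + int l) * ?R' (e - j + int m))) * ?T l (?T' m f))"
    by (simp add: nord2_eq_sum2[OF d] sum_distrib_left sum.cartesian_product' mult_ac)
  also have "\<dots> = (\<Sum>(m, l)\<in>{..<d} \<times> {..<d}. (\<Sum>j\<in>?J. fock_const (c powi j) * (?R (j + int l) * ?R' (e - j + int m))) * ?T l (?T' m f))"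
    by (subst sum.swap) (simp add: sum_distrib_right case_prod_beta)
  also have "\<dots> = (\<Sum>(m, l)\<in>{..<d} \<times> {..<d}. ?R'' (e + int (l + m)) * (fock_const ((1 / c) ^ l) * ?T l (?T' m f)))"
    by (intro sum.cong refl) (auto simp: inner mult_ac)
  also have "\<dots> = (\<Sum>(l, m)\<in>{..<d} \<times> {..<d}. ?R'' (e + int (l + m)) * (fock_const ((1 / c) ^ l) * ?T l (?T' m f)))"
    by (rule sum.reindex_bij_witness[where i = prod.swap and j = prod.swap]) auto
  \<comment> \<open>The two lowering modes together remove weight \<open>l + m\<close>, so only the
    triangle survives, and it can be sorted by total degree.\<close>
  also have "\<dots> = (\<Sum>(l, m)\<in>{(l, m). l + m < d}. ?R'' (e + int (l + m)) * (fock_const ((1 / c) ^ l) * ?T l (?T' m f)))"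
  proof (rule sum.mono_neutral_right)
    have "?T l (?T' m f) = 0" if "\<not> l + m < d" for l m
      using that by (intro exp_lower_eq_0[OF weight_below_exp_lower[OF d]]) simp
    then have "?R'' (e + int (l + m)) * (fock_const ((1 / c) ^ l) * ?T l (?T' m f)) = 0" if "\<not> l + m < d" for l m
      using that by simp
    then show "\<forall>p\<in>{..<d} \<times> {..<d} - {(l, m). l + m < d}. (case p of (l, m) \<Rightarrow> ?R'' (e + int (l + m)) * (fock_const ((1 / c) ^ l) * ?T l (?T' m f))) = 0"
      by (metis (mono_tags, lifting) DiffD2 case_prodI2 mem_Collect_eq split_conv surj_pair)
  qed auto
  also have "\<dots> = (\<Sum>n<d. \<Sum>l\<le>n. ?R'' (e + int n) * (fock_const ((1 / c) ^ l) * ?T l (?T' (n - l) f)))"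
    by (subst sum.triangle_reindex) simp
  also have "\<dots> = vop (\<kappa> * \<kappa>' * c powi (- s)) 0 (\<lambda>m. c ^ m * a m + a' m) (\<lambda>m. (1 / c) ^ m * b m + b' m) e f"
    unfolding vop_eq_sum[OF d] exp_lower_plus exp_lower_scale sum_distrib_left ..
  finally show ?thesis .
qed

text \<open>A one-sided sum over differences becomes a bilateral sum with odd coefficients. The
  value \<open>c 0\<close> is irrelevant, as the difference at 0 vanishes.\<close>

lemma sum_antisymmetric_int:
  fixes n :: "int \<Rightarrow> 'a::comm_ring_1"
  assumes "\<And>i. i > 0 \<Longrightarrow> c i = c' (int i)" "\<And>i. i > 0 \<Longrightarrow> c' (- int i) = - c i" "c' 0 = 0"
  shows "(\<Sum>i<K. c i * (n (int i) - n (- int i))) = (\<Sum>i\<in>{-int K<..<int K}. c' i * n i)"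
proof (induction K)
  case (Suc K)
  show ?case
  proof (cases "K = 0")
    case True
    have "{- 1<..<1} = {0::int}"
      by auto
    then show ?thesis
      using True assms(3) by (simp add: One_nat_def)
  next
    case False
    have "{-int (Suc K)<..<int (Suc K)} = insert (int K) (insert (- int K) {-int K<..<int K})"
      by auto
    then have "(\<Sum>i\<in>{-int (Suc K)<..<int (Suc K)}. c' i * n i) =
      c' (int K) * n (int K) + (c' (- int K) * n (- int K) + (\<Sum>i\<in>{-int K<..<int K}. c' i * n i))"
      using False by simp
    then show ?thesis
      unfolding sum.lessThan_Suc Suc.IH using False assms by (simp add: algebra_simps)
  qed
qed simp

lemma lowers_T2: "lowers snd T2"
  by (auto simp: lowers_def T2_def)

lemma tame_nord2: "tame snd (nord2 \<kappa> s a b \<kappa>' s' a' b' f)"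
proof -
  obtain d where d: "weight_below (int d) f"
    using weight_below_exists by blast
  have "- s' - int d \<le> y" if "nord2 \<kappa> s a b \<kappa>' s' a' b' f (x, y) \<noteq> 0" for x y
  proof (rule ccontr)
    assume "\<not> - s' - int d \<le> y"
    then have "nord2 \<kappa> s a b \<kappa>' s' a' b' f (x, y) = 0"
      by (intro nord2_eq_0[OF d]) simp
    with that show False ..
  qed
  then show ?thesis
    unfolding tame_def by (intro exI[of _ "- s' - int d"]) auto
qed

lemma tame_nord3: "tame slope (nord3 \<kappa> s a b f)"
proof -
  obtain d where d: "weight_below (int d) f"
    using weight_below_exists by blast
  \<comment> \<open>On the support every exponent exceeds \<open>- s - d\<close>, and the weights of
    \<open>slope\<close> add up to 6.\<close>
  have "6 * (- s - int d) \<le> slope (x, y, z)" if "nord3 \<kappa> s a b f (x, y, z) \<noteq> 0" for x y z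
  proof (rule ccontr)
    assume "\<not> 6 * (- s - int d) \<le> slope (x, y, z)"
    then have "nord3 \<kappa> s a b f (x, y, z) = 0"
      by (intro nord3_eq_0[OF d]) (simp add: slope_def, linarith)
    with that show False ..
  qed
  then show ?thesis
    unfolding tame_def by (intro exI[of _ "6 * (- s - int d)"]) auto
qed

section \<open>The quadratic and cubic relations of a single current\<close>

lemma ratio_mult_vop:
  "ratio_mult fock_scale f (vop \<kappa> s a b) v x y =
     lser T2 (lift_fps (f * contraction a b)) (nord2 \<kappa> s a b \<kappa> s a b v) (x, y)"
  unfolding ratio_mult_def fock_scale_eq vop_vop lift_fps_mult lser_mult[OF tame_nord2 lowers_T2]
  by (simp add: lser_def[of T2 "lift_fps f"] T2_funpow)

text \<open>The third factor \<open>1 - (t/q) x\<close> of \<open>G_series\<close> completes the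
  contraction to \<open>(1 - x)(1 - (q/t) x)(1 - (t/q) x)\<close>. This cubic changes sign when its
  coefficients are reversed; with the symmetry of \<open>nord2\<close>, reversal gives both the
  minus sign and the shift by 3.\<close>

lemma exchange_relation:
  assumes "q \<noteq> 0" "t \<noteq> 0"
    and H: "(1 - fps_const q * fps_X) * (1 - fps_const (1 / t) * fps_X) * (g * contraction a b) =
      (1 - fps_X) * (1 - fps_const (q / t) * fps_X)"
  shows "ratio_mult fock_scale (G_series q t * g) (vop \<kappa> s a b) v (x - 3) y =
    - ratio_mult fock_scale (G_series q t * g) (vop \<kappa> s a b) v (y - 3) x"
proof -
  define c where "c = 1 + q / t + t / q"
  let ?M = "nord2 \<kappa> s a b \<kappa> s a b v"
  have "G_series q t * g * contraction a b =
    (1 - fps_const (t / q) * fps_X) * ((1 - fps_const q * fps_X) * (1 - fps_const (1 / t) * fps_X) * (g * contraction a b))"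
    using assms(1,2) by (simp add: G_series_def mult_ac)
  also have "\<dots> = (1 - fps_const (t / q) * fps_X) * ((1 - fps_X) * (1 - fps_const (q / t) * fps_X))"
    by (simp only: H)
  also have "\<dots> = 1 - fps_const c * fps_X + fps_const c * fps_X ^ 2 - fps_X ^ 3"
  proof -
    have *: "fps_const (t / q) * fps_const (q / t) = 1"
      using assms(1,2) by simp
    have "(1 - fps_const (t / q) * fps_X) * ((1 - fps_X) * (1 - fps_const (q / t) * fps_X)) =
      1 - (1 + fps_const (q / t) + fps_const (t / q)) * fps_X +
      (fps_const (t / q) * fps_const (q / t) + fps_const (q / t) + fps_const (t / q)) * fps_X ^ 2
      - fps_const (t / q) * fps_const (q / t) * fps_X ^ 3"
      by (simp add: algebra_simps power2_eq_square power3_eq_cube del: fps_const_mult fps_const_add)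
    then show ?thesis
      unfolding * by (simp add: c_def flip: fps_const_add)
  qed
  finally have eq: "G_series q t * g * contraction a b = 1 - fps_const c * fps_X + fps_const c * fps_X ^ 2 - fps_X ^ 3" .
  have nth: "fps_nth (1 - fps_const c * fps_X + fps_const c * fps_X ^ 2 - fps_X ^ 3 :: complex fps) i =
    (if i = 0 then 1 else if i = 1 then - c else if i = 2 then c else if i = 3 then - 1 else 0)" for i
    by (auto simp: fps_X_power_iff fps_X_nth)
  have R: "ratio_mult fock_scale (G_series q t * g) (vop \<kappa> s a b) v x y =
    ?M (x, y) - fock_const c * ?M (x + 1, y - 1) + fock_const c * ?M (x + 2, y - 2) - ?M (x + 3, y - 3)" for x y
  proof -
    have "ratio_mult fock_scale (G_series q t * g) (vop \<kappa> s a b) v x y = (\<Sum>i<4. fock_const (if i = 0 then 1 else if i = 1 then - c else if i = 2 then c else if i = 3 then - 1 else 0) * ?M (x + int i, y - int i))"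
      unfolding ratio_mult_vop eq lser_def lift_fps_nth nth T2_funpow by (rule Sum_any_lessThan) simp
    then show ?thesis
      by (simp add: numeral_eq_Suc lessThan_Suc single_uminus)
  qed
  show ?thesis
    unfolding R by (simp add: nord2_swap[of _ _ _ _ _ _ _ _ _ y] nord2_swap[of _ _ _ _ _ _ _ _ _ "y - _"] algebra_simps)
qed

lemma tame_shift:
  assumes "tame l M" "\<And>n. l (S n) \<le> l n + D"
  shows "tame l (\<lambda>n. M (S n))"
proof -
  obtain E where E: "\<And>n. M n \<noteq> 0 \<Longrightarrow> E \<le> l n"
    using assms(1) by (auto simp: tame_def)
  have "E - D \<le> l n" if "M (S n) \<noteq> 0" for n
    using E[OF that] assms(2)[of n] by simp
  then show ?thesis
    by (auto simp: tame_def)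
qed

lemma serre_shift_tame_commute:
  assumes "tame slope M"
  shows "tame slope (serre_shift M)"
    and "T \<in> {T12, T23, T13} \<Longrightarrow> lser T f (serre_shift M) = serre_shift (lser T f M)"
proof -
  define S1 S2 S3 S4 :: "zzz \<Rightarrow> zzz" where
    "S1 = (\<lambda>(a, b, c). (a, b - 1, c + 1))" and "S2 = (\<lambda>(a, b, c). (a + 1, b - 1, c))" and
    "S3 = (\<lambda>(a, b, c). (a - 1, b + 1, c))" and "S4 = (\<lambda>(a, b, c). (a, b + 1, c - 1))"
  note S_defs = S1_def S2_def S3_def S4_def
  have eq: "serre_shift N = (\<lambda>n. N (S1 n) + (N (S2 n) + (- N (S3 n) + - N (S4 n))))" for N :: "zzz \<Rightarrow> 'a"
    by (auto simp: serre_shift_def S_defs)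
  have tame: "tame slope (\<lambda>n. M (S n))" if "S \<in> {S1, S2, S3, S4}" for S
    using that by (intro tame_shift[OF assms, of _ 1]) (auto simp: S_defs slope_def)
  show "tame slope (serre_shift M)"
    unfolding eq by (intro tame_add tame_uminus tame) simp_all
  show "lser T f (serre_shift M) = serre_shift (lser T f M)" if T: "T \<in> {T12, T23, T13}"
  proof
    fix n
    have low: "lowers slope T"
      using T by auto
    have shift: "lser T f (\<lambda>n. M (S n)) n = lser T f M (S n)" if "S \<in> {S1, S2, S3, S4}" for S
      using that T by (intro lser_shift) (auto simp: S_defs)
    have "tame slope (\<lambda>n. M (S1 n))" "tame slope (\<lambda>n. M (S2 n))" "tame slope (\<lambda>n. M (S3 n))" "tame slope (\<lambda>n. M (S4 n))"
      by (simp_all add: tame)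
    then have "lser T f (\<lambda>n. M (S1 n) + (M (S2 n) + (- M (S3 n) + - M (S4 n)))) n =
      lser T f (\<lambda>n. M (S1 n)) n + (lser T f (\<lambda>n. M (S2 n)) n +
        (- lser T f (\<lambda>n. M (S3 n)) n + - lser T f (\<lambda>n. M (S4 n)) n))"
      by (simp only: lser_add_right[where l = slope, OF _ _ low] lser_uminus_right tame_add tame_uminus)
    then show "lser T f (serre_shift M) n = serre_shift (lser T f M) n"
      unfolding eq by (simp add: shift)
  qed
qed

lemma lser_triple_Sum_any:
  fixes M :: "zzz \<Rightarrow> 'k::comm_ring_1"
  assumes "tame slope M"
  shows "Sum_any (\<lambda>(i::nat, j::nat, k::nat). fps_nth f i * (fps_nth f j * (fps_nth f k *
      M (a + int i + int k, b - int i + int j, c - int j - int k)))) =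
    lser T12 f (lser T23 f (lser T13 f M)) (a, b, c)"
proof -
  obtain D where D: "\<And>n. M n \<noteq> 0 \<Longrightarrow> D \<le> slope n"
    using assms by (auto simp: tame_def)
  \<comment> \<open>The indices \<open>(i, j, k)\<close> lower \<open>slope\<close> by
    \<open>i + j + 2 k\<close>, so any single index \<open>\<ge> K\<close> leaves the
    support.\<close>
  define K where "K = nat (slope (a, b, c) - D + 1)"
  have 0: "M (a + int i + int k, b - int i + int j, c - int j - int k) = 0" if "K \<le> i \<or> K \<le> j \<or> K \<le> k" for i j k
  proof -
    have "slope (a + int i + int k, b - int i + int j, c - int j - int k) < D"
      using that by (auto simp: K_def slope_def)
    then show ?thesis
      using D not_le by blast
  qed
  have 1: "lser T13 f M (a + int i, b - int i + int j, c - int j) =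
    (\<Sum>k<K. fps_nth f k * M (a + int i + int k, b - int i + int j, c - int j - int k))" for i j
    by (subst lser_eq_sum[where K = K]) (auto simp: T_funpow 0)
  then have 2: "lser T23 f (lser T13 f M) (a + int i, b - int i, c) =
    (\<Sum>j<K. fps_nth f j * (\<Sum>k<K. fps_nth f k * M (a + int i + int k, b - int i + int j, c - int j - int k)))" for i
    by (subst lser_eq_sum[where K = K]) (auto simp: T_funpow 0)
  then have 3: "lser T12 f (lser T23 f (lser T13 f M)) (a, b, c) =
    (\<Sum>i<K. fps_nth f i * (\<Sum>j<K. fps_nth f j * (\<Sum>k<K. fps_nth f k * M (a + int i + int k, b - int i + int j, c - int j - int k))))"
    by (subst lser_eq_sum[where K = K]) (auto simp: T_funpow 0)
  have "Sum_any (\<lambda>(i::nat, j::nat, k::nat). fps_nth f i * (fps_nth f j * (fps_nth f k *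
      M (a + int i + int k, b - int i + int j, c - int j - int k)))) =
    (\<Sum>(i, j, k)\<in>{..<K} \<times> {..<K} \<times> {..<K}. fps_nth f i * (fps_nth f j * (fps_nth f k *
      M (a + int i + int k, b - int i + int j, c - int j - int k))))"
  proof (rule Sum_any.expand_superset)
    have "M (a + int i + int k, b - int i + int j, c - int j - int k) \<noteq> 0 \<Longrightarrow> i < K \<and> j < K \<and> k < K" for i j k
      using 0[of i j k] by (metis not_le)
    then show "{p. (case p of (i, j, k) \<Rightarrow> fps_nth f i * (fps_nth f j * (fps_nth f k *
      M (a + int i + int k, b - int i + int j, c - int j - int k)))) \<noteq> 0} \<subseteq> {..<K} \<times> {..<K} \<times> {..<K}"
      by (auto; metis mult_zero_right)
  qed simp
  then show ?thesis
    by (simp add: 3 sum_distrib_left sum.cartesian_product')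
qed

text \<open>Elliptic factors and contractions live on the same three ratios. All these translations
  lower \<open>slope\<close>, so the factors may be reordered and merged, one series
  \<open>g * contraction a b\<close> per ratio.\<close>

lemma serre_term_vop:
  "serre_term fock_scale g (vop \<kappa> s a b) v x y z =
    serre_shift (lser T12 (lift_fps (g * contraction a b)) (lser T23 (lift_fps (g * contraction a b))
      (lser T13 (lift_fps (g * contraction a b)) (nord3 \<kappa> s a b v)))) (x, y, z)"
proof -
  note [simp] = tame_lser[where l = slope] tame_nord3
  let ?C = "lift_fps (contraction a b)" and ?G = "lift_fps g" and ?M = "nord3 \<kappa> s a b v"
  define W where "W = lser T23 ?C (lser T12 ?C (lser T13 ?C ?M))"
  have W: "tame slope W"
    by (simp add: W_def)
  have mult: "lser T f (lser T g N) = lser T (f * g) N" if "tame slope N" "lowers slope T" for T f g and N :: "zzz \<Rightarrow> fock"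
    using lser_mult[OF that] by simp
  have T13_T23: "lser T13 f (lser T23 g N) = lser T23 g (lser T13 f N)"
    and T13_T12: "lser T13 f (lser T12 g N) = lser T12 g (lser T13 f N)"
    and T23_T12: "lser T23 f (lser T12 g N) = lser T12 g (lser T23 f N)"
    if "tame slope N" for f g and N :: "zzz \<Rightarrow> fock"
    by (rule lser_commute[OF that]; simp add: T_commute)+
  have core: "serre_core (vop \<kappa> s a b) v x y z = serre_shift W (x, y, z)" for x y z
    by (simp add: serre_core_def serre_shift_def W_def vop_vop_vop)
  have "serre_term fock_scale g (vop \<kappa> s a b) v x y z =
    lser T12 ?G (lser T23 ?G (lser T13 ?G (serre_shift W))) (x, y, z)"
    unfolding lser_triple_Sum_any[OF serre_shift_tame_commute(1)[OF W], symmetric]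
    by (simp add: serre_term_def core fock_scale_eq fock_const_mult mult.assoc)
  also have "\<dots> = serre_shift (lser T12 ?G (lser T23 ?G (lser T13 ?G W))) (x, y, z)"
    by (simp add: serre_shift_tame_commute(2) W)
  also have "lser T13 ?G W = lser T23 ?C (lser T12 ?C (lser T13 (?G * ?C) ?M))"
    by (simp only: W_def T13_T23 T13_T12 mult tame_lser[where l = slope] tame_nord3 lowers_slope)
  also have "lser T23 ?G \<dots> = lser T12 ?C (lser T23 (?G * ?C) (lser T13 (?G * ?C) ?M))"
    by (simp only: T23_T12 mult tame_lser[where l = slope] tame_nord3 lowers_slope)
  also have "lser T12 ?G \<dots> = lser T12 (?G * ?C) (lser T23 (?G * ?C) (lser T13 (?G * ?C) ?M))"
    by (simp only: mult tame_lser[where l = slope] tame_nord3 lowers_slope)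
  finally show ?thesis
    by (simp only: lift_fps_mult)
qed

text \<open>Numerator and denominator of \<open>h\<close> differ only in the linear term: \<open>(1
  - x)(1 - \<delta> x) = (1 - \<sigma> x + \<delta> x^2) + (\<sigma> - 1 - \<delta>) x\<close>.
  Division gives the form \<open>1 + \<kappa> e\<close> that \<open>serre_symmetrized\<close>
  needs.\<close>

lemma serre_relation:
  assumes H: "(1 - fps_const q * fps_X) * (1 - fps_const (1 / t) * fps_X) * (g * contraction a b) =
      (1 - fps_X) * (1 - fps_const (q / t) * fps_X)"
  shows "serre_sum fock_scale g (vop \<kappa> s a b) v x y z = 0"
proof -
  define \<sigma> \<delta> where "\<sigma> = q + 1 / t" and "\<delta> = q / t"
  let ?D = "1 - fps_const \<sigma> * fps_X + fps_const \<delta> * fps_X ^ 2"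
  define e where "e = inverse ?D * fps_X"
  have D: "?D * inverse ?D = 1"
    by (rule inverse_mult_eq_1') simp
  then have e: "?D * e = fps_X"
    by (simp only: e_def mult.assoc[symmetric] mult_1)
  have D_eq: "(1 - fps_const q * fps_X) * (1 - fps_const (1 / t) * fps_X) = ?D"
    by (simp add: \<sigma>_def \<delta>_def algebra_simps power2_eq_square fps_const_add[symmetric] fps_const_mult[symmetric] divide_inverse
        del: fps_const_add fps_const_mult)
  have "?D * (g * contraction a b) = ?D * (1 + fps_const (\<sigma> - 1 - \<delta>) * e)"
  proof -
    have "?D * (1 + fps_const (\<sigma> - 1 - \<delta>) * e) = ?D + fps_const (\<sigma> - 1 - \<delta>) * (?D * e)"
      by (simp only: distrib_left mult.left_commute mult_1_right)
    also have "\<dots> = (1 - fps_X) * (1 - fps_const (q / t) * fps_X)"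
      unfolding e by (simp add: \<delta>_def algebra_simps power2_eq_square flip: fps_const_sub fps_const_add)
    finally show ?thesis
      using H D_eq by simp
  qed
  moreover have D0: "?D \<noteq> 0"
    using D by force
  ultimately have F: "g * contraction a b = 1 + fps_const (\<sigma> - 1 - \<delta>) * e"
    using mult_left_cancel[OF D0] by blast
  have lift_e: "(1 - fps_const (fock_const \<sigma>) * fps_X + fps_const (fock_const \<delta>) * fps_X ^ 2) * lift_fps e = fps_X"
    using arg_cong[OF e, of lift_fps] by (simp add: lift_fps_mult lift_fps_add lift_fps_diff power2_eq_square)
  have lift_F: "lift_fps (g * contraction a b) = 1 + fps_const (fock_const (\<sigma> - 1 - \<delta>)) * lift_fps e"
    unfolding F by (simp add: lift_fps_mult lift_fps_add)
  show ?thesis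
    unfolding serre_sum_def serre_term_vop lift_F
    by (rule serre_symmetrized[OF lift_e]) (simp_all add: tame_nord3 nord3_swap single_diff)
qed

section \<open>Commutators of two different currents and delta functions\<close>

lemma nord2_diagonal_shift:
  assumes "c \<noteq> 0"
  shows "Sum_any (\<lambda>i::int. fock_const (c powi i) * nord2 \<kappa> s a b \<kappa>' (- s) a' b' f (x + i, y - i)) =
    fock_const (c powi (- x)) * vop (\<kappa> * \<kappa>' * c powi (- s)) 0 (\<lambda>m. c ^ m * a m + a' m) (\<lambda>m. (1 / c) ^ m * b m + b' m) (x + y) f"
proof -
  obtain d where d: "weight_below (int d) f"
    using weight_below_exists by blast
  let ?n = "nord2 \<kappa> s a b \<kappa>' (- s) a' b' f"
  have "Sum_any (\<lambda>i::int. fock_const (c powi i) * ?n (x + i, y - i)) =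
    Sum_any (\<lambda>j. fock_const (c powi (- x)) * (fock_const (c powi j) * ?n (j, x + y - j)))"
  proof (rule Sum_any.reindex_cong[where l = "\<lambda>j. j - x"])
    show "bij (\<lambda>j. j - x)"
      by (rule bij_betw_byWitness[where f' = "\<lambda>j. j + x"]) auto
    show "(\<lambda>i. fock_const (c powi i) * ?n (x + i, y - i)) \<circ> (\<lambda>j. j - x) =
      (\<lambda>j. fock_const (c powi (- x)) * (fock_const (c powi j) * ?n (j, x + y - j)))"
    proof
      fix j
      have "c powi (j - x) = c powi (- x) * c powi j"
        using assms by (simp add: power_int_diff power_int_minus divide_inverse)
      then show "((\<lambda>i. fock_const (c powi i) * ?n (x + i, y - i)) \<circ> (\<lambda>j. j - x)) j =
        fock_const (c powi (- x)) * (fock_const (c powi j) * ?n (j, x + y - j))"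
        by (simp add: fock_const_mult mult.assoc algebra_simps)
    qed
  qed
  also have "\<dots> = fock_const (c powi (- x)) * Sum_any (\<lambda>j. fock_const (c powi j) * ?n (j, x + y - j))"
  proof (rule Sum_any_right_distrib[symmetric])
    have "{j. fock_const (c powi j) * ?n (j, x + y - j) \<noteq> 0} \<subseteq> {- s - int d..x + y - s + int d}"
    proof
      fix j
      assume "j \<in> {j. fock_const (c powi j) * ?n (j, x + y - j) \<noteq> 0}"
      then have "\<not> (j + s + int d \<le> 0 \<or> x + y - j + - s + int d \<le> 0)"
        using nord2_eq_0[OF d, of j s "x + y - j" "- s" \<kappa> a b \<kappa>' a' b'] by auto
      then show "j \<in> {- s - int d..x + y - s + int d}"
        by auto
    qed
    then show "finite {j. fock_const (c powi j) * ?n (j, x + y - j) \<noteq> 0}"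
      by (rule finite_subset) simp
  qed
  finally show ?thesis
    unfolding nord2_diagonal[OF assms] .
qed

text \<open>The contraction coefficients extend to an odd function of \<open>i\<close>. Hence the
  expansion in \<open>w/z\<close> minus the one in \<open>z/w\<close> is
  \<open>A (\<delta>(c w/z) - \<delta>(w/(c z)))\<close>, and the delta functions specialize the
  normally ordered product to \<open>z = c w\<close> and to \<open>z = w/c\<close>.\<close>

lemma vop_commutator:
  assumes "c \<noteq> 0"
    and C: "contraction a b' = contraction a' b"
    and nth: "\<And>i. i > 0 \<Longrightarrow> fps_nth (contraction a' b) i = A * (c ^ i - (1 / c) ^ i)"
  shows "vop \<kappa> s a b x (vop \<kappa>' (- s) a' b' y f) - vop \<kappa>' (- s) a' b' y (vop \<kappa> s a b x f) =
    fock_const A *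
     (fock_const (c powi (- x)) *
        vop (\<kappa> * \<kappa>' * c powi (- s)) 0 (\<lambda>m. c ^ m * a m + a' m) (\<lambda>m. (1 / c) ^ m * b m + b' m) (x + y) f
    - fock_const ((1 / c) powi (- x)) *
        vop (\<kappa> * \<kappa>' * (1 / c) powi (- s)) 0 (\<lambda>m. (1 / c) ^ m * a m + a' m) (\<lambda>m. c ^ m * b m + b' m) (x + y) f)"
proof -
  obtain d where d: "weight_below (int d) f"
    using weight_below_exists by blast
  define K where "K = nat (\<bar>x\<bar> + \<bar>y\<bar> + \<bar>s\<bar> + int d + 1)"
  let ?n = "nord2 \<kappa> s a b \<kappa>' (- s) a' b' f"
  define n where "n i = ?n (x + i, y - i)" for i
  let ?C = "\<lambda>i. fock_const (fps_nth (contraction a' b) i)"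
  have n0: "n i = 0" if "i \<notin> {-int K<..<int K}" for i
    using that unfolding n_def by (intro nord2_eq_0[OF d]) (auto simp: K_def)
  have "vop \<kappa> s a b x (vop \<kappa>' (- s) a' b' y f) = (\<Sum>i<K. ?C i * n (int i))"
  proof -
    have "?n ((T2 ^^ i) (x, y)) = 0" if "K \<le> i" for i
      using n0[of "int i"] that by (simp add: T2_funpow n_def)
    then show ?thesis
      unfolding vop_vop by (subst lser_eq_sum[where K = K]) (auto simp: T2_funpow n_def)
  qed
  \<comment> \<open>By symmetry of the normally ordered product, the opposite order reads the same
    sequence \<open>n\<close> backwards with the same contraction.\<close>
  moreover have "vop \<kappa>' (- s) a' b' y (vop \<kappa> s a b x f) = (\<Sum>i<K. ?C i * n (- int i))"
  proof -
    let ?n' = "nord2 \<kappa>' (- s) a' b' \<kappa> s a b f"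
    have eq: "?n' ((T2 ^^ i) (y, x)) = n (- int i)" for i
      by (simp add: T2_funpow n_def nord2_swap[of \<kappa>'])
    then have "?n' ((T2 ^^ i) (y, x)) = 0" if "K \<le> i" for i
      using n0[of "- int i"] that by simp
    then show ?thesis
      unfolding vop_vop C by (subst lser_eq_sum[where K = K]) (auto simp: eq)
  qed
  ultimately have "vop \<kappa> s a b x (vop \<kappa>' (- s) a' b' y f) - vop \<kappa>' (- s) a' b' y (vop \<kappa> s a b x f) =
    (\<Sum>i<K. ?C i * (n (int i) - n (- int i)))"
    by (simp add: right_diff_distrib sum_subtractf)
  \<comment> \<open>The constant term 1 of the contraction cancels at \<open>i = 0\<close>, so the
    formula for positive \<open>i\<close> is enough.\<close>
  also have "\<dots> = (\<Sum>i\<in>{-int K<..<int K}. fock_const (A * (c powi i - (1 / c) powi i)) * n i)"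
  proof (rule sum_antisymmetric_int)
    fix i :: nat
    assume "i > 0"
    then show "?C i = fock_const (A * (c powi int i - (1 / c) powi int i))"
      by (simp add: nth)
    have "A * (c powi (- int i) - (1 / c) powi (- int i)) = - (A * (c ^ i - (1 / c) ^ i))"
      using assms(1) by (simp add: power_int_minus power_divide field_simps)
    then show "fock_const (A * (c powi (- int i) - (1 / c) powi (- int i))) = - ?C i"
      using \<open>i > 0\<close> by (simp only: nth single_uminus)
  qed simp
  also have "\<dots> = fock_const A * ((\<Sum>i\<in>{-int K<..<int K}. fock_const (c powi i) * n i) - (\<Sum>i\<in>{-int K<..<int K}. fock_const ((1 / c) powi i) * n i))"
    by (simp add: sum_distrib_left right_diff_distrib left_diff_distrib single_diff fock_const_mult sum_subtractf mult.assoc)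
  also have "(\<Sum>i\<in>{-int K<..<int K}. fock_const (c powi i) * n i) = Sum_any (\<lambda>i. fock_const (c powi i) * n i)"
    by (rule Sum_any_int_superset[symmetric]) (simp add: n0)
  also have "(\<Sum>i\<in>{-int K<..<int K}. fock_const ((1 / c) powi i) * n i) = Sum_any (\<lambda>i. fock_const ((1 / c) powi i) * n i)"
    by (rule Sum_any_int_superset[symmetric]) (simp add: n0)
  finally show ?thesis
    unfolding n_def using nord2_diagonal_shift[of c] nord2_diagonal_shift[of "1 / c"] assms(1) by simp
qed

section \<open>Exponentials and logarithms of scalar power series\<close>

lemma fps_exp_compose_unique:
  fixes F :: "'a::field_char_0 fps"
  assumes "fps_nth L 0 = 0" "fps_nth F 0 = 1" "fps_deriv F = fps_deriv L * F"
  shows "F = fps_exp 1 oo L"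
proof (rule fps_ext)
  let ?G = "fps_exp 1 oo L"
  have G: "fps_deriv ?G = fps_deriv L * ?G"
    by (simp add: fps_compose_deriv[OF assms(1)] mult.commute)
  show "fps_nth F n = fps_nth ?G n" for n
  proof (induction n rule: less_induct)
    case (less n)
    show ?case
    proof (cases n)
      case (Suc k)
      have "of_nat (Suc k) * fps_nth F (Suc k) = fps_nth (fps_deriv L * F) k"
        by (simp add: Suc_eq_plus1 add.commute flip: assms(3))
      also have "\<dots> = fps_nth (fps_deriv L * ?G) k"
        unfolding fps_mult_nth by (intro sum.cong refl) (use Suc less.IH in simp)
      also have "\<dots> = of_nat (Suc k) * fps_nth ?G (Suc k)"
        by (simp add: Suc_eq_plus1 add.commute flip: G)
      finally show ?thesis
        using Suc by (simp del: of_nat_Suc)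
    qed (use assms in simp)
  qed
qed

lemma fps_exp_compose_add:
  fixes L M :: "'a::field_char_0 fps"
  assumes "fps_nth L 0 = 0" "fps_nth M 0 = 0"
  shows "fps_exp 1 oo (L + M) = (fps_exp 1 oo L) * (fps_exp 1 oo M)"
  by (rule fps_exp_compose_unique[symmetric])
     (use assms in \<open>simp_all add: fps_compose_deriv algebra_simps\<close>)

text \<open>The logarithm of \<open>1 - c x\<close>; division by zero supplies the constant term
  0.\<close>

definition log_linear :: "complex \<Rightarrow> complex fps" where
  "log_linear c = Abs_fps (\<lambda>m. - (c ^ m) / of_nat m)"

lemma log_linear_0 [simp]: "fps_nth (log_linear c) 0 = 0"
  by (simp add: log_linear_def)

lemma exp_log_linear: "fps_exp 1 oo log_linear c = 1 - fps_const c * fps_X"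
proof (rule fps_exp_compose_unique[symmetric])
  have "fps_nth (fps_deriv (log_linear c)) n = - (c ^ Suc n)" for n
    by (simp add: log_linear_def del: of_nat_Suc of_nat_add flip: Suc_eq_plus1)
  then have *: "fps_nth (fps_deriv (log_linear c)) = (\<lambda>n. - (c ^ Suc n))"
    by blast
  show "fps_deriv (1 - fps_const c * fps_X) = fps_deriv (log_linear c) * (1 - fps_const c * fps_X)"
  proof (rule fps_ext)
    fix n
    have "fps_nth (fps_deriv (log_linear c) * (1 - fps_const c * fps_X)) n =
      - (c ^ Suc n) - c * (if n = 0 then 0 else - (c ^ n))"
      by (cases n) (simp_all add: right_diff_distrib mult.left_commute[of _ "fps_const c"] * del: fps_deriv_nth)
    then show "fps_nth (fps_deriv (1 - fps_const c * fps_X)) n = fps_nth (fps_deriv (log_linear c) * (1 - fps_const c * fps_X)) n"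
      by (cases n) simp_all
  qed
qed (simp_all add: log_linear_def)

section \<open>The Fock representation\<close>

locale fock_parameters =
  fixes q t p r :: complex
  assumes q0: "q \<noteq> 0" and t0: "t \<noteq> 0" and p0: "p \<noteq> 0"
    and tq_root: "\<And>n::nat. n > 0 \<Longrightarrow> (q / t) ^ n \<noteq> 1"
    and r4: "r ^ 4 = t / q"
    and norm_p: "norm p < 1" and norm_pstar: "norm (p * q / t) < 1"
begin

definition alpha_coeff :: "nat \<Rightarrow> complex" where
  "alpha_coeff m = - (kappa q t (int m) / of_int (int m)) * (1 - (q / t) powi int m)
     * ((1 - p powi int m) / (1 - (p * q / t) powi int m))"

text \<open>
  The exponent coefficients of \<open>x\<^sup>+\<close>, \<open>x\<^sup>-\<close>, \<open>\<psi>\<^sup>+\<close>, \<open>\<psi>\<^sup>-\<close>, with \<open>\<alpha>\<^sub>m\<close> (\<open>m > 0\<close>) replaced by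
  \<open>alpha_coeff m\<close> times the derivative.
\<close>

definition xp_a :: "nat \<Rightarrow> complex" where "xp_a m = - (r ^ m / (1 - (t / q) ^ m))"
definition xp_b :: "nat \<Rightarrow> complex" where "xp_b m = r ^ (3 * m) / (1 - (t / q) ^ m) * alpha_coeff m"
definition xm_a :: "nat \<Rightarrow> complex" where
  "xm_a m = r ^ m / (1 - (t / q) ^ m) * ((1 - (p * q / t) powi (- int m)) / (1 - p powi (- int m)) * (r\<^sup>2) powi (- int m))"
definition xm_b :: "nat \<Rightarrow> complex" where
  "xm_b m = - (r ^ (3 * m) / (1 - (t / q) ^ m)) * ((1 - (p * q / t) powi int m) / (1 - p powi int m) * (r\<^sup>2) powi int m)
     * alpha_coeff m"
definition pp_a :: "nat \<Rightarrow> complex" where "pp_a m = - (p ^ m / (1 - p ^ m)) * (1 / r) ^ m"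
definition pp_b :: "nat \<Rightarrow> complex" where "pp_b m = 1 / (1 - p ^ m) * r ^ m * alpha_coeff m"
definition pm_a :: "nat \<Rightarrow> complex" where "pm_a m = - (1 / (1 - p ^ m)) * r ^ m"
definition pm_b :: "nat \<Rightarrow> complex" where "pm_b m = p ^ m / (1 - p ^ m) * (1 / r) ^ m * alpha_coeff m"

lemma r0: "r \<noteq> 0"
  using r4 q0 t0 by auto

lemma power_norm_neq_1: "norm z < 1 \<Longrightarrow> m \<ge> 1 \<Longrightarrow> z ^ m \<noteq> (1 :: complex)"
  by (metis norm_one norm_power power_less_one_iff norm_ge_zero less_irrefl zero_less_one order.strict_trans2)

text \<open>Everything is expressed through \<open>r^m\<close>, \<open>q^m\<close> and
  \<open>p^m\<close>; in particular \<open>t^m\<close> is eliminated, which leaves rational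
  identities in three independent quantities.\<close>

lemma power_facts:
  "(t / q) ^ m = (r ^ m) ^ 4" "(q / t) ^ m = 1 / (r ^ m) ^ 4" "t ^ m = (r ^ m) ^ 4 * q ^ m"
  "(p * q / t) ^ m = p ^ m / (r ^ m) ^ 4" "p / r ^ 4 = p * q / t"
proof -
  have 1: "(r ^ m) ^ 4 = t ^ m / q ^ m"
    using r4 by (metis power_divide power_mult mult.commute)
  show "(t / q) ^ m = (r ^ m) ^ 4" "(q / t) ^ m = 1 / (r ^ m) ^ 4" "t ^ m = (r ^ m) ^ 4 * q ^ m"
    "(p * q / t) ^ m = p ^ m / (r ^ m) ^ 4"
    unfolding 1 using q0 t0 by (simp_all add: power_divide power_mult_distrib)
  show "p / r ^ 4 = p * q / t"
    using r4 by simp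
qed

text \<open>These are the denominators that occur: \<open>(r ^ m) ^ 4 \<noteq> 1\<close> because
  \<open>q/t\<close> is not a root of unity, and the two conditions on \<open>p ^ m\<close> because
  \<open>p\<close> and \<open>p q / t\<close> have norm below 1.\<close>

lemma nonzero_facts:
  assumes "m \<ge> 1"
  shows "r ^ m \<noteq> 0" "q ^ m \<noteq> 0" "p ^ m \<noteq> 0" "(r ^ m) ^ 4 \<noteq> 1" "p ^ m \<noteq> 1" "p ^ m \<noteq> (r ^ m) ^ 4" "of_nat m \<noteq> (0 :: complex)"
proof -
  show "(r ^ m) ^ 4 \<noteq> 1"
    using tq_root[of m] assms power_facts(2)[of m] by fastforce
  show "p ^ m \<noteq> (r ^ m) ^ 4"
    using power_norm_neq_1[OF norm_pstar assms] power_facts(4)[of m] r0 by auto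
qed (use assms r0 q0 p0 power_norm_neq_1[OF norm_p] in auto)

lemma kappa_eq: "kappa q t (int m) = (1 - q ^ m) * (1 - 1 / ((r ^ m) ^ 4 * q ^ m)) * (1 - (r ^ m) ^ 4)"
  by (simp add: kappa_def power_int_minus power_facts divide_inverse[of 1])

lemma kappa_neg_eq: "kappa q t (- int m) = (1 - 1 / q ^ m) * (1 - (r ^ m) ^ 4 * q ^ m) * (1 - 1 / (r ^ m) ^ 4)"
  by (simp add: kappa_def power_int_minus power_facts divide_inverse[of 1])

lemma alpha_coeff_eq:
  "alpha_coeff m = - ((1 - q ^ m) * (1 - 1 / ((r ^ m) ^ 4 * q ^ m)) * (1 - (r ^ m) ^ 4) / of_nat m)
     * (1 - 1 / (r ^ m) ^ 4) * ((1 - p ^ m) / (1 - p ^ m / (r ^ m) ^ 4))"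
  by (simp add: alpha_coeff_def kappa_eq power_facts)

text \<open>The factor in \<open>fock_alpha'\<close> is even in the mode number:
  \<open>(1 - 1/x) / (1 - 1/y) = (y/x) (1 - x) / (1 - y)\<close>, and here
  \<open>y/x = (r ^ m) ^ 4\<close> turns \<open>1 / (r ^ m)^2\<close> into
  \<open>(r ^ m)^2\<close>.\<close>

lemma xm_factor_eq:
  assumes "m \<ge> 1"
  shows "(1 - (p * q / t) powi (- int m)) / (1 - p powi (- int m)) * (r\<^sup>2) powi (- int m) =
    (1 - p ^ m / (r ^ m) ^ 4) / (1 - p ^ m) * (r ^ m)\<^sup>2"
proof -
  have "(r\<^sup>2) powi (- int m) = 1 / (r ^ m)\<^sup>2"
    by (simp add: power_int_minus divide_inverse flip: power_mult) (simp add: mult.commute)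
  moreover have "(1 - 1 / (P / R ^ 4)) / (1 - 1 / P) * (1 / R\<^sup>2) = (1 - P / R ^ 4) / (1 - P) * R\<^sup>2"
    if "R \<noteq> 0" "P \<noteq> 0" "P \<noteq> 1" for P R :: complex
    using that by (simp add: divide_simps) algebra
  ultimately show ?thesis
    using nonzero_facts[OF assms] by (simp add: power_int_minus power_facts divide_inverse[of 1])
qed

lemma xp_a_eq: "xp_a m = - (r ^ m / (1 - (r ^ m) ^ 4))"
  by (simp add: xp_a_def power_facts)

lemma xp_b_eq: "xp_b m = (r ^ m) ^ 3 / (1 - (r ^ m) ^ 4) * alpha_coeff m"
  by (simp add: xp_b_def power_facts mult.commute flip: power_mult)

lemma xm_a_eq: "m \<ge> 1 \<Longrightarrow> xm_a m = r ^ m / (1 - (r ^ m) ^ 4) * ((1 - p ^ m / (r ^ m) ^ 4) / (1 - p ^ m) * (r ^ m)\<^sup>2)"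
  unfolding xm_a_def by (simp only: xm_factor_eq power_facts)

lemma xm_b_eq: "xm_b m = - ((r ^ m) ^ 3 / (1 - (r ^ m) ^ 4)) * ((1 - p ^ m / (r ^ m) ^ 4) / (1 - p ^ m) * (r ^ m)\<^sup>2) * alpha_coeff m"
proof -
  have "(r\<^sup>2) ^ m = (r ^ m)\<^sup>2" "r ^ (3 * m) = (r ^ m) ^ 3"
    by (simp_all flip: power_mult add: mult.commute)
  then show ?thesis
    by (simp add: xm_b_def power_facts)
qed

text \<open>Coefficient of \<open>x^m\<close> in the logarithm of
  \<open>(1 - q x)(1 - x/t) g(x) C(x) = (1 - x)(1 - (q/t) x)\<close>, with \<open>g\<close> at
  \<open>p q / t\<close> and \<open>C\<close> the self-contraction of the positive current:
  \<open>g\<close> removes the dependence on \<open>p\<close>.\<close>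

lemma contraction_xp_coeff:
  assumes "m \<ge> 1"
  shows "- (q ^ m) / of_nat m + - ((1 / t) ^ m) / of_nat m
    + (kappa q t (int m) / of_nat m * ((p * q / t) ^ m / (1 - (p * q / t) ^ m)) + xp_a m * xp_b m)
    = - (1 ^ m) / of_nat m + - ((q / t) ^ m) / of_nat m"
proof -
  have *: "- Q / n + - (1 / (R ^ 4 * Q)) / n + ((1 - Q) * (1 - 1 / (R ^ 4 * Q)) * (1 - R ^ 4) / n * (P / R ^ 4 / (1 - P / R ^ 4))
    + - (R / (1 - R ^ 4)) * (R ^ 3 / (1 - R ^ 4) * (- ((1 - Q) * (1 - 1 / (R ^ 4 * Q)) * (1 - R ^ 4) / n)
     * (1 - 1 / R ^ 4) * ((1 - P) / (1 - P / R ^ 4))))) = - 1 / n + - (1 / R ^ 4) / n"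
    if "R \<noteq> 0" "Q \<noteq> 0" "P \<noteq> 0" "R ^ 4 \<noteq> 1" "P \<noteq> 1" "P \<noteq> R ^ 4" "n \<noteq> 0" for R Q P n :: complex
    using that by (simp add: divide_simps) algebra
  show ?thesis
    unfolding xp_a_eq xp_b_eq alpha_coeff_eq kappa_eq power_divide[of 1 t] power_facts power_one
    using *[OF nonzero_facts[OF assms]] by simp
qed

text \<open>The same with \<open>q, t\<close> inverted; here \<open>g\<close> occurs inverted and
  has been moved to the other side.\<close>

lemma contraction_xm_coeff:
  assumes "m \<ge> 1"
  shows "- ((1 / q) ^ m) / of_nat m + - (t ^ m) / of_nat m + xm_a m * xm_b m
    = - (1 ^ m) / of_nat m + - ((t / q) ^ m) / of_nat m + kappa q t (int m) / of_nat m * (p ^ m / (1 - p ^ m))"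
proof -
  have *: "- (1 / Q) / n + - (R ^ 4 * Q) / n
    + R / (1 - R ^ 4) * ((1 - P / R ^ 4) / (1 - P) * R\<^sup>2) * (- (R ^ 3 / (1 - R ^ 4)) * ((1 - P / R ^ 4) / (1 - P) * R\<^sup>2)
      * (- ((1 - Q) * (1 - 1 / (R ^ 4 * Q)) * (1 - R ^ 4) / n) * (1 - 1 / R ^ 4) * ((1 - P) / (1 - P / R ^ 4))))
    = - 1 / n + - (R ^ 4) / n + (1 - Q) * (1 - 1 / (R ^ 4 * Q)) * (1 - R ^ 4) / n * (P / (1 - P))"
    if "R \<noteq> 0" "Q \<noteq> 0" "P \<noteq> 0" "R ^ 4 \<noteq> 1" "P \<noteq> 1" "P \<noteq> R ^ 4" "n \<noteq> 0" for R Q P n :: complex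
    using that by (simp add: divide_simps) algebra
  show ?thesis
    unfolding xm_a_eq[OF assms] xm_b_eq alpha_coeff_eq kappa_eq power_divide[of 1 q] power_facts power_one
    using *[OF nonzero_facts[OF assms]] by simp
qed

text \<open>Expanded, these are the logarithmic coefficients of
  \<open>(1 - q c x)(1 - c x / t) / ((1 - c x)(1 - x / c))\<close> with \<open>c = r^2\<close>; no
  \<open>p\<close> is left.\<close>

lemma contraction_mixed_coeff:
  assumes "m \<ge> 1"
  shows "xm_a m * xp_b m = (r ^ m)\<^sup>2 * (1 - q ^ m) * (1 - 1 / ((r ^ m) ^ 4 * q ^ m)) / of_nat m"
    and "xp_a m * xm_b m = (r ^ m)\<^sup>2 * (1 - q ^ m) * (1 - 1 / ((r ^ m) ^ 4 * q ^ m)) / of_nat m"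
proof -
  have *: "R / (1 - R ^ 4) * ((1 - P / R ^ 4) / (1 - P) * R\<^sup>2) * (R ^ 3 / (1 - R ^ 4) *
      (- ((1 - Q) * (1 - 1 / (R ^ 4 * Q)) * (1 - R ^ 4) / n) * (1 - 1 / R ^ 4) * ((1 - P) / (1 - P / R ^ 4))))
    = R\<^sup>2 * (1 - Q) * (1 - 1 / (R ^ 4 * Q)) / n"
    if "R \<noteq> 0" "Q \<noteq> 0" "P \<noteq> 0" "R ^ 4 \<noteq> 1" "P \<noteq> 1" "P \<noteq> R ^ 4" "n \<noteq> 0" for R Q P n :: complex
    using that by (simp add: divide_simps) algebra
  show "xm_a m * xp_b m = (r ^ m)\<^sup>2 * (1 - q ^ m) * (1 - 1 / ((r ^ m) ^ 4 * q ^ m)) / of_nat m"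
    unfolding xm_a_eq[OF assms] xp_b_eq alpha_coeff_eq using *[OF nonzero_facts[OF assms]] by simp
  also have "xm_a m * xp_b m = xp_a m * xm_b m"
    unfolding xm_a_eq[OF assms] xp_b_eq xp_a_eq xm_b_eq by (simp add: mult_ac)
  finally show "xp_a m * xm_b m = (r ^ m)\<^sup>2 * (1 - q ^ m) * (1 - 1 / ((r ^ m) ^ 4 * q ^ m)) / of_nat m" .
qed

text \<open>At \<open>z = \<gamma> w\<close> the exponents of the two currents add up to those of
  \<open>\<psi>^+(w)\<close>, and at \<open>z = w / \<gamma>\<close> to those of
  \<open>\<psi>^-(w / \<gamma>)\<close>; hence the extra powers in the last two equations.\<close>

lemma merge_coeff:
  assumes "m \<ge> 1"
  shows "(r\<^sup>2) ^ m * xp_a m + xm_a m = pp_a m"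
    and "(1 / r\<^sup>2) ^ m * xp_b m + xm_b m = pp_b m"
    and "(1 / r\<^sup>2) ^ m * xp_a m + xm_a m = (1 / r\<^sup>2) ^ m * pm_a m"
    and "(r\<^sup>2) ^ m * xp_b m + xm_b m = (r\<^sup>2) ^ m * pm_b m"
proof -
  have r2: "(r\<^sup>2) ^ m = (r ^ m)\<^sup>2" "(1 / r\<^sup>2) ^ m = 1 / (r ^ m)\<^sup>2" "(1 / r) ^ m = 1 / r ^ m"
    by (simp_all add: power_divide mult.commute flip: power_mult)
  note nz = nonzero_facts[OF assms]
  have 1: "R\<^sup>2 * - (R / (1 - R ^ 4)) + R / (1 - R ^ 4) * ((1 - P / R ^ 4) / (1 - P) * R\<^sup>2) = - (P / (1 - P)) * (1 / R)"
    if "R \<noteq> 0" "R ^ 4 \<noteq> 1" "P \<noteq> 1" for R P :: complex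
    using that by (simp add: divide_simps) algebra
  show "(r\<^sup>2) ^ m * xp_a m + xm_a m = pp_a m"
    unfolding xm_a_eq[OF assms] xp_a_eq pp_a_def r2 using nz by (intro 1)
  have 2: "1 / R\<^sup>2 * (R ^ 3 / (1 - R ^ 4) * A) + - (R ^ 3 / (1 - R ^ 4)) * ((1 - P / R ^ 4) / (1 - P) * R\<^sup>2) * A = 1 / (1 - P) * R * A"
    if "R \<noteq> 0" "R ^ 4 \<noteq> 1" "P \<noteq> 1" for R P A :: complex
    using that by (simp add: divide_simps) algebra
  show "(1 / r\<^sup>2) ^ m * xp_b m + xm_b m = pp_b m"
    unfolding xm_b_eq xp_b_eq pp_b_def r2 using nz by (intro 2)
  have 3: "1 / R\<^sup>2 * - (R / (1 - R ^ 4)) + R / (1 - R ^ 4) * ((1 - P / R ^ 4) / (1 - P) * R\<^sup>2) = 1 / R\<^sup>2 * (- (1 / (1 - P)) * R)"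
    if "R \<noteq> 0" "R ^ 4 \<noteq> 1" "P \<noteq> 1" for R P :: complex
    using that by (simp add: divide_simps) algebra
  show "(1 / r\<^sup>2) ^ m * xp_a m + xm_a m = (1 / r\<^sup>2) ^ m * pm_a m"
    unfolding xm_a_eq[OF assms] xp_a_eq pm_a_def r2 using nz by (intro 3)
  have 4: "R\<^sup>2 * (R ^ 3 / (1 - R ^ 4) * A) + - (R ^ 3 / (1 - R ^ 4)) * ((1 - P / R ^ 4) / (1 - P) * R\<^sup>2) * A = R\<^sup>2 * (P / (1 - P) * (1 / R) * A)"
    if "R \<noteq> 0" "R ^ 4 \<noteq> 1" "P \<noteq> 1" for R P A :: complex
    using that by (simp add: divide_simps) algebra
  show "(r\<^sup>2) ^ m * xp_b m + xm_b m = (r\<^sup>2) ^ m * pm_b m"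
    unfolding xm_b_eq xp_b_eq pm_b_def r2 using nz by (intro 4)
qed

text \<open>Commuting a positive mode past a current produces \<open>alpha_coeff m\<close> times a
  raising coefficient, a negative mode produces minus a lowering coefficient. These scalars are
  matched with the structure constants for both signs of the mode.\<close>

lemma alpha_relation_coeff:
  assumes "m \<ge> 1"
  shows "alpha_coeff m * xp_a m =
      - (kappa q t (int m) / of_int (int m)) * ((1 - p powi int m) / (1 - (p / r ^ 4) powi int m)) * r powi (- 3 * int m)"
    and "- xp_b m = - (kappa q t (- int m) / of_int (- int m))
      * ((1 - p powi (- int m)) / (1 - (p / r ^ 4) powi (- int m))) * r powi (- 3 * (- int m))"
    and "alpha_coeff m * xm_a m = kappa q t (int m) / of_int (int m) * r powi (- int m)"
    and "- xm_b m = kappa q t (- int m) / of_int (- int m) * r powi (- (- int m))"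
    and "- alpha_coeff m = - (kappa q t (- int m) / of_int (- int m)) * ((r\<^sup>2) powi (- int m) - (r\<^sup>2) powi (- (- int m)))
      * (r\<^sup>2) powi (- (- int m)) * ((1 - p powi (- int m)) / (1 - (p / r ^ 4) powi (- int m)))"
    and "alpha_coeff m = - (kappa q t (int m) / of_int (int m)) * ((r\<^sup>2) powi int m - (r\<^sup>2) powi (- int m))
      * (r\<^sup>2) powi (- int m) * ((1 - p powi int m) / (1 - (p / r ^ 4) powi int m))"
proof -
  have "r powi (3 * int m) = (r powi int m) ^ 3"
    by (simp add: power_int_mult mult.commute flip: power_int_power)
  then have r3: "r powi (- 3 * int m) = 1 / (r ^ m) ^ 3" "r powi (- 3 * (- int m)) = (r ^ m) ^ 3" "r powi (- int m) = 1 / r ^ m"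
      "r powi (- (- int m)) = r ^ m"
    by (simp_all add: power_int_minus divide_inverse)
  have r2: "(r\<^sup>2) powi int m = (r ^ m)\<^sup>2" "(r\<^sup>2) powi (- int m) = 1 / (r ^ m)\<^sup>2" "(r\<^sup>2) powi (- (- int m)) = (r ^ m)\<^sup>2"
    by (simp_all add: power_int_minus divide_inverse mult.commute flip: power_mult)
  have pp: "p powi (- int m) = 1 / p ^ m" "(p * q / t) powi (- int m) = (r ^ m) ^ 4 / p ^ m" "p powi int m = p ^ m" 
     "(p * q / t) powi int m = p ^ m / (r ^ m) ^ 4" "complex_of_int (int m) = of_nat m" "complex_of_int (- int m) = - of_nat m"
    by (simp_all add: power_int_minus divide_inverse power_facts del: times_divide_eq_right)
       (simp_all add: power_facts(4)[unfolded divide_inverse])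
  note nz = nonzero_facts[OF assms]
  note unf = r2 r3 pp power_facts(5) kappa_eq kappa_neg_eq xm_a_eq[OF assms] xm_b_eq xp_a_eq xp_b_eq alpha_coeff_eq
  show "alpha_coeff m * xp_a m =
      - (kappa q t (int m) / of_int (int m)) * ((1 - p powi int m) / (1 - (p / r ^ 4) powi int m)) * r powi (- 3 * int m)"
    unfolding unf using nz by (simp add: divide_simps) algebra
  show "- xp_b m = - (kappa q t (- int m) / of_int (- int m))
      * ((1 - p powi (- int m)) / (1 - (p / r ^ 4) powi (- int m))) * r powi (- 3 * (- int m))"
    unfolding unf using nz by (simp add: divide_simps) algebra
  show "alpha_coeff m * xm_a m = kappa q t (int m) / of_int (int m) * r powi (- int m)"
    unfolding unf using nz by (simp add: divide_simps) algebra
  show "- xm_b m = kappa q t (- int m) / of_int (- int m) * r powi (- (- int m))"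
    unfolding unf using nz by (simp add: divide_simps) algebra
  show "- alpha_coeff m = - (kappa q t (- int m) / of_int (- int m)) * ((r\<^sup>2) powi (- int m) - (r\<^sup>2) powi (- (- int m)))
      * (r\<^sup>2) powi (- (- int m)) * ((1 - p powi (- int m)) / (1 - (p / r ^ 4) powi (- int m)))"
    unfolding unf using nz by (simp add: divide_simps) algebra
  show "alpha_coeff m = - (kappa q t (int m) / of_int (int m)) * ((r\<^sup>2) powi int m - (r\<^sup>2) powi (- int m))
      * (r\<^sup>2) powi (- int m) * ((1 - p powi int m) / (1 - (p / r ^ 4) powi int m))"
    unfolding unf using nz by (simp add: divide_simps)
qed

end

section \<open>The contraction series of the Fock currents in closed form\<close>

lemma contraction_cong:
  assumes "\<And>m. m \<ge> 1 \<Longrightarrow> a m * b m = a' m * b' m"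
  shows "contraction a b = contraction a' b'"
proof -
  have "(\<lambda>m. if m = 0 then 0 else a m * b m) = (\<lambda>m. if m = 0 then 0 else a' m * b' m)"
    using assms by auto
  then show ?thesis
    by (simp add: contraction_def)
qed

lemma exp_log_linear_one: "fps_exp 1 oo log_linear 1 = 1 - fps_X"
  by (simp add: exp_log_linear)

context fock_parameters
begin

lemma contraction_xp:
  "(1 - fps_const q * fps_X) * (1 - fps_const (1 / t) * fps_X) * (g_series q t (p / r ^ 4) * contraction xp_a xp_b) =
    (1 - fps_X) * (1 - fps_const (q / t) * fps_X)"
proof -
  define Lg where "Lg = Abs_fps (\<lambda>m. if m = 0 then 0
    else kappa q t (int m) / of_nat m * ((p * q / t) ^ m / (1 - (p * q / t) ^ m)))"
  define LC where "LC = Abs_fps (\<lambda>m. if m = 0 then 0 else xp_a m * xp_b m)"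
  have 0: "fps_nth Lg 0 = 0" "fps_nth LC 0 = 0"
    by (simp_all add: Lg_def LC_def)
  have "(log_linear q + log_linear (1 / t)) + (Lg + LC) = log_linear 1 + log_linear (q / t)"
  proof (rule fps_ext)
    fix m
    show "fps_nth (log_linear q + log_linear (1 / t) + (Lg + LC)) m = fps_nth (log_linear 1 + log_linear (q / t)) m"
      using contraction_xp_coeff[of m] by (cases "m = 0") (simp_all add: 0 log_linear_def Lg_def LC_def)
  qed
  then have "fps_exp 1 oo ((log_linear q + log_linear (1 / t)) + (Lg + LC)) = fps_exp 1 oo (log_linear 1 + log_linear (q / t))"
    by simp
  then show ?thesis
    by (simp add: fps_exp_compose_add 0 exp_log_linear exp_log_linear_one g_series_def contraction_def power_facts(5)
        del: fps_const_divide flip: Lg_def LC_def)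
qed

lemma contraction_xm:
  "(1 - fps_const (1 / q) * fps_X) * (1 - fps_const (1 / (1 / t)) * fps_X) * (inverse (g_series q t p) * contraction xm_a xm_b) =
    (1 - fps_X) * (1 - fps_const (1 / q / (1 / t)) * fps_X)"
proof -
  define Lg where "Lg = Abs_fps (\<lambda>m. if m = 0 then 0
    else kappa q t (int m) / of_nat m * (p ^ m / (1 - p ^ m)))"
  define LC where "LC = Abs_fps (\<lambda>m. if m = 0 then 0 else xm_a m * xm_b m)"
  have 0: "fps_nth Lg 0 = 0" "fps_nth LC 0 = 0"
    by (simp_all add: Lg_def LC_def)
  have "(log_linear (1 / q) + log_linear t) + LC = (log_linear 1 + log_linear (t / q)) + Lg"
  proof (rule fps_ext)
    fix m
    show "fps_nth (log_linear (1 / q) + log_linear t + LC) m = fps_nth ((log_linear 1 + log_linear (t / q)) + Lg) m"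
      using contraction_xm_coeff[of m] by (cases "m = 0") (simp_all add: 0 log_linear_def Lg_def LC_def)
  qed
  then have "fps_exp 1 oo ((log_linear (1 / q) + log_linear t) + LC) = fps_exp 1 oo ((log_linear 1 + log_linear (t / q)) + Lg)"
    by simp
  then have *: "(1 - fps_const (1 / q) * fps_X) * (1 - fps_const t * fps_X) * contraction xm_a xm_b =
      (1 - fps_X) * (1 - fps_const (t / q) * fps_X) * g_series q t p"
    by (simp add: fps_exp_compose_add 0 exp_log_linear exp_log_linear_one g_series_def contraction_def
        del: fps_const_divide flip: Lg_def LC_def)
  have "g_series q t p * inverse (g_series q t p) = 1"
    by (rule inverse_mult_eq_1') (simp add: g_series_def)
  then have "(1 - fps_const (1 / q) * fps_X) * (1 - fps_const t * fps_X) * contraction xm_a xm_b * inverse (g_series q t p) =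
      (1 - fps_X) * (1 - fps_const (t / q) * fps_X)"
    unfolding * by (simp only: mult.assoc mult_1_right)
  then show ?thesis
    by (simp add: mult_ac)
qed

lemma contraction_mixed: "contraction xp_a xm_b = contraction xm_a xp_b"
  by (rule contraction_cong) (simp add: contraction_mixed_coeff)

text \<open>Partial fractions: the closed form equals
  \<open>1 + A (1/(1 - c x) - 1/(1 - x/c))\<close> with \<open>c = r^2\<close>. The residue
  \<open>A\<close> is the normalization constant of the commutator of the two currents.\<close>

lemma contraction_mixed_nth:
  assumes "i > 0"
  shows "fps_nth (contraction xm_a xp_b) i = (1 - q) * (1 - 1 / t) / (1 - q / t) * ((r\<^sup>2) ^ i - (1 / r\<^sup>2) ^ i)"
proof -
  define c where "c = r\<^sup>2"
  define A where "A = (1 - q) * (1 - 1 / t) / (1 - q / t)"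
  have c: "c \<noteq> 0" "c ^ 2 = t / q"
    using r0 r4 by (simp_all add: c_def flip: power_mult)
  define LC where "LC = Abs_fps (\<lambda>m. if m = 0 then 0 else xm_a m * xp_b m)"
  have 0: "fps_nth LC 0 = 0"
    by (simp add: LC_def)
  have "(log_linear c + log_linear (1 / c)) + LC = log_linear (q * c) + log_linear (c / t)"
  proof (rule fps_ext)
    fix m
    show "fps_nth ((log_linear c + log_linear (1 / c)) + LC) m = fps_nth (log_linear (q * c) + log_linear (c / t)) m"
    proof (cases "m = 0")
      case False
      have "- (R\<^sup>2) / n + - (1 / R\<^sup>2) / n + R\<^sup>2 * (1 - Q) * (1 - 1 / (R ^ 4 * Q)) / n =
        - (Q * R\<^sup>2) / n + - (R\<^sup>2 / (R ^ 4 * Q)) / n"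
        if "R \<noteq> 0" "Q \<noteq> 0" "n \<noteq> 0" for R Q n :: complex
        using that by (simp add: divide_simps) algebra
      note * = this[of "r ^ m" "q ^ m" "of_nat m"]
      have cm: "c ^ m = (r ^ m)\<^sup>2"
        by (simp add: c_def mult.commute flip: power_mult)
      show ?thesis
        using False * nonzero_facts[of m]
        by (simp add: log_linear_def LC_def contraction_mixed_coeff power_mult_distrib power_divide cm power_facts(3))
    qed (simp add: LC_def)
  qed
  then have "fps_exp 1 oo ((log_linear c + log_linear (1 / c)) + LC) = fps_exp 1 oo (log_linear (q * c) + log_linear (c / t))"
    by simp
  then have C: "(1 - fps_const c * fps_X) * (1 - fps_const (1 / c) * fps_X) * contraction xm_a xp_b =
      (1 - fps_const (q * c) * fps_X) * (1 - fps_const (c / t) * fps_X)"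
    by (simp add: fps_exp_compose_add 0 exp_log_linear contraction_def del: fps_const_divide flip: LC_def)
  define geo :: "complex \<Rightarrow> complex fps" where "geo d = Abs_fps (\<lambda>n. d ^ n)" for d
  have geo: "(1 - fps_const d * fps_X) * geo d = 1" for d
  proof (rule fps_ext)
    show "fps_nth ((1 - fps_const d * fps_X) * geo d) n = fps_nth 1 n" for n
      by (cases n) (simp_all add: geo_def left_diff_distrib mult.assoc)
  qed
  let ?D = "(1 - fps_const c * fps_X) * (1 - fps_const (1 / c) * fps_X)"
  have "?D * (1 + fps_const A * (geo c - geo (1 / c))) =
    ?D + fps_const A * ((1 - fps_const (1 / c) * fps_X) * ((1 - fps_const c * fps_X) * geo c)
      - (1 - fps_const c * fps_X) * ((1 - fps_const (1 / c) * fps_X) * geo (1 / c)))"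
    by (simp only: algebra_simps mult_1_left mult_1_right)
  also have "\<dots> = ?D + fps_const A * (fps_const (c - 1 / c) * fps_X)"
    unfolding geo by (simp add: algebra_simps flip: fps_const_sub)
  also have "\<dots> = (1 - fps_const (q * c) * fps_X) * (1 - fps_const (c / t) * fps_X)"
  proof -
    \<comment> \<open>Comparison of linear coefficients, which determines \<open>A\<close>; it uses
      \<open>q = t / c^2\<close> and \<open>q/t \<noteq> 1\<close>.\<close>
    have 1: "A * (c - 1 / c) = c + 1 / c - q * c - c / t"
    proof -
      have qt: "q / t \<noteq> 1" "q = t / c\<^sup>2"
        using tq_root[of 1] c q0 t0 by auto
      have "(1 - t / c\<^sup>2) * (1 - 1 / t) / (1 - t / c\<^sup>2 / t) * (c - 1 / c) = c + 1 / c - t / c\<^sup>2 * c - c / t"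
        if "t / c\<^sup>2 / t \<noteq> 1"
        using that c(1) t0 by (simp add: divide_simps power2_eq_square) algebra
      then show ?thesis
        using qt unfolding A_def by metis
    qed
    \<comment> \<open>The quadratic coefficients of numerator and denominator agree, so the fraction
      tends to 1 at infinity and no further term is needed.\<close>
    have 2: "q * c * (c / t) = 1"
    proof -
      have "q * c * (c / t) = q * c ^ 2 / t"
        by (simp add: power2_eq_square)
      then show ?thesis
        using q0 t0 by (simp add: c(2))
    qed
    have "(1 - fps_const c * fps_X) * (1 - fps_const c' * fps_X) + fps_const A * (fps_const (c - c') * fps_X) =
      1 + fps_const (A * (c - c') - c - c') * fps_X + fps_const (c * c') * fps_X ^ 2" for c' :: complex
      by (simp add: algebra_simps power2_eq_square fps_const_add[symmetric] fps_const_sub[symmetric] fps_const_mult[symmetric]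
          del: fps_const_add fps_const_sub fps_const_mult)
    then have "?D + fps_const A * (fps_const (c - 1 / c) * fps_X) =
      1 + fps_const (A * (c - 1 / c) - c - 1 / c) * fps_X + fps_const (c * (1 / c)) * fps_X ^ 2" .
    also have "\<dots> = 1 - fps_const (q * c + c / t) * fps_X + fps_const (q * c * (c / t)) * fps_X ^ 2"
    proof -
      have "A * (c - 1 / c) - c - 1 / c = - (q * c + c / t)" "c * (1 / c) = 1"
        using 1 c(1) by simp_all
      then show ?thesis
        by (simp only: 2 diff_conv_add_uminus fps_const_neg[symmetric] mult_minus_left)
    qed
    also have "\<dots> = (1 - fps_const (q * c) * fps_X) * (1 - fps_const (c / t) * fps_X)"
    proof -
      have "1 - fps_const (d + d') * fps_X + fps_const (d * d') * fps_X ^ 2 = (1 - fps_const d * fps_X) * (1 - fps_const d' * fps_X)"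
        for d d' :: complex
        by (simp add: algebra_simps power2_eq_square fps_const_add[symmetric] fps_const_mult[symmetric]
            del: fps_const_add fps_const_mult)
      then show ?thesis .
    qed
    finally show ?thesis .
  qed
  finally have "?D * contraction xm_a xp_b = ?D * (1 + fps_const A * (geo c - geo (1 / c)))"
    using C by simp
  moreover have "?D \<noteq> 0"
  proof -
    have "fps_nth ?D 0 \<noteq> 0"
      by simp
    then show ?thesis
      by fastforce
  qed
  ultimately have "contraction xm_a xp_b = 1 + fps_const A * (geo c - geo (1 / c))"
    using mult_left_cancel by blast
  then show ?thesis
    using assms by (simp add: geo_def c_def A_def)
qed

section \<open>Generators and currents of the Fock space as vertex operators\<close>

lemma fock_alpha_pos: "m \<ge> 1 \<Longrightarrow> fock_alpha q t p (int m) f = fock_const (alpha_coeff m) * fock_pderiv (m - 1) f"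
  by (simp add: fock_alpha_def alpha_coeff_def fock_scale_eq)

lemma fock_alpha_neg: "m \<ge> 1 \<Longrightarrow> fock_alpha q t p (- int m) f = fock_var (m - 1) * f"
  by (simp add: fock_alpha_def)

lemma fock_xp_eq: "fock_xp q t p r u N n f = vop (u * r powi (3 * N)) N xp_a xp_b (- n) f"
  unfolding fock_xp_def scale_vertex_eq_vop[symmetric]
  by (rule arg_cong[of _ _ "fock_scale _"], rule vertex_cong)
     (simp_all only: fock_alpha_pos fock_alpha_neg fock_scale_eq creation_def annihilation_def xp_a_def xp_b_def
       mult.assoc fock_const_mult)

lemma fock_xm_eq: "fock_xm q t p r u N n f = vop (1 / u * r powi (- 3 * N)) (- N) xm_a xm_b (- n) f"
proof -
  have minus: "- n - N = - n + - N"
    by simp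
  have "fock_xm q t p r u N n f = fock_scale (1 / u * r powi (- 3 * N)) (vertex fock_scale (creation xm_a) (annihilation xm_b) (- n + - N) f)"
    unfolding fock_xm_def minus
    by (rule arg_cong[of _ _ "fock_scale _"], rule vertex_cong)
       (simp_all only: fock_alpha'_def fock_alpha_pos fock_alpha_neg fock_scale_eq creation_def annihilation_def xm_a_def xm_b_def
       mult.assoc fock_const_mult)
  then show ?thesis
    by (simp only: scale_vertex_eq_vop)
qed

lemma psi_plus_eq: "psi_plus fock_scale p r (fock_scale \<kappa>) (fock_alpha q t p) e f = vop \<kappa> 0 pp_a pp_b e f"
proof -
  have "psi_plus fock_scale p r (fock_scale \<kappa>) (fock_alpha q t p) e f =
    fock_scale \<kappa> (vertex fock_scale (creation pp_a) (annihilation pp_b) (e + 0) f)"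
    unfolding psi_plus_def add_0_right
    by (rule arg_cong[of _ _ "fock_scale _"], rule vertex_cong)
       (simp_all only: fock_alpha_pos fock_alpha_neg fock_scale_eq creation_def annihilation_def pp_a_def pp_b_def
       mult.assoc fock_const_mult)
  then show ?thesis
    by (simp only: scale_vertex_eq_vop)
qed

lemma psi_minus_eq: "psi_minus fock_scale p r (fock_scale \<kappa>) (fock_alpha q t p) e f = vop \<kappa> 0 pm_a pm_b e f"
proof -
  have "psi_minus fock_scale p r (fock_scale \<kappa>) (fock_alpha q t p) e f =
    fock_scale \<kappa> (vertex fock_scale (creation pm_a) (annihilation pm_b) (e + 0) f)"
    unfolding psi_minus_def add_0_right
    by (rule arg_cong[of _ _ "fock_scale _"], rule vertex_cong)
       (simp_all only: fock_alpha_pos fock_alpha_neg fock_scale_eq creation_def annihilation_def pm_a_def pm_b_def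
       mult.assoc fock_const_mult)
  then show ?thesis
    by (simp only: scale_vertex_eq_vop)
qed

lemma psi_plus_fock: "psi_plus fock_scale p r (fock_scale (r powi (- 2 * N))) (fock_alpha q t p) e f = fock_psi_plus q t p r N e f"
proof -
  have "- (p ^ m / (1 - p ^ m)) * (1 / r) ^ m = - (p ^ m * r powi (- int m) / (1 - p ^ m))"
    "1 / (1 - p ^ m) * r ^ m = r ^ m / (1 - p ^ m)" for m
    by (simp_all add: power_int_minus power_divide divide_inverse mult_ac power_inverse)
  then show ?thesis
    by (simp only: psi_plus_def fock_psi_plus_def)
qed

lemma psi_minus_fock: "psi_minus fock_scale p r (fock_scale (r powi (2 * N))) (fock_alpha q t p) e f = fock_psi_minus q t p r N e f"
proof -
  have "p ^ m / (1 - p ^ m) * (1 / r) ^ m = p ^ m * r powi (- int m) / (1 - p ^ m)"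
    "- (1 / (1 - p ^ m)) * r ^ m = - (r ^ m / (1 - p ^ m))" for m
    by (simp_all add: power_int_minus power_divide divide_inverse mult_ac power_inverse)
  then show ?thesis
    by (simp only: psi_minus_def fock_psi_minus_def)
qed

lemma fock_alpha_add: "fock_alpha q t p m (f + g) = fock_alpha q t p m f + fock_alpha q t p m g"
  by (simp add: fock_alpha_def fock_scale_eq fock_pderiv_add distrib_left)

lemma int_cases_nonzero:
  fixes m :: int
  assumes "m \<noteq> 0"
  obtains k where "k \<ge> 1" "m = int k" | k where "k \<ge> 1" "m = - int k"
  using assms by (cases m rule: int_cases2) auto

lemma fock_alpha_commutator:
  assumes "m \<noteq> 0" "n \<noteq> 0"
  shows "fock_alpha q t p m (fock_alpha q t p n v) - fock_alpha q t p n (fock_alpha q t p m v) =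
    fock_scale (if m + n = 0
      then - (kappa q t m / of_int m) * ((r\<^sup>2) powi m - (r\<^sup>2) powi (- m)) * (r\<^sup>2) powi (- m)
           * ((1 - p powi m) / (1 - (p / r ^ 4) powi m))
      else 0) v"
proof (cases rule: int_cases_nonzero[OF assms(1)])
  case m: (1 j)
  show ?thesis
  proof (cases rule: int_cases_nonzero[OF assms(2)])
    case (1 k)
    then show ?thesis
      using m by (simp add: fock_alpha_pos fock_scale_eq fock_pderiv_const_mult fock_pderiv_commute[of "j - 1"] mult.left_commute)
  next
    case (2 k)
    show ?thesis
    proof (cases "j = k")
      case True
      have "fock_alpha q t p m (fock_alpha q t p n v) - fock_alpha q t p n (fock_alpha q t p m v) = fock_const (alpha_coeff j) * v"
        using m 2 True by (simp add: fock_alpha_pos fock_alpha_neg fock_pderiv_mult fock_pderiv_var algebra_simps)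
      also have "\<dots> = fock_scale (alpha_coeff j) v"
        by (simp add: fock_scale_eq)
      finally show ?thesis
        unfolding alpha_relation_coeff(6)[OF m(1)] using m 2 True by simp
    next
      case False
      then show ?thesis
        using m 2 by (simp add: fock_alpha_pos fock_alpha_neg fock_scale_eq fock_pderiv_mult fock_pderiv_var algebra_simps)
    qed
  qed
next
  case m: (2 j)
  show ?thesis
  proof (cases rule: int_cases_nonzero[OF assms(2)])
    case (1 k)
    show ?thesis
    proof (cases "j = k")
      case True
      have "fock_alpha q t p m (fock_alpha q t p n v) - fock_alpha q t p n (fock_alpha q t p m v) = fock_const (- alpha_coeff j) * v"
        using m 1 True by (simp add: fock_alpha_pos fock_alpha_neg fock_pderiv_mult fock_pderiv_var single_uminus algebra_simps)
      also have "\<dots> = fock_scale (- alpha_coeff j) v"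
        by (simp add: fock_scale_eq)
      finally show ?thesis
        unfolding alpha_relation_coeff(5)[OF m(1)] using m 1 True by simp
    next
      case False
      then show ?thesis
        using m 1 by (simp add: fock_alpha_pos fock_alpha_neg fock_scale_eq fock_pderiv_mult fock_pderiv_var algebra_simps)
    qed
  next
    case (2 k)
    then show ?thesis
      using m by (simp add: fock_alpha_neg fock_scale_eq mult.left_commute)
  qed
qed

lemma fock_alpha_vop:
  assumes "m \<ge> 1"
  shows "fock_alpha q t p (int m) (vop \<kappa> s a b e v) - vop \<kappa> s a b e (fock_alpha q t p (int m) v) =
      fock_const (alpha_coeff m * a m) * vop \<kappa> s a b (e - int m) v"
    and "fock_alpha q t p (- int m) (vop \<kappa> s a b e v) - vop \<kappa> s a b e (fock_alpha q t p (- int m) v) =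
      fock_const (- b m) * vop \<kappa> s a b (e + int m) v"
proof -
  show "fock_alpha q t p (int m) (vop \<kappa> s a b e v) - vop \<kappa> s a b e (fock_alpha q t p (int m) v) =
      fock_const (alpha_coeff m * a m) * vop \<kappa> s a b (e - int m) v"
    unfolding fock_alpha_pos[OF assms] vop_const_mult right_diff_distrib[symmetric] pderiv_vop[OF assms]
    by (simp add: fock_const_mult mult.assoc)
  show "fock_alpha q t p (- int m) (vop \<kappa> s a b e v) - vop \<kappa> s a b e (fock_alpha q t p (- int m) v) =
      fock_const (- b m) * vop \<kappa> s a b (e + int m) v"
    unfolding fock_alpha_neg[OF assms] vop_var_mult[OF assms] by (simp add: single_uminus)
qed

lemma fock_alpha_smooth:
  "\<exists>d. \<forall>ms. (\<forall>m\<in>set ms. m > 0) \<and> sum_list ms \<ge> d \<longrightarrow> foldr (fock_alpha q t p) ms v = 0"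
proof -
  obtain d where d: "weight_below (int d) v"
    using weight_below_exists by blast
  have "weight_below (int d - sum_list ms) (foldr (fock_alpha q t p) ms v)" if "\<forall>m\<in>set ms. m > 0" for ms
    using that
  proof (induction ms)
    case (Cons m ms)
    define k where "k = nat m"
    have k: "k \<ge> 1" "m = int k"
      using Cons.prems by (auto simp: k_def)
    have "weight_below (int d - sum_list ms - int (Suc (k - 1))) (fock_pderiv (k - 1) (foldr (fock_alpha q t p) ms v))"
      using Cons by (intro weight_below_pderiv) simp
    also have "int d - sum_list ms - int (Suc (k - 1)) = int d - sum_list (m # ms)"
      using k by simp
    finally show ?case
      using k by (simp add: fock_alpha_pos weight_below_const_mult)
  qed (use d in simp)
  then show ?thesis
    by (intro exI[of _ "int d"] allI impI, elim conjE) (rule weight_below_nonpos, assumption, simp)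
qed

lemma vop_smooth: "\<exists>d. \<forall>n\<ge>d. vop \<kappa> s a b (- n) v = 0"
proof -
  obtain d where d: "weight_below (int d) v"
    using weight_below_exists by blast
  then show ?thesis
    by (intro exI[of _ "s + int d"]) (auto intro: vop_eq_0[OF d])
qed

text \<open>The prefactors of the two currents cancel up to \<open>c^-N\<close> and
  \<open>c^N\<close> with \<open>c = \<gamma> = r^2\<close>; these are the eigenvalues of
  \<open>\<psi>_0^+\<close> and \<open>\<psi>_0^-\<close>.\<close>

lemma xp_xm_commutator:
  assumes "u \<noteq> 0"
  shows "vop (u * r powi (3 * N)) N xp_a xp_b x (vop (1 / u * r powi (- 3 * N)) (- N) xm_a xm_b y v)
      - vop (1 / u * r powi (- 3 * N)) (- N) xm_a xm_b y (vop (u * r powi (3 * N)) N xp_a xp_b x v) =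
    fock_const ((1 - q) * (1 - 1 / t) / (1 - q / t)) *
      (fock_const ((1 / r\<^sup>2) powi x) * vop (r powi (- 2 * N)) 0 pp_a pp_b (x + y) v
     - fock_const ((r\<^sup>2) powi x) * (fock_const ((1 / r\<^sup>2) powi (x + y)) * vop (r powi (2 * N)) 0 pm_a pm_b (x + y) v))"
proof -
  have c: "r\<^sup>2 \<noteq> 0"
    using r0 by simp
  have k: "u * r powi (3 * N) * (1 / u * r powi (- 3 * N)) = 1"
    using assms r0 by (simp add: power_int_minus)
  have k1: "u * r powi (3 * N) * (1 / u * r powi (- 3 * N)) * (r\<^sup>2) powi (- N) = r powi (- 2 * N)"
    unfolding k by (simp add: power_int_minus power_int_mult)
  have k2: "u * r powi (3 * N) * (1 / u * r powi (- 3 * N)) * (1 / r\<^sup>2) powi (- N) = r powi (2 * N)"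
    unfolding k by (simp add: power_int_minus power_int_mult power_int_divide_distrib)
  have inv: "(r\<^sup>2) powi (- x) = (1 / r\<^sup>2) powi x" "(1 / r\<^sup>2) powi (- x) = (r\<^sup>2) powi x"
    by (simp_all add: power_int_minus power_int_divide_distrib divide_inverse power_int_inverse)
  have 1: "vop (r powi (- 2 * N)) 0 (\<lambda>m. (r\<^sup>2) ^ m * xp_a m + xm_a m) (\<lambda>m. (1 / r\<^sup>2) ^ m * xp_b m + xm_b m) (x + y) v =
    vop (r powi (- 2 * N)) 0 pp_a pp_b (x + y) v"
    by (rule vop_cong) (simp_all add: merge_coeff)
  \<comment> \<open>The second delta function yields the operator at \<open>w / \<gamma>\<close>;
    rescaling by \<open>1 / r^2\<close> supplies the power \<open>(1 / r^2)\<close> to the total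
    degree.\<close>
  have "vop (r powi (2 * N)) 0 (\<lambda>m. (1 / r\<^sup>2) ^ m * xp_a m + xm_a m) (\<lambda>m. (r\<^sup>2) ^ m * xp_b m + xm_b m) (x + y) v =
    vop (r powi (2 * N)) 0 (\<lambda>m. (1 / r\<^sup>2) ^ m * pm_a m) (\<lambda>m. (1 / (1 / r\<^sup>2)) ^ m * pm_b m) (x + y) v"
    by (rule vop_cong) (use merge_coeff(3,4) in simp_all)
  also have "\<dots> = fock_const ((1 / r\<^sup>2) powi (x + y)) * vop (r powi (2 * N)) 0 pm_a pm_b (x + y) v"
    by (rule vop_rescale) (use c in simp)
  finally have 2: "vop (r powi (2 * N)) 0 (\<lambda>m. (1 / r\<^sup>2) ^ m * xp_a m + xm_a m) (\<lambda>m. (r\<^sup>2) ^ m * xp_b m + xm_b m) (x + y) v =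
    fock_const ((1 / r\<^sup>2) powi (x + y)) * vop (r powi (2 * N)) 0 pm_a pm_b (x + y) v" .
  show ?thesis
    by (subst vop_commutator[OF c contraction_mixed contraction_mixed_nth]) (simp_all only: k1 k2 inv 1 2)
qed

end

theorem theorem3p2:
  fixes q t p r u :: complex and N :: int
  assumes "q \<noteq> 0" and "t \<noteq> 0"
    and "\<forall>n::nat. n > 0 \<longrightarrow> q ^ n \<noteq> 1"
    and "\<forall>n::nat. n > 0 \<longrightarrow> t ^ n \<noteq> 1"
    and "\<forall>n::nat. n > 0 \<longrightarrow> (q / t) ^ n \<noteq> 1"
    and "r ^ 4 = t / q"
    and "p \<noteq> 0" and "norm p < 1" and "norm (p * q / t) < 1"
    and "u \<noteq> 0"
  shows "elliptic_toroidal_module fock_scale q t p r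
           (fock_scale r) (fock_scale (r powi (- 2 * N))) (fock_scale (r powi (2 * N)))
           (fock_alpha q t p) (fock_xp q t p r u N) (fock_xm q t p r u N)
       \<and> has_level fock_scale r (fock_scale r) (fock_scale (r powi (- 2 * N))) 1 N
       \<and> (\<forall>a f. psi_plus fock_scale p r (fock_scale (r powi (- 2 * N))) (fock_alpha q t p) a f
                = fock_psi_plus q t p r N a f)
       \<and> (\<forall>a f. psi_minus fock_scale p r (fock_scale (r powi (2 * N))) (fock_alpha q t p) a f
                = fock_psi_minus q t p r N a f)"
proof -
  interpret fock_parameters q t p r
    by unfold_locales (use assms in auto)
  have xp: "current (fock_xp q t p r u N) = vop (u * r powi (3 * N)) N xp_a xp_b"
    by (simp add: fun_eq_iff current_def fock_xp_eq)
  have xm: "current (fock_xm q t p r u N) = vop (1 / u * r powi (- 3 * N)) (- N) xm_a xm_b"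
    by (simp add: fun_eq_iff current_def fock_xm_eq)
  have scale_bij: "bij (fock_scale c)" if "c \<noteq> 0" for c
    by (rule bij_betw_byWitness[where f' = "fock_scale (1 / c)"])
       (use that in \<open>auto simp: fock_scale_eq mult.assoc[symmetric] fock_const_mult[symmetric]\<close>)
  have alpha_scale: "fock_scale c (fock_alpha q t p m v) = fock_alpha q t p m (fock_scale c v)" for c m v
    by (simp add: fock_alpha_def fock_scale_eq fock_pderiv_const_mult mult.left_commute)
  have vop_scale: "fock_scale c (vop \<kappa> s a b e v) = vop \<kappa> s a b e (fock_scale c v)" for c \<kappa> s a b e v
    by (simp add: fock_scale_eq vop_const_mult)
  have xp': "fock_xp q t p r u N n = vop (u * r powi (3 * N)) N xp_a xp_b (- n)" for n
    by (simp add: fun_eq_iff fock_xp_eq)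
  have xm': "fock_xm q t p r u N n = vop (1 / u * r powi (- 3 * N)) (- N) xm_a xm_b (- n)" for n
    by (simp add: fun_eq_iff fock_xm_eq)
  interpret vector_space fock_scale
    by (rule vector_space_fock_scale)
  have "elliptic_toroidal_module fock_scale q t p r
           (fock_scale r) (fock_scale (r powi (- 2 * N))) (fock_scale (r powi (2 * N)))
           (fock_alpha q t p) (fock_xp q t p r u N) (fock_xm q t p r u N)"
  proof
    show "r \<noteq> 0" "p \<noteq> 0" "norm p < 1" "norm (p / r ^ 4) < 1"
      using r0 p0 norm_p norm_pstar by (simp_all only: power_facts(5)) simp_all
    show "bij (fock_scale (r powi (- 2 * N)))" "bij (fock_scale (r powi (2 * N)))"
      using r0 by (simp_all add: scale_bij)
    show "\<exists>d. \<forall>ms. (\<forall>m\<in>set ms. m > 0) \<and> sum_list ms \<ge> d \<longrightarrow> foldr (fock_alpha q t p) ms v = 0" for v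
      by (rule fock_alpha_smooth)
    show "\<exists>d. \<forall>n\<ge>d. fock_xp q t p r u N n v = 0" "\<exists>d. \<forall>n\<ge>d. fock_xm q t p r u N n v = 0" for v
      unfolding xp' xm' by (rule vop_smooth)+
    show "fock_alpha q t p m (fock_alpha q t p n v) - fock_alpha q t p n (fock_alpha q t p m v) =
      fock_scale (if m + n = 0
             then - (kappa q t m / of_int m) * ((r\<^sup>2) powi m - (r\<^sup>2) powi (- m)) * (r\<^sup>2) powi (- m)
                  * ((1 - p powi m) / (1 - (p / r ^ 4) powi m))
             else 0) v" if "m \<noteq> 0" "n \<noteq> 0" for m n v
      using that by (rule fock_alpha_commutator)
    show "fock_alpha q t p m (current (fock_xp q t p r u N) a v) - current (fock_xp q t p r u N) a (fock_alpha q t p m v) =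
      fock_scale (- (kappa q t m / of_int m) * ((1 - p powi m) / (1 - (p / r ^ 4) powi m)) * r powi (- 3 * m))
        (current (fock_xp q t p r u N) (a - m) v)" if "m \<noteq> 0" for m a v
    proof (cases rule: int_cases_nonzero[OF that])
      case (1 k)
      then show ?thesis
        using alpha_relation_coeff(1)[OF 1(1)] by (simp add: xp fock_alpha_vop fock_scale_eq)
    next
      case (2 k)
      then show ?thesis
        using alpha_relation_coeff(2)[OF 2(1)] fock_alpha_vop(2)[OF 2(1), of "u * r powi (3 * N)" N xp_a xp_b a v]
        by (simp only: xp fock_scale_eq diff_minus_eq_add)
    qed
    show "fock_alpha q t p m (current (fock_xm q t p r u N) a v) - current (fock_xm q t p r u N) a (fock_alpha q t p m v) =
      fock_scale (kappa q t m / of_int m * r powi (- m)) (current (fock_xm q t p r u N) (a - m) v)" if "m \<noteq> 0" for m a v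
    proof (cases rule: int_cases_nonzero[OF that])
      case (1 k)
      then show ?thesis
        using alpha_relation_coeff(3)[OF 1(1)] by (simp add: xm fock_alpha_vop fock_scale_eq)
    next
      case (2 k)
      then show ?thesis
        using alpha_relation_coeff(4)[OF 2(1)] fock_alpha_vop(2)[OF 2(1), of "1 / u * r powi (- 3 * N)" "- N" xm_a xm_b a v]
        by (simp only: xm fock_scale_eq diff_minus_eq_add)
    qed
    show "current (fock_xp q t p r u N) a (current (fock_xm q t p r u N) b v) -
        current (fock_xm q t p r u N) b (current (fock_xp q t p r u N) a v) =
      fock_scale ((1 - q) * (1 - 1 / t) / (1 - q / t))
        (delta_mult fock_scale (1 / r\<^sup>2) (\<lambda>e. psi_plus fock_scale p r (fock_scale (r powi (- 2 * N))) (fock_alpha q t p) e v) a b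
         - delta_mult fock_scale (r\<^sup>2) (\<lambda>e. fock_scale ((1 / r\<^sup>2) powi e)
             (psi_minus fock_scale p r (fock_scale (r powi (2 * N))) (fock_alpha q t p) e v)) a b)" for a b v
      unfolding xp xm psi_plus_eq psi_minus_eq delta_mult_def fock_scale_eq xp_xm_commutator[OF \<open>u \<noteq> 0\<close>] ..
    show "ratio_mult fock_scale (G_series q t * g_series q t (p / r ^ 4)) (current (fock_xp q t p r u N)) v (a - 3) b =
      - ratio_mult fock_scale (G_series q t * g_series q t (p / r ^ 4)) (current (fock_xp q t p r u N)) v (b - 3) a" for a b v
      unfolding xp by (rule exchange_relation[OF q0 t0 contraction_xp])
    \<comment> \<open>For the negative current the general relations are applied with
      \<open>1/q\<close> and \<open>1/t\<close> in place of \<open>q\<close> and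
      \<open>t\<close>.\<close>
    show "ratio_mult fock_scale (G_series (1 / q) (1 / t) * inverse (g_series q t p)) (current (fock_xm q t p r u N)) v (a - 3) b =
      - ratio_mult fock_scale (G_series (1 / q) (1 / t) * inverse (g_series q t p)) (current (fock_xm q t p r u N)) v (b - 3) a" for a b v
      unfolding xm by (rule exchange_relation[OF _ _ contraction_xm]) (use q0 t0 in simp_all)
    show "serre_sum fock_scale (g_series q t (p / r ^ 4)) (current (fock_xp q t p r u N)) v a b e = 0" for a b e v
      unfolding xp by (rule serre_relation[OF contraction_xp])
    show "serre_sum fock_scale (inverse (g_series q t p)) (current (fock_xm q t p r u N)) v a b e = 0" for a b e v
      unfolding xm by (rule serre_relation[OF contraction_xm])
  \<comment> \<open>The remaining axioms are linearity and the centrality of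
    \<open>\<psi>_0^+\<close> and \<open>\<psi>_0^-\<close>, which act by scalars.\<close>
  qed (simp_all only: xp' xm' scale_right_distrib fock_alpha_add vop_add alpha_scale vop_scale scale_left_commute)
  moreover have "has_level fock_scale r (fock_scale r) (fock_scale (r powi (- 2 * N))) 1 N"
    by (simp add: has_level_def)
  ultimately show ?thesis
    by (simp only: psi_plus_fock psi_minus_fock simp_thms)
qed

end
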